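(* The dock re-allocation problem $\mathrm{DR}$ can be solved (i.e., an optimal solution can be computed) by an algorithm running in $O\bigl(n^2\log n\,\log((D+B)/n)\bigr)$ time.
   Context: Let $n\ge 1$ and $N=\{1,\dots,n\}$. For $y\in\mathbb{R}^n$ and $X\subseteq N$ write $y(X)=\sum_{i\in X}y(i)$. Given are vectors $\bar d,\bar b\in\mathbb{Z}^n_+$ with $D=\bar d(N)$, $B=\bar b(N)$, a positive integer $\gamma$, integer vectors $\ell,u\in\mathbb{Z}^n$, and for each $i\in N$ a multimodular function $c_i:\mathbb{Z}^2_+\to\mathbb{R}$, meaning that for integers $\alpha,\beta$: (1) $c_i(\alpha+1,\beta+1)-c_i(\alpha+1,\beta)\ge c_i(\alpha,\beta+1)-c_i(\alpha,\beta)$ for $\alpha,\beta\ge 0$; (2) $c_i(\alpha-1,\beta+1)-c_i(\alpha-1,\beta)\ge c_i(\alpha,\beta)-c_i(\alpha,\beta-1)$ for $\alpha,\beta\ge 1$; (3) $c_i(\alpha+1,\beta-1)-c_i(\alpha,\beta-1)\ge c_i(\alpha,\beta)-c_i(\alpha-1,\beta)$ for $\alpha,\beta\ge1$. Problem $\mathrm{DR}$: minimize $c(d,b)=\sum_{i=1}^n c_i(d(i),b(i))$ over $d,b\in\mathbb{Z}^n_+$ subject to $d(N)+b(N)=D+B$, $b(N)\le B$, $\|(d+b)-(\bar d+\bar b)\|_1\le 2\gamma$, and $\ell\le d+b\le u$ (componentwise). The problem is assumed to be feasible. Computational conventions: time is the number of elementary steps, where arithmetic operations and comparisons, and each evaluation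 of a function value $c_i(\alpha,\beta)$ (given by an oracle), take constant time; logarithmic factors in the bound are read as being at least $1$. *)

theory Defs
  imports Complex_Main
begin

section \<open>The dock re-allocation problem\<close>

text \<open>
  Vectors in \<open>\<int>\<^sup>n\<close> are functions \<^typ>\<open>nat \<Rightarrow> int\<close> of which only the entries with index in
  \<open>{1..n}\<close> are relevant. The functions \<open>c\<^sub>i\<close> have domain \<open>\<int>\<^sub>+\<^sup>2\<close>: all conditions below refer to
  nonnegative arguments only, so that the values of \<open>cfun I i\<close> at other arguments are arbitrary.
\<close>

record instance_DR =
  nstations :: nat
  dbar :: "nat \<Rightarrow> int"
  bbar :: "nat \<Rightarrow> int"
  gam :: int
  lo :: "nat \<Rightarrow> int"
  up :: "nat \<Rightarrow> int"
  cfun :: "nat \<Rightarrow> int \<Rightarrow> int \<Rightarrow> real"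

definition multimodular :: "(int \<Rightarrow> int \<Rightarrow> real) \<Rightarrow> bool" where
  "multimodular c \<longleftrightarrow>
    (\<forall>\<alpha> \<beta>. \<alpha> \<ge> 0 \<and> \<beta> \<ge> 0 \<longrightarrow>
       c (\<alpha> + 1) (\<beta> + 1) - c (\<alpha> + 1) \<beta> \<ge> c \<alpha> (\<beta> + 1) - c \<alpha> \<beta>) \<and>
    (\<forall>\<alpha> \<beta>. \<alpha> \<ge> 1 \<and> \<beta> \<ge> 1 \<longrightarrow>
       c (\<alpha> - 1) (\<beta> + 1) - c (\<alpha> - 1) \<beta> \<ge> c \<alpha> \<beta> - c \<alpha> (\<beta> - 1)) \<and>
    (\<forall>\<alpha> \<beta>. \<alpha> \<ge> 1 \<and> \<beta> \<ge> 1 \<longrightarrow>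
       c (\<alpha> + 1) (\<beta> - 1) - c \<alpha> (\<beta> - 1) \<ge> c \<alpha> \<beta> - c (\<alpha> - 1) \<beta>)"

definition Dtot :: "instance_DR \<Rightarrow> int" where
  "Dtot I = (\<Sum>i = 1..nstations I. dbar I i)"

definition Btot :: "instance_DR \<Rightarrow> int" where
  "Btot I = (\<Sum>i = 1..nstations I. bbar I i)"

definition feasible_DR :: "instance_DR \<Rightarrow> (nat \<Rightarrow> int) \<Rightarrow> (nat \<Rightarrow> int) \<Rightarrow> bool" where
  "feasible_DR I d b \<longleftrightarrow>
    (\<forall>i\<in>{1..nstations I}. d i \<ge> 0 \<and> b i \<ge> 0) \<and>
    (\<Sum>i = 1..nstations I. d i) + (\<Sum>i = 1..nstations I. b i) = Dtot I + Btot I \<and>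
    (\<Sum>i = 1..nstations I. b i) \<le> Btot I \<and>
    (\<Sum>i = 1..nstations I. \<bar>(d i + b i) - (dbar I i + bbar I i)\<bar>) \<le> 2 * gam I \<and>
    (\<forall>i\<in>{1..nstations I}. lo I i \<le> d i + b i \<and> d i + b i \<le> up I i)"

definition objective_DR :: "instance_DR \<Rightarrow> (nat \<Rightarrow> int) \<Rightarrow> (nat \<Rightarrow> int) \<Rightarrow> real" where
  "objective_DR I d b = (\<Sum>i = 1..nstations I. cfun I i (d i) (b i))"

definition optimal_DR :: "instance_DR \<Rightarrow> (nat \<Rightarrow> int) \<Rightarrow> (nat \<Rightarrow> int) \<Rightarrow> bool" where
  "optimal_DR I d b \<longleftrightarrow> feasible_DR I d b \<and>
    (\<forall>d' b'. feasible_DR I d' b' \<longrightarrow> objective_DR I d b \<le> objective_DR I d' b')"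

definition valid_DR :: "instance_DR \<Rightarrow> bool" where
  "valid_DR I \<longleftrightarrow>
    nstations I \<ge> 1 \<and> (\<forall>i\<in>{1..nstations I}. dbar I i \<ge> 0 \<and> bbar I i \<ge> 0) \<and> gam I \<ge> 1 \<and>
    (\<forall>i\<in>{1..nstations I}. multimodular (cfun I i)) \<and> (\<exists>d b. feasible_DR I d b)"

section \<open>Algorithms and their running time\<close>

text \<open>
  Algorithms are programs of a while-language with arrays. Integers and reals live in separate
  arrays; a scalar variable is cell 0 of an array. Integers can be converted to reals, but reals
  influence integers only through comparisons (there is no rounding), and the only constants are
  integers. The functions \<open>c\<^sub>i\<close> are accessible only through the expression \<open>Query\<close>. Each constant,
  array access, arithmetic operation, comparison, Boolean connective, oracle call and assignment is
  one elementary step.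
\<close>

datatype iexp =
    IConst int
  | IRead string iexp
  | IAdd iexp iexp
  | ISub iexp iexp
  | IMul iexp iexp
  | IDiv iexp iexp

datatype rexp =
    ROfInt iexp
  | RRead string iexp
  | RAdd rexp rexp
  | RSub rexp rexp
  | RMul rexp rexp
  | RDiv rexp rexp
  | Query iexp iexp iexp

datatype bexp =
    ILe iexp iexp
  | RLe rexp rexp
  | BNot bexp
  | BAnd bexp bexp

datatype com =
    Skip
  | IAssign string iexp iexp
  | RAssign string iexp rexp
  | Seq com com
  | Cond bexp com com
  | While bexp com

record state =
  imem :: "string \<Rightarrow> int \<Rightarrow> int"
  rmem :: "string \<Rightarrow> int \<Rightarrow> real"

type_synonym oracle_fun = "nat \<Rightarrow> int \<Rightarrow> int \<Rightarrow> real"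

text \<open>\<open>IDiv\<close> is division rounded down; division by zero yields zero.\<close>

fun ival :: "state \<Rightarrow> iexp \<Rightarrow> int" where
  "ival s (IConst k) = k"
| "ival s (IRead x e) = imem s x (ival s e)"
| "ival s (IAdd e1 e2) = ival s e1 + ival s e2"
| "ival s (ISub e1 e2) = ival s e1 - ival s e2"
| "ival s (IMul e1 e2) = ival s e1 * ival s e2"
| "ival s (IDiv e1 e2) = ival s e1 div ival s e2"

fun rval :: "oracle_fun \<Rightarrow> state \<Rightarrow> rexp \<Rightarrow> real" where
  "rval c s (ROfInt e) = of_int (ival s e)"
| "rval c s (RRead x e) = rmem s x (ival s e)"
| "rval c s (RAdd e1 e2) = rval c s e1 + rval c s e2"
| "rval c s (RSub e1 e2) = rval c s e1 - rval c s e2"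
| "rval c s (RMul e1 e2) = rval c s e1 * rval c s e2"
| "rval c s (RDiv e1 e2) = rval c s e1 / rval c s e2"
| "rval c s (Query e e1 e2) = c (nat (ival s e)) (ival s e1) (ival s e2)"

fun bval :: "oracle_fun \<Rightarrow> state \<Rightarrow> bexp \<Rightarrow> bool" where
  "bval c s (ILe e1 e2) \<longleftrightarrow> ival s e1 \<le> ival s e2"
| "bval c s (RLe e1 e2) \<longleftrightarrow> rval c s e1 \<le> rval c s e2"
| "bval c s (BNot e) \<longleftrightarrow> \<not> bval c s e"
| "bval c s (BAnd e1 e2) \<longleftrightarrow> bval c s e1 \<and> bval c s e2"

fun itime :: "iexp \<Rightarrow> nat" where
  "itime (IConst k) = 1"
| "itime (IRead x e) = itime e + 1"
| "itime (IAdd e1 e2) = itime e1 + itime e2 + 1"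
| "itime (ISub e1 e2) = itime e1 + itime e2 + 1"
| "itime (IMul e1 e2) = itime e1 + itime e2 + 1"
| "itime (IDiv e1 e2) = itime e1 + itime e2 + 1"

fun rtime :: "rexp \<Rightarrow> nat" where
  "rtime (ROfInt e) = itime e + 1"
| "rtime (RRead x e) = itime e + 1"
| "rtime (RAdd e1 e2) = rtime e1 + rtime e2 + 1"
| "rtime (RSub e1 e2) = rtime e1 + rtime e2 + 1"
| "rtime (RMul e1 e2) = rtime e1 + rtime e2 + 1"
| "rtime (RDiv e1 e2) = rtime e1 + rtime e2 + 1"
| "rtime (Query e e1 e2) = itime e + itime e1 + itime e2 + 1"

fun btime :: "bexp \<Rightarrow> nat" where
  "btime (ILe e1 e2) = itime e1 + itime e2 + 1"
| "btime (RLe e1 e2) = rtime e1 + rtime e2 + 1"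
| "btime (BNot e) = btime e + 1"
| "btime (BAnd e1 e2) = btime e1 + btime e2 + 1"

definition iwrite :: "string \<Rightarrow> int \<Rightarrow> int \<Rightarrow> state \<Rightarrow> state" where
  "iwrite x k v s = s\<lparr>imem := (imem s)(x := (imem s x)(k := v))\<rparr>"

definition rwrite :: "string \<Rightarrow> int \<Rightarrow> real \<Rightarrow> state \<Rightarrow> state" where
  "rwrite x k v s = s\<lparr>rmem := (rmem s)(x := (rmem s x)(k := v))\<rparr>"

text \<open>\<open>exec c P s t s'\<close>: with oracle \<open>c\<close>, the program \<open>P\<close> started in state \<open>s\<close> terminates in
  state \<open>s'\<close> after exactly \<open>t\<close> elementary steps.\<close>

inductive exec :: "oracle_fun \<Rightarrow> com \<Rightarrow> state \<Rightarrow> nat \<Rightarrow> state \<Rightarrow> bool" for c where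
  Skip: "exec c Skip s 1 s"
| IAssign: "exec c (IAssign x e a) s (itime e + itime a + 1) (iwrite x (ival s e) (ival s a) s)"
| RAssign: "exec c (RAssign x e a) s (itime e + rtime a + 1) (rwrite x (ival s e) (rval c s a) s)"
| Seq: "exec c P s t s' \<Longrightarrow> exec c Q s' t' s'' \<Longrightarrow> exec c (Seq P Q) s (t + t') s''"
| CondTrue: "bval c s e \<Longrightarrow> exec c P s t s' \<Longrightarrow> exec c (Cond e P Q) s (btime e + t + 1) s'"
| CondFalse: "\<not> bval c s e \<Longrightarrow> exec c Q s t s' \<Longrightarrow> exec c (Cond e P Q) s (btime e + t + 1) s'"
| WhileFalse: "\<not> bval c s e \<Longrightarrow> exec c (While e P) s (btime e + 1) s"
| WhileTrue: "bval c s e \<Longrightarrow> exec c P s t s' \<Longrightarrow> exec c (While e P) s' t' s'' \<Longrightarrow>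
    exec c (While e P) s (btime e + t + t' + 1) s''"


lemma exec_deterministic:
  "exec c P s t s' \<Longrightarrow> exec c P s u s'' \<Longrightarrow> t = u \<and> s' = s''"
proof (induction arbitrary: u s'' rule: exec.induct)
  case (Skip s)
  then show ?case by cases simp
next
  case (IAssign x e a s)
  then show ?case by cases simp
next
  case (RAssign x e a s)
  then show ?case by cases simp
next
  case (Seq P s t s' Q t' s1)
  from Seq.prems show ?case
    by cases (metis Seq.IH)
next
  case (CondTrue s e P t s' Q)
  from CondTrue.prems show ?case
    by cases (metis CondTrue.hyps(1) CondTrue.IH)+
next
  case (CondFalse s e Q t s' P)
  from CondFalse.prems show ?case
    by cases (metis CondFalse.hyps(1) CondFalse.IH)+
next
  case (WhileFalse s e P)
  from WhileFalse.prems show ?case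
    by cases (use WhileFalse.hyps in simp_all)
next
  case (WhileTrue s e P t s' t' s1)
  from WhileTrue.prems show ?case
    by cases (metis WhileTrue.hyps(1) WhileTrue.IH)+
qed

text \<open>The input occupies the cells below; all other cells, including those of the vectors outside
  \<open>{1..n}\<close>, are initially 0.\<close>

definition input_vec :: "nat \<Rightarrow> (nat \<Rightarrow> int) \<Rightarrow> int \<Rightarrow> int" where
  "input_vec n v k = (if 1 \<le> k \<and> k \<le> int n then v (nat k) else 0)"

definition input_DR :: "instance_DR \<Rightarrow> state" where
  "input_DR I = \<lparr>
     imem = (\<lambda>_ _. 0)(
       ''n'' := (\<lambda>_. 0)(0 := int (nstations I)),
       ''gamma'' := (\<lambda>_. 0)(0 := gam I),
       ''dbar'' := input_vec (nstations I) (dbar I),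
       ''bbar'' := input_vec (nstations I) (bbar I),
       ''l'' := input_vec (nstations I) (lo I),
       ''u'' := input_vec (nstations I) (up I)),
     rmem = (\<lambda>_ _. 0)\<rparr>"

definition output_vec :: "state \<Rightarrow> string \<Rightarrow> nat \<Rightarrow> int" where
  "output_vec s x i = imem s x (int i)"

text \<open>Logarithmic factors in running times are read as at least 1.\<close>

definition logfac :: "real \<Rightarrow> real" where
  "logfac x = max 1 (log 2 x)"

end

theory Submission
  imports Defs
begin

text \<open>The problem is a flow problem on four nodes. Replace the target \<open>dbar i + bbar i\<close> of a station by its
projection \<open>mid i\<close> to the interval of admissible dock numbers. A station with \<open>d\<close> empty docks and \<open>b\<close>
bikes has \<open>x = d + b\<close> docks; book \<open>e \<ge> max 0 (x - mid i)\<close> of them as additional ones and describe the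
station by the vector \<open>(e - x, - e, d, b)\<close>, whose entries sum to 0. Since both \<open>x\<close> and the targets sum
to \<open>D + B\<close>, the bound on the distance says that the numbers \<open>e\<close> can be chosen with sum at most \<open>slack I\<close>. So, after one
cost-free dummy station has been added to take up the slack of this bound and of the bound on the bikes,
a feasible solution is a choice of one vector per station with prescribed totals in the four nodes.
By multimodularity every station cost satisfies the exchange axiom of M-convex functions in the four
coordinates (lemma \<open>exchange_cost\<close>). If real prices of the four nodes are such that every station minimises
its own priced cost, and the totals are as prescribed, the solution is optimal (\<open>optimal_certificate\<close>).

Such prices are found by capacity scaling with successive shortest paths. The vectors move in steps of \<open>\<Delta>\<close>, a
power of two that is halved in every phase until it is 1, and every station is kept optimal on its
\<open>\<Delta>\<close>-grid for the current prices.
When \<open>\<Delta>\<close> is halved, the exchange property puts a new optimum of the station within three steps of the old one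
in each coordinate (\<open>grid_opt_proximity\<close>), so a search of 343 points re-optimises the station. Then units of \<open>\<Delta>\<close>
are pushed from nodes with excess at least \<open>\<Delta>\<close> to nodes with deficit at least \<open>\<Delta>\<close>. A search tree is grown from the
excess nodes by raising the prices of the nodes reached until an arc to a new node becomes tight; an arc
here is a possible move of one station. Because ties are broken in favour of the tail reached first, the path found has no
shortcut by a tight arc, and the exchange axiom then shows that all stations stay optimal when the path is
augmented, even if a station occurs on it several times (\<open>push_arcs\<close>). If the search gets stuck, the nodes
reached form a set that no station can leave; comparing with any feasible solution, rounded to the grid,
bounds the remaining surplus by \<open>(12 N + 8) (\<Delta> - 1)\<close> for \<open>N\<close> stations (\<open>stuck_surplus\<close>). Thus a phase starts
with a surplus of at most \<open>60 N \<Delta>\<close>, needs at most \<open>60 N\<close> augmentations, and for \<open>\<Delta> = 1\<close> ends with none.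

An augmentation scans at most \<open>64 N\<close> arcs, four rounds of \<open>16 N\<close>, so a phase takes \<open>O(n^2)\<close> steps. The
number of phases is 1 if \<open>D + B \<le> 1\<close> and otherwise at most
\<open>1 + log (D + B) = 1 + log n + log ((D + B) / n)\<close>; as both factors are read as at least 1, this is at most three times
their product (\<open>phase_count\<close>).\<close>

section \<open>Multimodular functions of two variables\<close>

lemma multimodular_swap_args: "multimodular f \<Longrightarrow> multimodular (\<lambda>a b. f b a)"
  unfolding multimodular_def by (auto simp: algebra_simps)

lemma multimodular_D:
  assumes "multimodular f"
  shows "a \<ge> 0 \<Longrightarrow> b \<ge> 0 \<Longrightarrow> f (a+1) (b+1) - f (a+1) b \<ge> f a (b+1) - f a b"
    and "a \<ge> 1 \<Longrightarrow> b \<ge> 1 \<Longrightarrow> f (a-1) (b+1) - f (a-1) b \<ge> f a b - f a (b-1)"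
    and "a \<ge> 1 \<Longrightarrow> b \<ge> 1 \<Longrightarrow> f (a+1) (b-1) - f a (b-1) \<ge> f a b - f (a-1) b"
  using assms unfolding multimodular_def by blast+

text \<open>The defining inequalities make the marginal cost of a unit of the first kind monotone in the directions
\<open>(0,1)\<close> and \<open>(1,-1)\<close>, hence on the cone they generate. The path chosen by the induction zigzags in order not to
leave the quadrant, where nothing is known about \<open>f\<close>.\<close>

lemma multimodular_unit_d:
  assumes mm: "multimodular f" and "0 \<le> a" "a \<le> a'" "0 \<le> b" "0 \<le> b'" "a + b \<le> a' + b'"
  shows "f (a+1) b - f a b \<le> f (a'+1) b' - f a' b'"
  using assms(2-)
proof (induction "nat (a' - a) + nat (a' + b' - a - b)" arbitrary: a b rule: less_induct)
  case less
  have up: "f (a+1) b - f a b \<le> f (a+1) (b+1) - f a (b+1)"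
    using multimodular_D(1)[OF mm, of a b] less.prems by simp
  show ?case
  proof (cases "a = a'")
    case True
    show ?thesis
    proof (cases "b = b'")
      case False
      then have "f (a+1) (b+1) - f a (b+1) \<le> f (a'+1) b' - f a' b'"
        using less.prems True by (intro less.hyps) auto
      with up show ?thesis by linarith
    qed (use True in simp)
  next
    case False
    show ?thesis
    proof (cases "b \<ge> 1")
      case True
      have "f (a+1) b - f a b \<le> f (a+1+1) (b-1) - f (a+1) (b-1)"
        using multimodular_D(3)[OF mm, of "a+1" b] True less.prems by simp
      also have "\<dots> \<le> f (a'+1) b' - f a' b'"
        using less.prems True False by (intro less.hyps) auto
      finally show ?thesis .
    next
      case F2: False
      have "f (a+1) (b+1) - f a (b+1) \<le> f (a+1+1) b - f (a+1) b"
        using multimodular_D(3)[OF mm, of "a+1" "b+1"] F2 less.prems by simp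
      also have "\<dots> \<le> f (a'+1) b' - f a' b'"
        using less.prems F2 False by (intro less.hyps) auto
      finally show ?thesis using up by linarith
    qed
  qed
qed

text \<open>Telescoping unit steps. In this form multimodularity makes no reference to a grid, which is why one
exchange lemma serves all step sizes.\<close>

lemma multimodular_step_d_nat:
  assumes mm: "multimodular f" and "0 \<le> a" "a \<le> a'" "0 \<le> b" "0 \<le> b'" "a + b \<le> a' + b'"
  shows "f (a + int s) b - f a b \<le> f (a' + int s) b' - f a' b'"
proof (induction s)
  case (Suc s)
  have "f (a + int s + 1) b - f (a + int s) b \<le> f (a' + int s + 1) b' - f (a' + int s) b'"
    using assms by (intro multimodular_unit_d[OF mm]) auto
  then show ?case using Suc by (simp add: algebra_simps)
qed simp

lemma multimodular_step_d:
  assumes mm: "multimodular f" and "0 \<le> a" "a \<le> a'" "0 \<le> b" "0 \<le> b'" "a + b \<le> a' + b'" "0 \<le> s"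
  shows "f (a + s) b - f a b \<le> f (a' + s) b' - f a' b'"
  using multimodular_step_d_nat[OF assms(1-6), of "nat s"] assms by simp

lemma multimodular_step_b:
  assumes mm: "multimodular f" and "0 \<le> b" "b \<le> b'" "0 \<le> a" "0 \<le> a'" "a + b \<le> a' + b'" "0 \<le> s"
  shows "f a (b + s) - f a b \<le> f a' (b' + s) - f a' b'"
  using multimodular_step_d[OF multimodular_swap_args[OF mm], of b b' a a' s] assms
  by (simp add: add.commute)

lemma multimodular_unit_swap:
  assumes mm: "multimodular f" and "1 \<le> a'" "a' \<le> a" "0 \<le> b" "b \<le> b'"
  shows "f (a-1) (b+1) - f a b \<le> f (a'-1) (b'+1) - f a' b'"
  using assms(2-)
proof (induction "nat (a - a') + nat (b' - b)" arbitrary: a b rule: less_induct)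
  case less
  show ?case
  proof (cases "b = b'")
    case False
    have "f (a-1) (b+1) - f a b \<le> f (a-1) (b+1+1) - f a (b+1)"
      using multimodular_D(2)[OF mm, of a "b+1"] less.prems by simp
    also have "\<dots> \<le> f (a'-1) (b'+1) - f a' b'"
      using less.prems False by (intro less.hyps) auto
    finally show ?thesis .
  next
    case b: True
    show ?thesis
    proof (cases "a = a'")
      case False
      have "f (a-1) (b+1) - f a b \<le> f (a-1-1) (b+1) - f (a-1) b"
        using multimodular_D(3)[OF mm, of "a-1" "b+1"] less.prems False by simp
      also have "\<dots> \<le> f (a'-1) (b'+1) - f a' b'"
        using less.prems False by (intro less.hyps) auto
      finally show ?thesis .
    qed (use b in simp)
  qed
qed

lemma multimodular_step_swap_nat:
  assumes mm: "multimodular f" and "int s \<le> a'" "a' \<le> a" "0 \<le> b" "b \<le> b'"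
  shows "f (a - int s) (b + int s) - f a b \<le> f (a' - int s) (b' + int s) - f a' b'"
  using assms(2-)
proof (induction s)
  case (Suc s)
  have "f (a - int s - 1) (b + int s + 1) - f (a - int s) (b + int s)
      \<le> f (a' - int s - 1) (b' + int s + 1) - f (a' - int s) (b' + int s)"
    using Suc.prems by (intro multimodular_unit_swap[OF mm]) auto
  then show ?case using Suc by (simp add: algebra_simps)
qed simp

lemma multimodular_step_swap:
  assumes mm: "multimodular f" and "s \<le> a'" "a' \<le> a" "0 \<le> b" "b \<le> b'" "0 \<le> s"
  shows "f (a - s) (b + s) - f a b \<le> f (a' - s) (b' + s) - f a' b'"
  using multimodular_step_swap_nat[OF mm, of "nat s"] assms by simp

section \<open>Stations as functions on four resource nodes\<close>

definition move :: "(int \<Rightarrow> int) \<Rightarrow> int \<Rightarrow> int \<Rightarrow> int \<Rightarrow> int \<Rightarrow> int" where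
  "move y u v s = (\<lambda>k. y k - (if k = u then s else 0) + (if k = v then s else 0))"

abbreviation nodes :: "int set" where "nodes \<equiv> {0..3}"

lemma nodes_eq: "nodes = {0,1,2,3}" by auto

lemma ball_nodes: "(\<forall>k\<in>nodes. P k) \<longleftrightarrow> P 0 \<and> P 1 \<and> P 2 \<and> P 3"
  by (simp add: nodes_eq)

lemma sum_nodes: "(\<Sum>k\<in>nodes. g k) = g 0 + g 1 + g 2 + g 3"
  by (simp add: nodes_eq add.assoc)

text \<open>A station with \<open>d = y 2\<close>, \<open>b = y 3\<close> and \<open>x = d + b\<close> docks, \<open>- y 1\<close> of which are booked as lying above the
reference level \<open>m\<close>, so that at most \<open>m\<close> are not. The sign convention makes the entries sum to 0, and
every change of the station is then a flow between the nodes. Booking more docks than necessary is allowed: the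
set of admissible points is cut out by bounds on \<open>y 0\<close>, \<open>y 1\<close>, \<open>y 2\<close>, \<open>y 3\<close> and \<open>y 2 + y 3\<close>, a laminar family.\<close>

definition adm :: "int \<Rightarrow> int \<Rightarrow> int \<Rightarrow> (int \<Rightarrow> int) \<Rightarrow> bool" where
  "adm l u m y \<longleftrightarrow> 0 \<le> y 2 \<and> 0 \<le> y 3 \<and> y 1 \<le> 0 \<and> - m \<le> y 0 \<and> l \<le> y 2 + y 3 \<and> y 2 + y 3 \<le> u \<and>
     y 0 + y 1 + y 2 + y 3 = 0"

definition red :: "(int \<Rightarrow> int \<Rightarrow> real) \<Rightarrow> (int \<Rightarrow> real) \<Rightarrow> (int \<Rightarrow> int) \<Rightarrow> real" where
  "red f p y = f (y 2) (y 3) + (\<Sum>k\<in>nodes. p k * of_int (y k))"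

definition same_grid :: "int \<Rightarrow> (int \<Rightarrow> int) \<Rightarrow> (int \<Rightarrow> int) \<Rightarrow> bool" where
  "same_grid g y z \<longleftrightarrow> (\<forall>k\<in>nodes. g dvd y k - z k)"

definition dist1 :: "(int \<Rightarrow> int) \<Rightarrow> (int \<Rightarrow> int) \<Rightarrow> int" where
  "dist1 y z = (\<Sum>k\<in>nodes. \<bar>y k - z k\<bar>)"

lemma node_cases: "k \<in> nodes \<Longrightarrow> (k = 0 \<Longrightarrow> P) \<Longrightarrow> (k = 1 \<Longrightarrow> P) \<Longrightarrow> (k = 2 \<Longrightarrow> P) \<Longrightarrow> (k = 3 \<Longrightarrow> P) \<Longrightarrow> P"
  by (force simp: nodes_eq)

lemma grid_gap: "(g::int) dvd x \<Longrightarrow> g dvd s \<Longrightarrow> \<not> x \<le> - s \<Longrightarrow> x \<ge> g - s"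
  using zdvd_imp_le[of g "x + s"] by (auto simp: dvd_add)

lemma red_move_diff:
  assumes "u \<in> nodes" "v \<in> nodes"
  shows "red f p (move y u v s) - red f p y =
     f (move y u v s 2) (move y u v s 3) - f (y 2) (y 3) + of_int s * (p v - p u)"
  using assms unfolding red_def sum_nodes move_def
  by (elim node_cases) (simp_all add: algebra_simps)

lemma red_exchange:
  assumes "u \<in> nodes" "v \<in> nodes"
    "f (x 2) (x 3) + f (y 2) (y 3) \<ge>
      f (move x u v s 2) (move x u v s 3) + f (move y v u s 2) (move y v u s 3)"
  shows "red f p x + red f p y \<ge> red f p (move x u v s) + red f p (move y v u s)"
  using assms red_move_diff[of u v f p x s] red_move_diff[of v u f p y s]
  by (simp add: algebra_simps)

text \<open>The exchange axiom of M-convexity, for steps \<open>s\<close> that may be a multiple of the common grid \<open>g\<close> of the two points.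
For \<open>s = g\<close> the threshold is \<open>g\<close> and this is the axiom itself; \<open>s = 2 * g\<close> gives proximity of the minima on two
consecutive grids, and \<open>g = 1\<close> gives rounding to a grid.

The threshold comes from the following pigeonhole. The partner of \<open>u\<close> is sought first on the same side of the
station (docks or contents), where exchanging does not change the number of docks. If that node lags by less than
\<open>s\<close>, hence by at most \<open>s - g\<close>, then the numbers of docks differ by at least \<open>2 * s - g\<close>. So one of the
two nodes on the other side lags by \<open>s\<close>, and the numbers of docks stay in order after the exchange, as the
monotonicity of the marginal costs requires.\<close>

lemma exchange_cost:
  assumes mm: "multimodular f" and x: "adm l h m x" and y: "adm l h m y"
    and g: "0 < g" "g dvd s" "0 < s" and xy: "same_grid g x y"
    and u: "u \<in> nodes" and big: "x u - y u \<ge> 3 * s - 2 * g"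
  obtains w where "w \<in> nodes" "x w - y w \<le> - s"
    "adm l h m (move x u w s)" "adm l h m (move y w u s)"
    "f (x 2) (x 3) + f (y 2) (y 3) \<ge>
      f (move x u w s 2) (move x u w s 3) + f (move y w u s 2) (move y w u s 3)"
proof -
  have sg: "s \<ge> g" using g zdvd_imp_le by blast
  have dv: "g dvd x 0 - y 0" "g dvd x 1 - y 1" "g dvd x 2 - y 2" "g dvd x 3 - y 3"
    using xy unfolding same_grid_def ball_nodes by auto
  have gap: "g dvd z \<Longrightarrow> \<not> z \<le> - s \<Longrightarrow> z \<ge> g - s" for z using grid_gap g by blast
  note gp = gap[OF dv(1)] gap[OF dv(2)] gap[OF dv(3)] gap[OF dv(4)]
  have X: "0 \<le> x 2" "0 \<le> x 3" "x 1 \<le> 0" "- m \<le> x 0" "l \<le> x 2 + x 3" "x 2 + x 3 \<le> h" "x 0 + x 1 + x 2 + x 3 = 0"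
    using x unfolding adm_def by auto
  have Y: "0 \<le> y 2" "0 \<le> y 3" "y 1 \<le> 0" "- m \<le> y 0" "l \<le> y 2 + y 3" "y 2 + y 3 \<le> h" "y 0 + y 1 + y 2 + y 3 = 0"
    using y unfolding adm_def by auto
  note simps = adm_def move_def
  from u consider "u = 0" | "u = 1" | "u = 2" | "u = 3" unfolding nodes_eq by blast
  then show thesis
  proof cases
    case 1
    show thesis
    proof (cases "x 1 - y 1 \<le> - s")
      case True
      then show thesis using 1 big X Y sg g by (intro that[of 1]) (auto simp: simps)
    next
      case False
      then have a: "x 1 - y 1 \<ge> g - s" using gp by blast
      then have t: "(x 2 + x 3) - (y 2 + y 3) \<le> g - 2 * s" using big 1 X Y by simp
      show thesis
      proof (cases "x 2 - y 2 \<le> - s")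
        case True
        then show thesis using 1 big X Y sg g t multimodular_step_d[OF mm, of "x 2" "y 2 - s" "x 3" "y 3" s]
          by (intro that[of 2]) (auto simp: simps)
      next
        case False
        then have "x 3 - y 3 \<le> - s" using t gp by auto
        then show thesis using 1 big X Y sg g t multimodular_step_b[OF mm, of "x 3" "y 3 - s" "x 2" "y 2" s]
          by (intro that[of 3]) (auto simp: simps)
      qed
    qed
  next
    case 2
    show thesis
    proof (cases "x 0 - y 0 \<le> - s")
      case True
      then show thesis using 2 big X Y sg g by (intro that[of 0]) (auto simp: simps)
    next
      case False
      then have a: "x 0 - y 0 \<ge> g - s" using gp by blast
      then have t: "(x 2 + x 3) - (y 2 + y 3) \<le> g - 2 * s" using big 2 X Y by simp
      show thesis
      proof (cases "x 2 - y 2 \<le> - s")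
        case True
        then show thesis using 2 big X Y sg g t multimodular_step_d[OF mm, of "x 2" "y 2 - s" "x 3" "y 3" s]
          by (intro that[of 2]) (auto simp: simps)
      next
        case False
        then have "x 3 - y 3 \<le> - s" using t gp by auto
        then show thesis using 2 big X Y sg g t multimodular_step_b[OF mm, of "x 3" "y 3 - s" "x 2" "y 2" s]
          by (intro that[of 3]) (auto simp: simps)
      qed
    qed
  next
    case 3
    show thesis
    proof (cases "x 3 - y 3 \<le> - s")
      case True
      then show thesis using 3 big X Y sg g multimodular_step_swap[OF mm, of s "y 2 + s" "x 2" "x 3" "y 3 - s"]
        by (intro that[of 3]) (auto simp: simps)
    next
      case False
      then have a: "x 3 - y 3 \<ge> g - s" using gp by blast
      then have t: "(x 2 + x 3) - (y 2 + y 3) \<ge> 2 * s - g" using big 3 X Y by simp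
      have D: "f (y 2 + s) (y 3) - f (y 2) (y 3) \<le> f (x 2) (x 3) - f (x 2 - s) (x 3)"
        using multimodular_step_d[OF mm, of "y 2" "x 2 - s" "y 3" "x 3" s] X Y sg g t big 3 by simp
      show thesis
      proof (cases "x 0 - y 0 \<le> - s")
        case True
        then show thesis using 3 big X Y sg g t D by (intro that[of 0]) (auto simp: simps)
      next
        case False
        then have "x 1 - y 1 \<le> - s" using t gp X Y by auto
        then show thesis using 3 big X Y sg g t D by (intro that[of 1]) (auto simp: simps)
      qed
    qed
  next
    case 4
    show thesis
    proof (cases "x 2 - y 2 \<le> - s")
      case True
      then show thesis using 4 big X Y sg g
          multimodular_step_swap[OF mm, of s "y 2" "x 2 + s" "x 3 - s" "y 3"]
          multimodular_step_swap[OF multimodular_swap_args[OF mm], of s "y 3 + s" "x 3" "x 2" "y 2 - s"]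
        by (intro that[of 2]) (auto simp: simps)
    next
      case False
      then have a: "x 2 - y 2 \<ge> g - s" using gp by blast
      then have t: "(x 2 + x 3) - (y 2 + y 3) \<ge> 2 * s - g" using big 4 X Y by simp
      have D: "f (y 2) (y 3 + s) - f (y 2) (y 3) \<le> f (x 2) (x 3) - f (x 2) (x 3 - s)"
        using multimodular_step_b[OF mm, of "y 3" "x 3 - s" "y 2" "x 2" s] X Y sg g t big 4 by simp
      show thesis
      proof (cases "x 0 - y 0 \<le> - s")
        case True
        then show thesis using 4 big X Y sg g t D by (intro that[of 0]) (auto simp: simps)
      next
        case False
        then have "x 1 - y 1 \<le> - s" using t gp X Y by auto
        then show thesis using 4 big X Y sg g t D by (intro that[of 1]) (auto simp: simps)
      qed
    qed
  qed
qed

section \<open>Minima on a grid: local optimality, proximity, rounding\<close>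

lemma same_grid_refl [simp]: "same_grid g y y"
  by (simp add: same_grid_def)

lemma same_grid_sym: "same_grid g x y \<Longrightarrow> same_grid g y x"
  unfolding same_grid_def by (simp add: dvd_diff_commute)

lemma same_grid_trans: "same_grid g x y \<Longrightarrow> same_grid g y z \<Longrightarrow> same_grid g x z"
  unfolding same_grid_def
proof
  fix k assume k: "k \<in> nodes" and *: "\<forall>k\<in>nodes. g dvd x k - y k" "\<forall>k\<in>nodes. g dvd y k - z k"
  then have "g dvd (x k - y k) + (y k - z k)" by (intro dvd_add) auto
  then show "g dvd x k - z k" by simp
qed

lemma same_grid_move [simp]: "g dvd s \<Longrightarrow> same_grid g (move y a b s) y"
  unfolding same_grid_def move_def by auto

lemma dist1_nonneg: "0 \<le> dist1 x y"
  unfolding dist1_def by (simp add: sum_nonneg)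

lemma dist1_move:
  assumes "a \<in> nodes" "b \<in> nodes" "x a - y a \<ge> s" "x b - y b \<le> - s" "0 < s"
  shows "dist1 (move x a b s) y < dist1 x y"
  using assms unfolding dist1_def sum_nodes move_def nodes_eq by auto

lemma exchange_towards:
  assumes mm: "multimodular f" and x: "adm l h m x" and y: "adm l h m y"
    and g: "0 < g" "g dvd s" "0 < s" and xy: "same_grid g x y"
    and u: "u \<in> nodes" and big: "\<bar>x u - y u\<bar> \<ge> 3 * s - 2 * g"
  obtains a b where "a \<in> nodes" "b \<in> nodes"
    "adm l h m (move x b a s)" "adm l h m (move y a b s)"
    "red f p x + red f p y \<ge> red f p (move x b a s) + red f p (move y a b s)"
    "dist1 (move x b a s) y < dist1 x y" "dist1 (move y a b s) x < dist1 y x"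
proof -
  have sg: "s \<ge> g" using g zdvd_imp_le by blast
  show thesis
  proof (cases "x u - y u \<ge> 3 * s - 2 * g")
    case True
    from exchange_cost[OF mm x y g xy u True] obtain w where w: "w \<in> nodes" "x w - y w \<le> - s"
      "adm l h m (move x u w s)" "adm l h m (move y w u s)"
      "f (x 2) (x 3) + f (y 2) (y 3) \<ge>
        f (move x u w s 2) (move x u w s 3) + f (move y w u s 2) (move y w u s 3)" .
    show thesis
      using w True sg g u
      by (intro that[of w u] red_exchange dist1_move) auto
  next
    case False
    then have F: "y u - x u \<ge> 3 * s - 2 * g" using big by linarith
    from exchange_cost[OF mm y x g same_grid_sym[OF xy] u F] obtain w where w: "w \<in> nodes" "y w - x w \<le> - s"
      "adm l h m (move y u w s)" "adm l h m (move x w u s)"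
      "f (y 2) (y 3) + f (x 2) (x 3) \<ge>
        f (move y u w s 2) (move y u w s 3) + f (move x w u s 2) (move x w u s 3)" .
    show thesis
      using w F sg g u
      by (intro that[of u w] red_exchange dist1_move) auto
  qed
qed

definition grid_opt where
  "grid_opt f l h m p g y \<longleftrightarrow> adm l h m y \<and>
     (\<forall>y'. adm l h m y' \<and> same_grid g y' y \<longrightarrow> red f p y \<le> red f p y')"

lemma grid_optD:
  assumes "grid_opt f l h m p g y"
  shows "adm l h m y" and "adm l h m x \<Longrightarrow> same_grid g x y \<Longrightarrow> red f p y \<le> red f p x"
  using assms unfolding grid_opt_def by auto

lemma red_cong: "(\<And>k. k \<in> nodes \<Longrightarrow> x k = y k) \<Longrightarrow> red f p x = red f p y"
  unfolding red_def by (simp add: sum_nodes)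

text \<open>A point of the grid with smaller value could be exchanged with \<open>y\<close>. This does not decrease the value at \<open>y\<close>, so
it does not increase that of the other point, which meanwhile moves closer to \<open>y\<close>.\<close>

lemma grid_optI_local:
  assumes mm: "multimodular f" and y: "adm l h m y" and g: "0 < g"
    and loc: "\<And>a b. a \<in> nodes \<Longrightarrow> b \<in> nodes \<Longrightarrow> adm l h m (move y a b g) \<Longrightarrow> red f p y \<le> red f p (move y a b g)"
  shows "grid_opt f l h m p g y"
proof -
  have "red f p y \<le> red f p x" if "adm l h m x" "same_grid g x y" for x
    using that
  proof (induction "nat (dist1 x y)" arbitrary: x rule: less_induct)
    case less
    show ?case
    proof (cases "\<forall>k\<in>nodes. x k = y k")
      case True
      then show ?thesis using red_cong[of x y] by simp
    next
      case False
      then obtain u where u: "u \<in> nodes" "x u \<noteq> y u" by blast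
      then have "g dvd x u - y u" using less.prems unfolding same_grid_def by blast
      then have "\<bar>x u - y u\<bar> \<ge> 3 * g - 2 * g"
        using u zdvd_imp_le[of g "\<bar>x u - y u\<bar>"] by simp
      from exchange_towards[OF mm less.prems(1) y g dvd_refl g less.prems(2) u(1) this, of p]
      obtain a b where ab: "a \<in> nodes" "b \<in> nodes"
        "adm l h m (move x b a g)" "adm l h m (move y a b g)"
        "red f p x + red f p y \<ge> red f p (move x b a g) + red f p (move y a b g)"
        "dist1 (move x b a g) y < dist1 x y" by metis
      have "nat (dist1 (move x b a g) y) < nat (dist1 x y)"
        using ab(6) dist1_nonneg[of "move x b a g" y] by linarith
      then have "red f p y \<le> red f p (move x b a g)"
        using less.hyps[OF _ ab(3) same_grid_trans[OF same_grid_move[OF dvd_refl] less.prems(2)]] by blast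
      with ab loc[of a b] show ?thesis by linarith
    qed
  qed
  with y show ?thesis unfolding grid_opt_def by blast
qed

text \<open>Exchanges by \<open>2 * g\<close> stay on the coarse grid as seen from \<open>y\<close>, where \<open>y\<close> is optimal. So they do
not increase the value at \<open>x\<close>, and they are available as long as some coordinate differs by more than \<open>3 * g\<close>.
The set of admissible points being unbounded, existence of a minimum on the fine grid is a consequence.\<close>

lemma grid_opt_proximity:
  assumes mm: "multimodular f" and y: "grid_opt f l h m p (2 * g) y" and g: "0 < g"
    and "adm l h m x" "same_grid g x y"
  shows "\<exists>x'. adm l h m x' \<and> same_grid g x' y \<and> (\<forall>k\<in>nodes. \<bar>x' k - y k\<bar> \<le> 3 * g) \<and> red f p x' \<le> red f p x"
  using assms(4-)
proof (induction "nat (dist1 x y)" arbitrary: x rule: less_induct)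
  case less
  show ?case
  proof (cases "\<forall>k\<in>nodes. \<bar>x k - y k\<bar> \<le> 3 * g")
    case True
    then show ?thesis using less.prems by blast
  next
    case False
    then obtain u where u: "u \<in> nodes" "\<bar>x u - y u\<bar> > 3 * g" using not_le by blast
    then have "g dvd \<bar>x u - y u\<bar> - 3 * g" using less.prems unfolding same_grid_def by (intro dvd_diff) auto
    then have big: "\<bar>x u - y u\<bar> \<ge> 3 * (2 * g) - 2 * g"
      using u zdvd_imp_le[of g "\<bar>x u - y u\<bar> - 3 * g"] by simp
    have ya: "adm l h m y" using y unfolding grid_opt_def by blast
    have g2: "g dvd 2 * g" "0 < 2 * g" using g by auto
    from exchange_towards[OF mm less.prems(1) ya g g2 less.prems(2) u(1) big, of p]
    obtain a b where ab: "a \<in> nodes" "b \<in> nodes"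
      "adm l h m (move x b a (2*g))" "adm l h m (move y a b (2*g))"
      "red f p x + red f p y \<ge> red f p (move x b a (2*g)) + red f p (move y a b (2*g))"
      "dist1 (move x b a (2*g)) y < dist1 x y" by metis
    have "same_grid g (move x b a (2*g)) y" using same_grid_trans[OF same_grid_move less.prems(2)] g2 by blast
    moreover have "nat (dist1 (move x b a (2*g)) y) < nat (dist1 x y)"
      using ab(6) dist1_nonneg[of "move x b a (2*g)" y] by linarith
    ultimately obtain x' where x': "adm l h m x'" "same_grid g x' y" "\<forall>k\<in>nodes. \<bar>x' k - y k\<bar> \<le> 3 * g"
        "red f p x' \<le> red f p (move x b a (2*g))"
      using less.hyps[OF _ ab(3)] by blast
    have "red f p y \<le> red f p (move y a b (2*g))"
      by (rule grid_optD(2)[OF y ab(4)]) simp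
    then have "red f p x' \<le> red f p x" using x'(4) ab(5) by linarith
    with x' show ?thesis by blast
  qed
qed

lemma multimodular_zero: "multimodular (\<lambda>_ _. 0)"
  by (simp add: multimodular_def)

text \<open>The same descent with the zero cost: only admissibility is exchanged.\<close>

lemma adm_rounding:
  assumes "adm l h m y" "adm l h m x" "0 < D"
  shows "\<exists>y'. adm l h m y' \<and> same_grid D y' y \<and> (\<forall>k\<in>nodes. \<bar>y' k - x k\<bar> \<le> 3 * (D - 1))"
  using assms(1)
proof (induction "nat (dist1 y x)" arbitrary: y rule: less_induct)
  case less
  show ?case
  proof (cases "\<forall>k\<in>nodes. \<bar>y k - x k\<bar> \<le> 3 * (D - 1)")
    case True
    then show ?thesis using less.prems same_grid_refl by blast
  next
    case False
    then obtain u where u: "u \<in> nodes" "\<bar>y u - x u\<bar> \<ge> 3 * D - 2 * 1" by force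
    have c1: "same_grid 1 y x" by (simp add: same_grid_def)
    from exchange_towards[OF multimodular_zero less.prems assms(2) _ _ assms(3) c1 u, of "\<lambda>_. 0"]
    obtain a b where ab: "a \<in> nodes" "b \<in> nodes"
      "adm l h m (move y b a D)" "dist1 (move y b a D) x < dist1 y x" by (metis one_dvd zero_less_one)
    have "\<exists>y'. adm l h m y' \<and> same_grid D y' (move y b a D) \<and> (\<forall>k\<in>nodes. \<bar>y' k - x k\<bar> \<le> 3 * (D - 1))"
      using ab dist1_nonneg[of "move y b a D" x] by (intro less.hyps) auto
    then show ?thesis using same_grid_trans[OF _ same_grid_move[OF dvd_refl]] by blast
  qed
qed

text \<open>If no unit of size \<open>D\<close> can leave \<open>S\<close>, then \<open>y\<close> is a local, hence a global, minimum of the linear function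
\<open>\<Sum>v\<in>S. y v\<close> on its grid. The constant is the rounding error, \<open>3 * (D - 1)\<close> for each of the four coordinates.\<close>

lemma closed_excess:
  assumes y: "adm l h m y" and x: "adm l h m x" and D: "0 < D" and S: "S \<subseteq> nodes"
    and cl: "\<And>a b. a \<in> S \<Longrightarrow> b \<in> nodes - S \<Longrightarrow> \<not> adm l h m (move y a b D)"
  shows "(\<Sum>v\<in>S. y v) \<le> (\<Sum>v\<in>S. x v) + 12 * (D - 1)"
proof -
  define p :: "int \<Rightarrow> real" where "p = (\<lambda>k. if k \<in> S then 1 else 0)"
  have rp: "red (\<lambda>_ _. 0) p z = of_int (\<Sum>v\<in>S. z v)" for z
  proof -
    have "(\<Sum>k\<in>nodes. p k * of_int (z k)) = (\<Sum>k\<in>nodes. if k \<in> S then of_int (z k) else 0)"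
      unfolding p_def by (intro sum.cong) auto
    also have "\<dots> = (\<Sum>k\<in>nodes \<inter> S. of_int (z k))" by (subst sum.inter_restrict) auto
    also have "nodes \<inter> S = S" using S by blast
    finally show ?thesis by (simp add: red_def)
  qed
  have "grid_opt (\<lambda>_ _. 0) l h m p D y"
  proof (rule grid_optI_local[OF multimodular_zero y D])
    fix a b assume ab: "a \<in> nodes" "b \<in> nodes" "adm l h m (move y a b D)"
    then have "\<not> (a \<in> S \<and> b \<notin> S)" using cl by blast
    then have "0 \<le> of_int D * (p b - p a)" using D unfolding p_def by auto
    with red_move_diff[OF ab(1,2), of "\<lambda>_ _. 0" p y D]
    show "red (\<lambda>_ _. 0) p y \<le> red (\<lambda>_ _. 0) p (move y a b D)" by simp
  qed
  moreover obtain y' where y': "adm l h m y'" "same_grid D y' y" "\<forall>k\<in>nodes. \<bar>y' k - x k\<bar> \<le> 3 * (D - 1)"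
    using adm_rounding[OF y x D] by blast
  ultimately have "(\<Sum>v\<in>S. y v) \<le> (\<Sum>v\<in>S. y' v)" unfolding grid_opt_def rp of_int_le_iff by blast
  also have "\<dots> \<le> (\<Sum>v\<in>S. x v + 3 * (D - 1))"
  proof (rule sum_mono)
    fix v assume "v \<in> S"
    then have "\<bar>y' v - x v\<bar> \<le> 3 * (D - 1)" using y' S by blast
    then show "y' v \<le> x v + 3 * (D - 1)" by linarith
  qed
  also have "\<dots> = (\<Sum>v\<in>S. x v) + int (card S) * (3 * (D - 1))" by (simp add: sum.distrib)
  also have "int (card S) * (3 * (D - 1)) \<le> 4 * (3 * (D - 1))"
    using card_mono[OF _ S] D by (intro mult_right_mono) auto
  finally show ?thesis by simp
qed

section \<open>Pushing along tight arcs\<close>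

definition tight where
  "tight f l h m p g y a b \<longleftrightarrow> adm l h m (move y a b g) \<and> red f p (move y a b g) = red f p y"

lemma grid_opt_congr:
  assumes "grid_opt f l h m p g y" "adm l h m x" "same_grid g x y" "red f p x = red f p y"
  shows "grid_opt f l h m p g x"
  using assms unfolding grid_opt_def by (metis same_grid_trans)

lemma grid_opt_tight_move:
  assumes "grid_opt f l h m p g y" "tight f l h m p g y a b"
  shows "grid_opt f l h m p g (move y a b g)"
  using assms(2) grid_opt_congr[OF assms(1) _ same_grid_move[OF dvd_refl]] unfolding tight_def by blast

lemma grid_opt_exchange:
  assumes mm: "multimodular f" and g: "0 < g" and y: "grid_opt f l h m p g y"
    and x1: "adm l h m x1" "same_grid g x1 y" "red f p x1 = red f p y"
    and x2: "adm l h m x2" "same_grid g x2 y" "red f p x2 = red f p y"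
    and u: "u \<in> nodes" "x1 u - x2 u \<ge> g"
  obtains w where "w \<in> nodes" "x1 w - x2 w \<le> - g"
    "adm l h m (move x1 u w g)" "red f p (move x1 u w g) = red f p y"
    "adm l h m (move x2 w u g)" "red f p (move x2 w u g) = red f p y"
proof -
  have "3 * g - 2 * g \<le> x1 u - x2 u" using u by simp
  from exchange_cost[OF mm x1(1) x2(1) g dvd_refl g same_grid_trans[OF x1(2) same_grid_sym[OF x2(2)]] u(1) this]
  obtain w where w: "w \<in> nodes" "x1 w - x2 w \<le> - g"
    "adm l h m (move x1 u w g)" "adm l h m (move x2 w u g)"
    "f (x1 2) (x1 3) + f (x2 2) (x2 3) \<ge>
      f (move x1 u w g 2) (move x1 u w g 3) + f (move x2 w u g 2) (move x2 w u g 3)" .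
  have "red f p x1 + red f p x2 \<ge> red f p (move x1 u w g) + red f p (move x2 w u g)"
    using red_exchange[OF u(1) w(1,5)] .
  moreover have "red f p (move x1 u w g) \<ge> red f p y" "red f p (move x2 w u g) \<ge> red f p y"
    using grid_optD(2)[OF y w(3) same_grid_trans[OF same_grid_move[OF dvd_refl] x1(2)]]
      grid_optD(2)[OF y w(4) same_grid_trans[OF same_grid_move[OF dvd_refl] x2(2)]] .
  ultimately have "red f p (move x1 u w g) = red f p y" "red f p (move x2 w u g) = red f p y"
    using x1(3) x2(3) by linarith+
  with w show thesis using that by blast
qed

text \<open>If two tight arcs \<open>a \<rightarrow> b\<close> and \<open>c \<rightarrow> d\<close> of one station lie on a path in this order and the shortcut \<open>a \<rightarrow> d\<close> is
not tight, they can be used together. Indeed, exchanging at \<open>b\<close> between the two points reached by one move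
each, the node that makes up for it is \<open>a\<close> or \<open>d\<close>, and \<open>d\<close> would produce the shortcut. For consecutive arcs
\<open>a\<close> would produce it too, so these never belong to the same station.\<close>

lemma tight_after_push:
  assumes mm: "multimodular f" and g: "0 < g" and y: "grid_opt f l h m p g y"
    and t: "tight f l h m p g y a b" "tight f l h m p g y c d" "\<not> tight f l h m p g y a d"
    and nd: "b \<in> nodes" "a \<noteq> b" "c \<noteq> d" "a \<noteq> d" "a \<noteq> c" "b \<noteq> d"
  shows "b \<noteq> c \<and> tight f l h m p g (move y c d g) a b"
proof -
  let ?x1 = "move y a b g" and ?x2 = "move y c d g"
  have "?x1 b - ?x2 b \<ge> g" using nd g unfolding move_def by auto
  from grid_opt_exchange[OF mm g y _ same_grid_move[OF dvd_refl] _ _ same_grid_move[OF dvd_refl] _ nd(1) this] t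
  obtain w where w: "w \<in> nodes" "?x1 w - ?x2 w \<le> - g"
    "adm l h m (move ?x1 b w g)" "red f p (move ?x1 b w g) = red f p y"
    "adm l h m (move ?x2 w b g)" "red f p (move ?x2 w b g) = red f p y"
    unfolding tight_def by blast
  have "w = a \<or> w = d" using w(2) g nd unfolding move_def by (auto split: if_splits)
  moreover have "move ?x1 b d g = move y a d g" unfolding move_def by auto
  ultimately have wa: "w = a" using w t(3) unfolding tight_def by metis
  have "b \<noteq> c"
  proof
    assume "b = c"
    then have "move ?x2 a b g = move y a d g" unfolding move_def by auto
    with w wa t(3) show False unfolding tight_def by metis
  qed
  with w wa t show ?thesis unfolding tight_def by metis
qed

text \<open>The same argument, now for \<open>y\<close> and a point reached by two moves: a new tight arc \<open>a \<rightarrow> b\<close> after a push on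
\<open>c \<rightarrow> d\<close> would come from \<open>a \<rightarrow> b\<close> or \<open>a \<rightarrow> d\<close> having been tight.\<close>

lemma not_tight_after_push:
  assumes mm: "multimodular f" and g: "0 < g" and y: "grid_opt f l h m p g y"
    and t: "tight f l h m p g y c d" "\<not> tight f l h m p g y a d" "\<not> tight f l h m p g y a b"
    and nd: "d \<in> nodes" "a \<noteq> b" "c \<noteq> d" "a \<noteq> d" "a \<noteq> c" "b \<noteq> d"
  shows "\<not> tight f l h m p g (move y c d g) a b"
proof
  assume T: "tight f l h m p g (move y c d g) a b"
  let ?x = "move (move y c d g) a b g"
  have "?x d - y d \<ge> g" using nd unfolding move_def by auto
  have a: "adm l h m y" using y unfolding grid_opt_def by blast
  have X: "adm l h m ?x" "same_grid g ?x y" "red f p ?x = red f p y"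
    using T t same_grid_trans[OF same_grid_move same_grid_move] unfolding tight_def by auto
  from grid_opt_exchange[OF mm g y X a same_grid_refl refl nd(1) \<open>?x d - y d \<ge> g\<close>]
  obtain w where w: "w \<in> nodes" "?x w - y w \<le> - g"
    "adm l h m (move ?x d w g)" "red f p (move ?x d w g) = red f p y"
    "adm l h m (move y w d g)" "red f p (move y w d g) = red f p y" .
  have "w \<noteq> a" using w t(2) unfolding tight_def by metis
  then have "w = c" "b \<noteq> c" using w(2) g nd unfolding move_def by (auto split: if_splits)
  moreover have "move ?x d c g = move y a b g" unfolding move_def by auto
  ultimately show False using w t(3) unfolding tight_def by metis
qed

section \<open>Networks of stations\<close>

text \<open>The vectors of all stations occupy one array, four cells each. The value 0 outside of the nodes makes
equations between vectors hold as equations between functions.\<close>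

definition vec :: "(int \<Rightarrow> int) \<Rightarrow> int \<Rightarrow> int \<Rightarrow> int" where
  "vec Y i = (\<lambda>v. if v \<in> nodes then Y (4 * i + v) else 0)"

definition push :: "(int \<Rightarrow> int) \<Rightarrow> int \<Rightarrow> int \<Rightarrow> int \<Rightarrow> int \<Rightarrow> int \<Rightarrow> int" where
  "push Y i a b D = (let Y' = Y(4 * i + a := Y (4 * i + a) - D) in Y'(4 * i + b := Y' (4 * i + b) + D))"

lemma vec_push:
  assumes "a \<in> nodes" "b \<in> nodes"
  shows "vec (push Y i a b D) i' = (if i' = i then move (vec Y i) a b D else vec Y i')"
  using assms unfolding push_def Let_def vec_def move_def by (fastforce simp: fun_eq_iff)

definition surplus :: "(int \<Rightarrow> int) \<Rightarrow> int" where
  "surplus e = (\<Sum>v\<in>nodes. max 0 (e v))"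

lemma surplus_augment:
  assumes "a \<in> nodes" "b \<in> nodes" "e a \<ge> D" "e b \<le> - D" "0 < D"
    and "\<And>v. v \<in> nodes \<Longrightarrow> e' v = e v - (if v = a then D else 0) + (if v = b then D else 0)"
  shows "surplus e' = surplus e - D"
proof -
  have "a \<noteq> b" using assms by auto
  then have "max 0 (e' v) = max 0 (e v) - (if v = a then D else 0)" if "v \<in> nodes" for v
    using assms(3-5) assms(6)[OF that] by (auto simp: max_def)
  then have "surplus e' = (\<Sum>v\<in>nodes. max 0 (e v) - (if v = a then D else 0))"
    unfolding surplus_def by (intro sum.cong) auto
  also have "\<dots> = surplus e - D" unfolding surplus_def sum_subtractf using assms(1) by simp
  finally show ?thesis .
qed

lemma grid_opt_halve:
  assumes mm: "multimodular f" and y: "grid_opt f l h m p (2 * g) y" and g: "0 < g"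
    and w: "adm l h m w" "same_grid g w y"
    and min: "\<And>x. adm l h m x \<Longrightarrow> same_grid g x y \<Longrightarrow> \<forall>k\<in>nodes. \<bar>x k - y k\<bar> \<le> 3 * g \<Longrightarrow> red f p w \<le> red f p x"
  shows "grid_opt f l h m p g w"
proof -
  have "red f p w \<le> red f p x" if "adm l h m x" "same_grid g x w" for x
    using grid_opt_proximity[OF mm y g that(1) same_grid_trans[OF that(2) w(2)]] min by force
  with w show ?thesis unfolding grid_opt_def by blast
qed

text \<open>The admissible points \<open>Z\<close> fix the prescribed totals of the nodes and witness that these can be attained.\<close>

locale network =
  fixes N :: nat and F :: "int \<Rightarrow> int \<Rightarrow> int \<Rightarrow> real" and L U M :: "int \<Rightarrow> int"
    and Z :: "int \<Rightarrow> int \<Rightarrow> int"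
  assumes mm: "i \<in> {1..int N} \<Longrightarrow> multimodular (F i)"
    and Zadm: "i \<in> {1..int N} \<Longrightarrow> adm (L i) (U i) (M i) (Z i)"
begin

definition excess :: "(int \<Rightarrow> int) \<Rightarrow> int \<Rightarrow> int" where
  "excess Y v = (\<Sum>i\<in>{1..int N}. vec Y i v - Z i v)"

definition can_move :: "int \<Rightarrow> (int \<Rightarrow> int) \<Rightarrow> int \<Rightarrow> int \<Rightarrow> int \<Rightarrow> bool" where
  "can_move D Y i a b \<longleftrightarrow> adm (L i) (U i) (M i) (move (vec Y i) a b D)"

definition move_cost :: "(int \<Rightarrow> real) \<Rightarrow> int \<Rightarrow> (int \<Rightarrow> int) \<Rightarrow> int \<Rightarrow> int \<Rightarrow> int \<Rightarrow> real" where
  "move_cost p D Y i a b = red (F i) p (move (vec Y i) a b D) - red (F i) p (vec Y i)"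

definition tight_arc :: "(int \<Rightarrow> real) \<Rightarrow> int \<Rightarrow> (int \<Rightarrow> int) \<Rightarrow> int \<Rightarrow> int \<Rightarrow> int \<Rightarrow> bool" where
  "tight_arc p D Y i a b \<longleftrightarrow> can_move D Y i a b \<and> move_cost p D Y i a b = 0"

definition all_opt :: "(int \<Rightarrow> real) \<Rightarrow> int \<Rightarrow> (int \<Rightarrow> int) \<Rightarrow> bool" where
  "all_opt p D Y \<longleftrightarrow> (\<forall>i\<in>{1..int N}. grid_opt (F i) (L i) (U i) (M i) p D (vec Y i))"

text \<open>A search forest: \<open>O' 0, \<dots>, O' (k - 1)\<close> are the nodes in the order in which they are reached. The node at position \<open>j\<close> is a
root if \<open>P j = -1\<close>; otherwise it is reached from the node at position \<open>P j\<close> by a move of the station \<open>A j\<close>. The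
last clause excludes shortcuts: no tight arc leads to a node from nodes reached before its predecessor.\<close>

definition arcs :: "(int \<Rightarrow> real) \<Rightarrow> int \<Rightarrow> (int \<Rightarrow> int) \<Rightarrow> (int \<Rightarrow> int) \<Rightarrow> int \<Rightarrow> (int \<Rightarrow> int) \<Rightarrow> (int \<Rightarrow> int) \<Rightarrow> bool" where
  "arcs p D Y O' k P A \<longleftrightarrow> inj_on O' {0..<k} \<and> (\<forall>j\<in>{0..<k}. O' j \<in> nodes \<and>
     (P j = -1 \<or> 0 \<le> P j \<and> P j < j \<and> A j \<in> {1..int N} \<and> tight_arc p D Y (A j) (O' (P j)) (O' j) \<and>
       (\<forall>j'\<in>{0..<P j}. \<forall>i\<in>{1..int N}. \<not> tight_arc p D Y i (O' j') (O' j))))"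

lemma arcsD:
  assumes "arcs p D Y O' k P A"
  shows "inj_on O' {0..<k}" and "0 \<le> j \<Longrightarrow> j < k \<Longrightarrow> O' j \<in> nodes"
    and "0 \<le> j \<Longrightarrow> j < k \<Longrightarrow> P j = -1 \<or> 0 \<le> P j \<and> P j < j \<and> A j \<in> {1..int N} \<and>
       tight_arc p D Y (A j) (O' (P j)) (O' j) \<and>
       (\<forall>j'\<in>{0..<P j}. \<forall>i\<in>{1..int N}. \<not> tight_arc p D Y i (O' j') (O' j))"
  using assms atLeastLessThan_iff[of j 0 k] unfolding arcs_def by blast+

lemma tight_arc_tight: "tight_arc p D Y i a b \<longleftrightarrow> tight (F i) (L i) (U i) (M i) p D (vec Y i) a b"
  unfolding tight_arc_def can_move_def move_cost_def tight_def by auto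

lemma excess_push:
  assumes "i \<in> {1..int N}" "a \<in> nodes" "b \<in> nodes"
  shows "excess (push Y i a b D) v = excess Y v - (if v = a then D else 0) + (if v = b then D else 0)"
proof -
  have "excess (push Y i a b D) v =
      (\<Sum>i'\<in>{1..int N}. (vec Y i' v - Z i' v) + (if i' = i then - (if v = a then D else 0) + (if v = b then D else 0) else 0))"
    unfolding excess_def vec_push[OF assms(2,3)] by (intro sum.cong) (auto simp: move_def)
  also have "\<dots> = excess Y v - (if v = a then D else 0) + (if v = b then D else 0)"
    using assms(1) unfolding sum.distrib excess_def by simp
  finally show ?thesis .
qed

text \<open>Augmentation proceeds from the end of the path to its root. Pushing on the last arc turns the rest of the
path into a path of the same kind, so the step can be repeated.\<close>

lemma push_arcs:
  assumes so: "all_opt p D Y" and D: "0 < D" and ar: "arcs p D Y O' (k + 1) P A" and k: "0 \<le> k" "0 \<le> P k"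
    and Y': "Y' = push Y (A k) (O' (P k)) (O' k) D"
  shows "all_opt p D Y'" "arcs p D Y' O' (P k + 1) P A" "P k < k" "O' k \<in> nodes" "O' (P k) \<in> nodes"
    "A k \<in> {1..int N}"
    "excess Y' v = excess Y v - (if v = O' (P k) then D else 0) + (if v = O' k then D else 0)"
proof -
  let ?c = "O' (P k)" and ?d = "O' k" and ?i = "A k"
  have inj: "inj_on O' {0..<k+1}" using arcsD(1)[OF ar] .
  have nod: "O' j \<in> nodes" if "0 \<le> j" "j \<le> k" for j by (rule arcsD(2)[OF ar]) (use that in auto)
  have P: "P j = -1 \<or> 0 \<le> P j \<and> P j < j \<and> A j \<in> {1..int N} \<and>
      tight_arc p D Y (A j) (O' (P j)) (O' j) \<and> (\<forall>j'\<in>{0..<P j}. \<forall>i\<in>{1..int N}. \<not> tight_arc p D Y i (O' j') (O' j))"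
    if "0 \<le> j" "j \<le> k" for j by (rule arcsD(3)[OF ar]) (use that in auto)
  have ne: "O' a \<noteq> O' b" if "0 \<le> a" "a \<le> k" "0 \<le> b" "b \<le> k" "a \<noteq> b" for a b
    using inj that unfolding inj_on_def by auto
  have Pk: "P k < k" "?i \<in> {1..int N}" "tight_arc p D Y ?i ?c ?d"
    "\<And>j' i. 0 \<le> j' \<Longrightarrow> j' < P k \<Longrightarrow> i \<in> {1..int N} \<Longrightarrow> \<not> tight_arc p D Y i (O' j') ?d"
    using P[of k] k by simp_all
  have cd: "?c \<in> nodes" "?d \<in> nodes" using nod[of "P k"] nod[of k] k Pk by auto
  have vY: "vec Y' i' = (if i' = ?i then move (vec Y ?i) ?c ?d D else vec Y i')" for i'
    unfolding Y' vec_push[OF cd] ..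
  have optY: "grid_opt (F i) (L i) (U i) (M i) p D (vec Y i)" if "i \<in> {1..int N}" for i
    using so that unfolding all_opt_def by blast
  show "P k < k" "?d \<in> nodes" "?c \<in> nodes" "?i \<in> {1..int N}" using Pk cd by auto
  show "excess Y' v = excess Y v - (if v = O' (P k) then D else 0) + (if v = O' k then D else 0)"
    unfolding Y' using excess_push[OF Pk(2) cd] .
  show "all_opt p D Y'"
    using so Pk grid_opt_tight_move[OF optY[OF Pk(2)]] unfolding all_opt_def vY tight_arc_tight by auto
  have keep: "tight_arc p D Y' (A j) (O' (P j)) (O' j)" if j: "0 \<le> j" "j \<le> P k" "0 \<le> P j" for j
  proof (cases "A j = ?i")
    case True
    have Pj: "P j < j" "tight_arc p D Y (A j) (O' (P j)) (O' j)" using P[of j] j Pk by auto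
    have n: "\<not> tight_arc p D Y ?i (O' (P j)) ?d" using Pk(4)[of "P j" ?i] Pk(2) j Pj by auto
    have "tight (F ?i) (L ?i) (U ?i) (M ?i) p D (move (vec Y ?i) ?c ?d D) (O' (P j)) (O' j)"
      using j Pj Pk k n True
      by (intro conjunct2[OF tight_after_push[OF mm[OF Pk(2)] D optY[OF Pk(2)]]] ne nod)
        (auto simp: tight_arc_tight)
    then show ?thesis unfolding tight_arc_tight vY using True by simp
  next
    case False
    then show ?thesis using P[of j] j Pk unfolding tight_arc_tight vY by auto
  qed
  have keep2: "\<not> tight_arc p D Y' i (O' j') (O' j)" if j: "0 \<le> j" "j \<le> P k" "0 \<le> j'" "j' < P j" "i \<in> {1..int N}" for i j j'
  proof (cases "i = ?i")
    case True
    have Pj: "P j < j" "\<not> tight_arc p D Y i (O' j') (O' j)" using P[of j] j Pk by auto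
    have "\<not> tight (F ?i) (L ?i) (U ?i) (M ?i) p D (move (vec Y ?i) ?c ?d D) (O' j') (O' j)"
      using j Pj Pk(1,3) Pk(4)[of j' ?i] Pk(2) k True
      by (intro not_tight_after_push[OF mm[OF Pk(2)] D optY[OF Pk(2)]] ne nod)
        (auto simp: tight_arc_tight)
    then show ?thesis unfolding tight_arc_tight vY using True by simp
  next
    case False
    then show ?thesis using P[of j] j Pk unfolding tight_arc_tight vY by auto
  qed
  have "inj_on O' {0..<P k + 1}" by (rule inj_on_subset[OF inj]) (use Pk in auto)
  moreover have "O' j \<in> nodes \<and> (P j = -1 \<or> 0 \<le> P j \<and> P j < j \<and> A j \<in> {1..int N} \<and> tight_arc p D Y' (A j) (O' (P j)) (O' j) \<and>
       (\<forall>j'\<in>{0..<P j}. \<forall>i\<in>{1..int N}. \<not> tight_arc p D Y' i (O' j') (O' j)))" if "j \<in> {0..<P k + 1}" for j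
  proof -
    have j: "0 \<le> j" "j \<le> P k" "j \<le> k" using that Pk(1) by auto
    then show ?thesis using P[OF j(1,3)] nod[OF j(1,3)] keep[OF j(1,2)] keep2[OF j(1,2)] by auto
  qed
  ultimately show "arcs p D Y' O' (P k + 1) P A" unfolding arcs_def by blast
qed

definition lift :: "(int \<Rightarrow> real) \<Rightarrow> int set \<Rightarrow> real \<Rightarrow> int \<Rightarrow> real" where
  "lift p S t = (\<lambda>v. if v \<in> S then p v + t else p v)"

lemma move_cost_lift:
  assumes "a \<in> nodes" "b \<in> nodes" "0 < D"
  shows "move_cost (lift p S (t / of_int D)) D Y i a b =
    move_cost p D Y i a b - (if a \<in> S then t else 0) + (if b \<in> S then t else 0)"
  unfolding move_cost_def red_move_diff[OF assms(1,2)] lift_def using assms(3)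
  by (auto simp: algebra_simps)

lemma all_opt_mc_nonneg:
  assumes "all_opt p D Y" "i \<in> {1..int N}" "can_move D Y i a b"
  shows "0 \<le> move_cost p D Y i a b"
proof -
  have "grid_opt (F i) (L i) (U i) (M i) p D (vec Y i)" using assms unfolding all_opt_def by blast
  from grid_optD(2)[OF this assms(3)[unfolded can_move_def] same_grid_move[OF dvd_refl]]
  show ?thesis unfolding move_cost_def by simp
qed

lemma all_opt_lift:
  assumes so: "all_opt p D Y" and D: "0 < D" and t: "0 \<le> t"
    and th: "\<And>i a b. i \<in> {1..int N} \<Longrightarrow> a \<in> nodes \<inter> S \<Longrightarrow> b \<in> nodes - S \<Longrightarrow> can_move D Y i a b \<Longrightarrow> t \<le> move_cost p D Y i a b"
  shows "all_opt (lift p S (t / of_int D)) D Y"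
  unfolding all_opt_def
proof
  fix i assume i: "i \<in> {1..int N}"
  show "grid_opt (F i) (L i) (U i) (M i) (lift p S (t / of_int D)) D (vec Y i)"
  proof (rule grid_optI_local[OF mm[OF i] _ D])
    show "adm (L i) (U i) (M i) (vec Y i)" using so i grid_optD(1) unfolding all_opt_def by blast
  next
    fix a b assume ab: "a \<in> nodes" "b \<in> nodes" "adm (L i) (U i) (M i) (move (vec Y i) a b D)"
    then have "can_move D Y i a b" unfolding can_move_def by simp
    then have "0 \<le> move_cost (lift p S (t / of_int D)) D Y i a b"
      unfolding move_cost_lift[OF ab(1,2) D]
      using all_opt_mc_nonneg[OF so i, of a b] th[OF i, of a b] t ab(1,2) \<open>can_move D Y i a b\<close>
      by (cases "a \<in> S"; cases "b \<in> S") simp_all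
    then show "red (F i) (lift p S (t / of_int D)) (vec Y i) \<le> red (F i) (lift p S (t / of_int D)) (move (vec Y i) a b D)"
      unfolding move_cost_def by simp
  qed
qed

text \<open>The prices of all reached nodes are raised by the least cost of an arc leaving them, which makes this arc tight and
keeps all others nonnegative. Taking an arc whose tail was reached as early as possible excludes shortcuts to the
new node, and later raises leave arcs within the tree alone.\<close>

lemma arcs_extend:
  assumes so: "all_opt p D Y" and D: "0 < D" and ar: "arcs p D Y O' k P A"
    and k: "0 \<le> j" "j < k" and b: "b \<in> nodes - S" and S: "S = O' ` {0..<k}" and i: "i \<in> {1..int N}"
    and m: "can_move D Y i (O' j) b" and t: "t = move_cost p D Y i (O' j) b"
    and min: "\<And>i' j' b'. i' \<in> {1..int N} \<Longrightarrow> 0 \<le> j' \<Longrightarrow> j' < k \<Longrightarrow> b' \<in> nodes - S \<Longrightarrow> can_move D Y i' (O' j') b' \<Longrightarrow>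
       t \<le> move_cost p D Y i' (O' j') b'"
    and first: "\<And>i' j'. i' \<in> {1..int N} \<Longrightarrow> 0 \<le> j' \<Longrightarrow> j' < j \<Longrightarrow> can_move D Y i' (O' j') b \<Longrightarrow> t < move_cost p D Y i' (O' j') b"
  shows "all_opt (lift p S (t / of_int D)) D Y"
    "arcs (lift p S (t / of_int D)) D Y (O'(k := b)) (k + 1) (P(k := j)) (A(k := i))"
proof -
  let ?p = "lift p S (t / of_int D)" and ?O = "O'(k := b)" and ?P = "P(k := j)" and ?A = "A(k := i)"
  have nod: "\<And>j. 0 \<le> j \<Longrightarrow> j < k \<Longrightarrow> O' j \<in> nodes" using ar unfolding arcs_def by auto
  have t0: "0 \<le> t" unfolding t by (rule all_opt_mc_nonneg[OF so i m])
  show "all_opt ?p D Y"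
  proof (rule all_opt_lift[OF so D t0])
    fix i' a b' assume "i' \<in> {1..int N}" "a \<in> nodes \<inter> S" "b' \<in> nodes - S" "can_move D Y i' a b'"
    then show "t \<le> move_cost p D Y i' a b'" using min unfolding S by auto
  qed
  have same: "tight_arc ?p D Y i' (O' a) (O' c) \<longleftrightarrow> tight_arc p D Y i' (O' a) (O' c)" if "0 \<le> a" "a < k" "0 \<le> c" "c < k" for i' a c
    using that nod move_cost_lift[OF nod[of a] nod[of c] D] unfolding tight_arc_def S by auto
  have new: "move_cost ?p D Y i' (O' a) b = move_cost p D Y i' (O' a) b - t" if "0 \<le> a" "a < k" for i' a
    using that b nod move_cost_lift[OF nod[of a] _ D, of b] unfolding S by auto
  have inj: "inj_on ?O {0..<k+1}"
  proof -
    have "{0..<k+1} = insert k {0..<k}" using k by auto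
    moreover have "inj_on O' {0..<k}" using ar unfolding arcs_def by blast
    ultimately show ?thesis using b unfolding S by (auto simp: inj_on_def)
  qed
  have "?O a \<in> nodes \<and> (?P a = -1 \<or> 0 \<le> ?P a \<and> ?P a < a \<and> ?A a \<in> {1..int N} \<and> tight_arc ?p D Y (?A a) (?O (?P a)) (?O a) \<and>
       (\<forall>j'\<in>{0..<?P a}. \<forall>i\<in>{1..int N}. \<not> tight_arc ?p D Y i (?O j') (?O a)))" if a: "a \<in> {0..<k+1}" for a
  proof (cases "a = k")
    case True
    have "tight_arc ?p D Y i (O' j) b" using m new k t unfolding tight_arc_def by simp
    moreover have "\<not> tight_arc ?p D Y i' (O' j') b" if "0 \<le> j'" "j' < j" "i' \<in> {1..int N}" for i' j'
      using first[of i' j'] that new[of j'] k unfolding tight_arc_def by auto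
    ultimately show ?thesis using True k b i by auto
  next
    case False
    then have a': "0 \<le> a" "a < k" using a by auto
    then show ?thesis using arcsD(2,3)[OF ar a'] False same by auto
  qed
  with inj show "arcs ?p D Y ?O (k + 1) ?P ?A" unfolding arcs_def by blast
qed

lemma stuck_posx:
  assumes so: "all_opt p D Y" and D: "0 < D" and S: "S \<subseteq> nodes"
    and cl: "\<And>i a b. i \<in> {1..int N} \<Longrightarrow> a \<in> S \<Longrightarrow> b \<in> nodes - S \<Longrightarrow> \<not> can_move D Y i a b"
    and inS: "\<And>v. v \<in> S \<Longrightarrow> excess Y v > - D" and out: "\<And>v. v \<in> nodes - S \<Longrightarrow> excess Y v < D"
  shows "surplus (excess Y) \<le> (12 * int N + 8) * (D - 1)"
proof -
  have "(\<Sum>v\<in>S. excess Y v) = (\<Sum>i\<in>{1..int N}. (\<Sum>v\<in>S. vec Y i v) - (\<Sum>v\<in>S. Z i v))"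
    unfolding excess_def by (subst sum.swap) (simp add: sum_subtractf)
  also have "\<dots> \<le> (\<Sum>i\<in>{1..int N}. 12 * (D - 1))"
  proof (rule sum_mono)
    fix i assume i: "i \<in> {1..int N}"
    have "adm (L i) (U i) (M i) (vec Y i)" using so i grid_optD(1) unfolding all_opt_def by blast
    from closed_excess[OF this Zadm[OF i] D S] cl[OF i]
    show "(\<Sum>v\<in>S. vec Y i v) - (\<Sum>v\<in>S. Z i v) \<le> 12 * (D - 1)" unfolding can_move_def by fastforce
  qed
  also have "\<dots> = 12 * int N * (D - 1)" by simp
  finally have *: "(\<Sum>v\<in>S. excess Y v) \<le> 12 * int N * (D - 1)" .
  have "surplus (excess Y) \<le> (\<Sum>v\<in>nodes. (if v \<in> S then excess Y v else 0) + (D - 1))"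
    unfolding surplus_def
  proof (rule sum_mono)
    fix v assume "v \<in> nodes"
    then show "max 0 (excess Y v) \<le> (if v \<in> S then excess Y v else 0) + (D - 1)"
      using inS[of v] out[of v] D by auto
  qed
  also have "\<dots> = (\<Sum>v\<in>nodes \<inter> S. excess Y v) + 4 * (D - 1)"
    unfolding sum.distrib by (subst sum.inter_restrict) auto
  also have "nodes \<inter> S = S" using S by blast
  finally have "surplus (excess Y) \<le> 12 * int N * (D - 1) + 4 * (D - 1)" using * by linarith
  also have "\<dots> \<le> (12 * int N + 8) * (D - 1)" using D by (simp add: algebra_simps)
  finally show ?thesis .
qed

end

section \<open>Reasoning about programs and their running time\<close>

text \<open>Total correctness with a bound on the running time.\<close>

definition runs :: "oracle_fun \<Rightarrow> com \<Rightarrow> nat \<Rightarrow> state \<Rightarrow> (state \<Rightarrow> bool) \<Rightarrow> bool" where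
  "runs c P k s Q \<longleftrightarrow> (\<exists>t s'. exec c P s t s' \<and> t \<le> k \<and> Q s')"

lemma runs_exec: "exec c P s t s' \<Longrightarrow> t \<le> k \<Longrightarrow> Q s' \<Longrightarrow> runs c P k s Q"
  unfolding runs_def by blast

lemma runs_mono: "runs c P k s Q \<Longrightarrow> k \<le> k' \<Longrightarrow> (\<And>s'. Q s' \<Longrightarrow> Q' s') \<Longrightarrow> runs c P k' s Q'"
  unfolding runs_def by (meson le_trans)

lemma runs_Seq: "runs c P k s (\<lambda>s'. runs c P' k' s' Q) \<Longrightarrow> runs c (Seq P P') (k + k') s Q"
  unfolding runs_def by (meson add_mono exec.Seq)

lemma runs_Cond:
  assumes "bval c s e \<Longrightarrow> runs c P k s Q" "\<not> bval c s e \<Longrightarrow> runs c P' k s Q"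
  shows "runs c (Cond e P P') (btime e + k + 1) s Q"
proof (cases "bval c s e")
  case True
  from assms(1)[OF this] obtain t s' where "exec c P s t s'" "t \<le> k" "Q s'" unfolding runs_def by blast
  then show ?thesis unfolding runs_def
    by (intro exI[of _ "btime e + t + 1"] exI[of _ s']) (use True exec.CondTrue in auto)
next
  case False
  from assms(2)[OF this] obtain t s' where "exec c P' s t s'" "t \<le> k" "Q s'" unfolding runs_def by blast
  then show ?thesis unfolding runs_def
    by (intro exI[of _ "btime e + t + 1"] exI[of _ s']) (use False exec.CondFalse in auto)
qed

fun loopfree :: "com \<Rightarrow> bool" where
  "loopfree (Seq P Q) \<longleftrightarrow> loopfree P \<and> loopfree Q"
| "loopfree (Cond e P Q) \<longleftrightarrow> loopfree P \<and> loopfree Q"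
| "loopfree (While e P) \<longleftrightarrow> False"
| "loopfree _ \<longleftrightarrow> True"

text \<open>Meaningful for loop-free programs only. Their running time is at most the constant \<open>maxtime\<close>, the value of
which never matters.\<close>

fun sem :: "oracle_fun \<Rightarrow> com \<Rightarrow> state \<Rightarrow> state" where
  "sem c Skip s = s"
| "sem c (IAssign x e a) s = iwrite x (ival s e) (ival s a) s"
| "sem c (RAssign x e a) s = rwrite x (ival s e) (rval c s a) s"
| "sem c (Seq P Q) s = sem c Q (sem c P s)"
| "sem c (Cond e P Q) s = (if bval c s e then sem c P s else sem c Q s)"
| "sem c (While e P) s = s"

fun maxtime :: "com \<Rightarrow> nat" where
  "maxtime Skip = 1"
| "maxtime (IAssign x e a) = itime e + itime a + 1"
| "maxtime (RAssign x e a) = itime e + rtime a + 1"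
| "maxtime (Seq P Q) = maxtime P + maxtime Q"
| "maxtime (Cond e P Q) = btime e + (maxtime P + maxtime Q) + 1"
| "maxtime (While e P) = 0"

lemma runs_sem: "loopfree P \<Longrightarrow> Q (sem c P s) \<Longrightarrow> runs c P (maxtime P) s Q"
proof (induction P arbitrary: s Q)
  case (Seq P1 P2)
  then show ?case by (auto intro: runs_Seq)
next
  case (Cond e P1 P2)
  show ?case unfolding maxtime.simps
  proof (rule runs_Cond)
    assume "bval c s e"
    with Cond show "runs c P1 (maxtime P1 + maxtime P2) s Q" by (auto intro: runs_mono[of c P1 "maxtime P1" s Q])
  next
    assume "\<not> bval c s e"
    with Cond show "runs c P2 (maxtime P1 + maxtime P2) s Q" by (auto intro: runs_mono[of c P2 "maxtime P2" s Q])
  qed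
next
  case Skip
  then show ?case by (intro runs_exec[OF exec.Skip]) auto
next
  case (IAssign x e a)
  then show ?case by (intro runs_exec[OF exec.IAssign]) auto
next
  case (RAssign x e a)
  then show ?case by (intro runs_exec[OF exec.RAssign]) auto
qed simp

fun imods :: "com \<Rightarrow> string set" where
  "imods (IAssign x e a) = {x}"
| "imods (Seq P Q) = imods P \<union> imods Q"
| "imods (Cond e P Q) = imods P \<union> imods Q"
| "imods (While e P) = imods P"
| "imods _ = {}"

fun rmods :: "com \<Rightarrow> string set" where
  "rmods (RAssign x e a) = {x}"
| "rmods (Seq P Q) = rmods P \<union> rmods Q"
| "rmods (Cond e P Q) = rmods P \<union> rmods Q"
| "rmods (While e P) = rmods P"
| "rmods _ = {}"

lemma mem_write [simp]:
  "imem (iwrite x k v s) = (imem s)(x := (imem s x)(k := v))" "rmem (iwrite x k v s) = rmem s"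
  "rmem (rwrite x k r s) = (rmem s)(x := (rmem s x)(k := r))" "imem (rwrite x k r s) = imem s"
  by (simp_all add: iwrite_def rwrite_def)

definition agree :: "string set \<Rightarrow> string set \<Rightarrow> state \<Rightarrow> state \<Rightarrow> bool" where
  "agree W R s s' \<longleftrightarrow> (\<forall>x. x \<notin> W \<longrightarrow> imem s' x = imem s x) \<and> (\<forall>x. x \<notin> R \<longrightarrow> rmem s' x = rmem s x)"

abbreviation frame :: "com \<Rightarrow> state \<Rightarrow> state \<Rightarrow> bool" where
  "frame P \<equiv> agree (imods P) (rmods P)"

lemma agree_refl [simp]: "agree W R s s"
  by (simp add: agree_def)

lemma agree_trans: "agree W R s s' \<Longrightarrow> agree W R s' s'' \<Longrightarrow> agree W R s s''"
  by (simp add: agree_def)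

lemma agree_mono: "agree W R s s' \<Longrightarrow> W \<subseteq> W' \<Longrightarrow> R \<subseteq> R' \<Longrightarrow> agree W' R' s s'"
  unfolding agree_def by blast

lemma agree_iwrite: "x \<in> W \<Longrightarrow> agree W R s s' \<Longrightarrow> agree W R s (iwrite x k v s')"
  unfolding agree_def by auto

lemma agreeD:
  assumes "agree W R s s'"
  shows "x \<notin> W \<Longrightarrow> imem s' x = imem s x" "x \<notin> R \<Longrightarrow> rmem s' x = rmem s x"
  using assms unfolding agree_def by auto

lemma agree_seq: "agree W1 R1 s s' \<Longrightarrow> agree W2 R2 s' s'' \<Longrightarrow> agree (W1 \<union> W2) (R1 \<union> R2) s s''"
  by (simp add: agree_def)

lemma exec_agree: "exec c P s t s' \<Longrightarrow> frame P s s'"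
proof (induction rule: exec.induct)
  case (Seq P s t s' Q t' s'')
  then show ?case using agree_seq by simp
next
  case (CondTrue s e P t s' Q)
  then show ?case using agree_seq[OF _ agree_refl] by simp
next
  case (CondFalse s e Q t s' P)
  then show ?case using agree_seq[OF agree_refl] by simp
next
  case (WhileTrue s e P t s' t' s'')
  from agree_trans[OF WhileTrue.IH(1)] WhileTrue.IH(2) show ?case by simp
qed (simp_all add: agree_def)

lemma runs_agree: "runs c P k s Q \<Longrightarrow> runs c P k s (\<lambda>s'. Q s' \<and> frame P s s')"
  unfolding runs_def using exec_agree by blast

lemma sem_agree: "loopfree P \<Longrightarrow> frame P s (sem c P s)"
proof (induction P arbitrary: s)
  case (Seq P1 P2)
  then show ?case by (simp add: agree_seq[of _ _ s "sem c P1 s"])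
next
  case (Cond e P1 P2)
  then show ?case using agree_seq[OF _ agree_refl] agree_seq[OF agree_refl] by simp
qed (simp_all add: agree_def)

abbreviation V :: "string \<Rightarrow> iexp" where "V x \<equiv> IRead x (IConst 0)"
abbreviation ISet :: "string \<Rightarrow> iexp \<Rightarrow> com" where "ISet x a \<equiv> IAssign x (IConst 0) a"

definition For :: "string \<Rightarrow> iexp \<Rightarrow> com \<Rightarrow> com" where
  "For x h P = Seq (ISet x (IConst 0))
     (While (BNot (ILe h (V x))) (Seq P (ISet x (IAdd (V x) (IConst 1)))))"

lemma mods_For [simp]: "imods (For x h P) = insert x (imods P)" "rmods (For x h P) = rmods P"
  by (auto simp: For_def)

definition fortime :: "nat \<Rightarrow> nat \<Rightarrow> iexp \<Rightarrow> nat" where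
  "fortime n k h = n * (k + itime h + 20) + itime h + 20"

lemma runs_For:
  assumes init: "I 0 (iwrite x 0 0 s)"
    and H: "\<And>j s. j \<le> H \<Longrightarrow> I j s \<Longrightarrow> imem s x 0 = int j \<Longrightarrow> ival s h = int H"
    and body: "\<And>j s. j < H \<Longrightarrow> I j s \<Longrightarrow> imem s x 0 = int j \<Longrightarrow>
      runs c P k s (\<lambda>s'. imem s' x 0 = int j \<and> I (Suc j) (iwrite x 0 (int j + 1) s'))"
    and post: "\<And>s. I H s \<Longrightarrow> imem s x 0 = int H \<Longrightarrow> Q s"
  shows "runs c (For x h P) (fortime H k h) s Q"
proof -
  let ?W = "While (BNot (ILe h (V x))) (Seq P (ISet x (IAdd (V x) (IConst 1))))"
  have loop: "runs c ?W ((H - j) * (k + itime h + 20) + itime h + 10) s Q"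
    if "j \<le> H" "I j s" "imem s x 0 = int j" for j s
    using that
  proof (induction "H - j" arbitrary: j s)
    case 0
    then have "j = H" by simp
    with 0 have "Q s" "\<not> bval c s (BNot (ILe h (V x)))" using post H[of j s] by auto
    then show ?case by (intro runs_exec[OF exec.WhileFalse]) auto
  next
    case (Suc d)
    then have j: "j < H" by simp
    have b: "bval c s (BNot (ILe h (V x)))" using H[of j s] Suc.prems j by simp
    obtain t s' where 1: "exec c P s t s'" "t \<le> k" "imem s' x 0 = int j" "I (Suc j) (iwrite x 0 (int j + 1) s')"
      using body[OF j Suc.prems(2,3)] unfolding runs_def by blast
    let ?s = "iwrite x 0 (int j + 1) s'"
    have "exec c (ISet x (IAdd (V x) (IConst 1))) s' 6 ?s"
      using exec.IAssign[of c x "IConst 0" "IAdd (V x) (IConst 1)" s'] 1(3) by (simp add: numeral_eq_Suc)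
    then have 2: "exec c (Seq P (ISet x (IAdd (V x) (IConst 1)))) s (t + 6) ?s"
      by (rule exec.Seq[OF 1(1)])
    have "runs c ?W ((H - Suc j) * (k + itime h + 20) + itime h + 10) ?s Q"
      using Suc.hyps(2) j 1(4) by (intro Suc.hyps(1)) auto
    then obtain t' s'' where 3: "exec c ?W ?s t' s''" "t' \<le> (H - Suc j) * (k + itime h + 20) + itime h + 10" "Q s''"
      unfolding runs_def by blast
    have "H - j = Suc (H - Suc j)" using j by simp
    then have "btime (BNot (ILe h (V x))) + (t + 6) + t' + 1 \<le> (H - j) * (k + itime h + 20) + itime h + 10"
      using 1(2) 3(2) by simp
    with exec.WhileTrue[OF b 2 3(1)] 3(3) show ?case unfolding runs_def by blast
  qed
  have "runs c (ISet x (IConst 0)) 3 s (\<lambda>s'. runs c ?W (H * (k + itime h + 20) + itime h + 10) s' Q)"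
    using loop[of 0 "iwrite x 0 0 s"] init by (intro runs_exec[OF exec.IAssign]) simp_all
  from runs_Seq[OF this] show ?thesis
    unfolding For_def fortime_def by (rule runs_mono) auto
qed

subsection \<open>Selecting the first minimiser\<close>

definition argmin_body :: "com \<Rightarrow> bexp \<Rightarrow> rexp \<Rightarrow> com" where
  "argmin_body P ok val = Seq P (Cond (BAnd ok (BNot (BAnd (ILe (IConst 1) (V ''w'')) (RLe (RRead ''t'' (IConst 0)) val))))
     (Seq (RAssign ''t'' (IConst 0) val) (Seq (ISet ''B'' (V ''q'')) (ISet ''w'' (IConst 1)))) Skip)"

definition argmin :: "iexp \<Rightarrow> com \<Rightarrow> bexp \<Rightarrow> rexp \<Rightarrow> com" where
  "argmin h P ok val = Seq (ISet ''w'' (IConst 0)) (For ''q'' h (argmin_body P ok val))"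

definition argmin_time :: "nat \<Rightarrow> iexp \<Rightarrow> com \<Rightarrow> bexp \<Rightarrow> rexp \<Rightarrow> nat" where
  "argmin_time H h P ok val = 3 + fortime H (maxtime (argmin_body P ok val)) h"

text \<open>What \<open>argmin\<close> leaves in its cells \<open>w\<close>, \<open>B\<close>, \<open>t\<close>: whether there is a candidate, the first of the best ones, and
its value. That it is the first is used to prefer arcs with early tails.\<close>

definition first_min :: "nat \<Rightarrow> (nat \<Rightarrow> bool) \<Rightarrow> (nat \<Rightarrow> real) \<Rightarrow> int \<Rightarrow> int \<Rightarrow> real \<Rightarrow> bool" where
  "first_min H ok val w B t \<longleftrightarrow> (w = 0 \<and> (\<forall>q<H. \<not> ok q)) \<or>
     (w = 1 \<and> (\<exists>b<H. B = int b \<and> ok b \<and> t = val b \<and> (\<forall>q<H. ok q \<longrightarrow> val b \<le> val q) \<and>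
        (\<forall>q<b. ok q \<longrightarrow> val b < val q)))"

lemma first_min_skip:
  assumes "first_min j ok val w B t" "\<not> (ok j \<and> \<not> (1 \<le> w \<and> t \<le> val j))"
  shows "first_min (Suc j) ok val w B t"
proof -
  consider "w = 0" "\<forall>q<j. \<not> ok q" | b where "w = 1" "b < j" "B = int b" "ok b" "t = val b"
    "\<forall>q<j. ok q \<longrightarrow> val b \<le> val q" "\<forall>q<b. ok q \<longrightarrow> val b < val q"
    using assms(1) unfolding first_min_def by blast
  then show ?thesis
  proof cases
    case 1
    with assms(2) have "\<forall>q<Suc j. \<not> ok q" using less_Suc_eq by auto
    with 1 show ?thesis unfolding first_min_def by blast
  next
    case (2 b)
    have "\<forall>q<Suc j. ok q \<longrightarrow> val b \<le> val q" using 2 assms(2) less_Suc_eq by auto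
    moreover have "b < Suc j" using 2 by simp
    ultimately show ?thesis using 2 unfolding first_min_def by blast
  qed
qed

lemma first_min_take:
  assumes "first_min j ok val w B t" "ok j" "\<not> (1 \<le> w \<and> t \<le> val j)"
  shows "first_min (Suc j) ok val 1 (int j) (val j)"
proof -
  have "\<forall>q<j. ok q \<longrightarrow> val j < val q"
    using assms unfolding first_min_def by force
  moreover from this have "\<forall>q<Suc j. ok q \<longrightarrow> val j \<le> val q" using less_Suc_eq by fastforce
  ultimately show ?thesis using assms(2) unfolding first_min_def by blast
qed

lemma runs_argmin:
  assumes lf: "loopfree P" and fr: "''w'' \<notin> imods P" "''B'' \<notin> imods P" "''q'' \<notin> imods P" "rmods P = {}"
    and H: "\<And>s'. agree (imods P \<union> {''w'', ''B'', ''q''}) {''t''} s s' \<Longrightarrow> ival s' h = int H"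
    and P: "\<And>s' q. q < H \<Longrightarrow> agree (imods P \<union> {''w'', ''B'', ''q''}) {''t''} s s' \<Longrightarrow> imem s' ''q'' 0 = int q \<Longrightarrow>
      bval c (sem c P s') ok = okf q \<and> rval c (sem c P s') val = valf q"
  shows "runs c (argmin h P ok val) (argmin_time H h P ok val) s (\<lambda>s'.
    agree (imods P \<union> {''w'', ''B'', ''q''}) {''t''} s s' \<and>
    first_min H okf valf (imem s' ''w'' 0) (imem s' ''B'' 0) (rmem s' ''t'' 0))"
proof -
  let ?W = "imods P \<union> {''w'', ''B'', ''q''}"
  let ?I = "\<lambda>j s'. agree ?W {''t''} s s' \<and> first_min j okf valf (imem s' ''w'' 0) (imem s' ''B'' 0) (rmem s' ''t'' 0)"
  have "runs c (For ''q'' h (argmin_body P ok val)) (fortime H (maxtime (argmin_body P ok val)) h)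
     (iwrite ''w'' 0 0 s) (?I H)"
  proof (rule runs_For[where I = ?I])
    show "?I 0 (iwrite ''q'' 0 0 (iwrite ''w'' 0 0 s))"
      by (auto simp: first_min_def intro!: agree_iwrite)
  next
    fix j s' assume j: "j < H" "?I j s'" "imem s' ''q'' 0 = int j"
    let ?s = "sem c P s'"
    have ev: "bval c ?s ok = okf j" "rval c ?s val = valf j" using P[OF j(1) _ j(3)] j(2) by auto
    have ag: "agree (imods P) {} s' ?s" using sem_agree[OF lf, of s' c] fr by simp
    have ag2: "agree ?W {''t''} s ?s"
      using agree_trans[of ?W "{''t''}" s s' ?s] j(2) agree_mono[OF ag] by blast
    have same: "imem ?s ''w'' 0 = imem s' ''w'' 0" "imem ?s ''B'' 0 = imem s' ''B'' 0"
      "imem ?s ''q'' 0 = int j" "rmem ?s ''t'' 0 = rmem s' ''t'' 0"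
      using agreeD[OF ag] fr j(3) by auto
    show "runs c (argmin_body P ok val) (maxtime (argmin_body P ok val)) s'
      (\<lambda>s''. imem s'' ''q'' 0 = int j \<and> ?I (Suc j) (iwrite ''q'' 0 (int j + 1) s''))"
    proof (rule runs_sem)
      show "loopfree (argmin_body P ok val)" using lf by (simp add: argmin_body_def)
      let ?t = "sem c (argmin_body P ok val) s'"
      show "imem ?t ''q'' 0 = int j \<and> ?I (Suc j) (iwrite ''q'' 0 (int j + 1) ?t)"
      proof (cases "okf j \<and> \<not> (1 \<le> imem s' ''w'' 0 \<and> rmem s' ''t'' 0 \<le> valf j)")
        case True
        then have t: "?t = iwrite ''w'' 0 1 (iwrite ''B'' 0 (int j) (rwrite ''t'' 0 (valf j) ?s))"
          by (simp add: argmin_body_def ev same)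
        have "agree ?W {''t''} s (iwrite ''q'' 0 (int j + 1) ?t)"
          using ag2 unfolding t agree_def by simp
        moreover have "first_min (Suc j) okf valf 1 (int j) (valf j)"
          using first_min_take[of j okf valf] j(2) True by blast
        ultimately show ?thesis using same by (simp add: t)
      next
        case False
        then have t: "?t = ?s" by (auto simp: argmin_body_def ev same)
        have "agree ?W {''t''} s (iwrite ''q'' 0 (int j + 1) ?t)"
          using ag2 unfolding t agree_def by simp
        with first_min_skip[OF conjunct2[OF j(2)] False] show ?thesis using same by (simp add: t)
      qed
    qed
  qed (use H in auto)
  then have "runs c (ISet ''w'' (IConst 0)) 3 s (\<lambda>s'. runs c (For ''q'' h (argmin_body P ok val)) (fortime H (maxtime (argmin_body P ok val)) h)
     s' (?I H))"
    by (intro runs_exec[OF exec.IAssign]) simp_all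
  from runs_Seq[OF this] show ?thesis unfolding argmin_def argmin_time_def .
qed

section \<open>The program\<close>

abbreviation C :: "int \<Rightarrow> iexp" where "C \<equiv> IConst"

text \<open>The memory is used as follows. Input-dependent constants: the number \<open>N\<close> of stations including the dummy, the bounds
\<open>lo\<close>, \<open>up\<close> and reference levels \<open>m\<close>, the factor \<open>f\<close> of the cost, which is 0 for the dummy and 1 otherwise. State of
the algorithm: the step \<open>D\<close>, the vectors \<open>y\<close>, the excess \<open>e\<close> and the price \<open>p\<close> of the nodes. Search: the positions
\<open>o\<close>, \<open>P\<close>, \<open>A\<close> of the forest and their number \<open>k\<close>, the membership \<open>r\<close> in the forest, the outcome \<open>g\<close> (0: undecided, 1: a
deficit node is reached, 2: stuck). Candidates: the number \<open>q\<close>, the tail \<open>s\<close> at position \<open>j\<close>, the head \<open>v\<close>, the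
station \<open>i\<close> and the point \<open>z\<close>. The loops count in \<open>x\<close>, \<open>h\<close>, \<open>c\<close> and \<open>H\<close>.\<close>

definition ycell :: "iexp \<Rightarrow> iexp" where
  "ycell v = IAdd (IMul (C 4) (V ''i'')) v"

definition price :: "string \<Rightarrow> iexp \<Rightarrow> int \<Rightarrow> rexp" where
  "price a b v = RMul (RRead ''p'' (C v)) (ROfInt (IRead a (IAdd b (C v))))"

definition valexp :: "string \<Rightarrow> iexp \<Rightarrow> rexp" where
  "valexp a b = RAdd (RMul (ROfInt (IRead ''f'' (V ''i'')))
       (Query (V ''i'') (IRead a (IAdd b (C 2))) (IRead a (IAdd b (C 3)))))
     (RAdd (RAdd (RAdd (price a b 0) (price a b 1)) (price a b 2)) (price a b 3))"

definition admexp :: bexp where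
  "admexp = BAnd (ILe (C 0) (IRead ''z'' (C 2))) (BAnd (ILe (C 0) (IRead ''z'' (C 3)))
     (BAnd (ILe (IRead ''z'' (C 1)) (C 0)) (BAnd (ILe (ISub (C 0) (IRead ''m'' (V ''i''))) (IRead ''z'' (C 0)))
     (BAnd (ILe (IRead ''lo'' (V ''i'')) (IAdd (IRead ''z'' (C 2)) (IRead ''z'' (C 3))))
       (ILe (IAdd (IRead ''z'' (C 2)) (IRead ''z'' (C 3))) (IRead ''up'' (V ''i'')))))))"

lemma bval_admexp:
  "bval c s admexp \<and> imem s ''z'' 0 + imem s ''z'' 1 + imem s ''z'' 2 + imem s ''z'' 3 = 0 \<longleftrightarrow>
   adm (imem s ''lo'' (imem s ''i'' 0)) (imem s ''up'' (imem s ''i'' 0)) (imem s ''m'' (imem s ''i'' 0)) (imem s ''z'')"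
  unfolding admexp_def adm_def by auto

lemma rval_valexp:
  "rval c s (valexp a b) = red (\<lambda>x y. real_of_int (imem s ''f'' (imem s ''i'' 0)) * c (nat (imem s ''i'' 0)) x y)
     (rmem s ''p'') (\<lambda>v. imem s a (ival s b + v))"
  unfolding valexp_def price_def red_def sum_nodes by simp

lemma adm_cong: "(\<And>k. k \<in> nodes \<Longrightarrow> x k = y k) \<Longrightarrow> adm l u m x \<longleftrightarrow> adm l u m y"
  unfolding adm_def by simp

text \<open>The candidates are numbered by three base-7 digits, which encode steps from -3 to 3 in the first three
coordinates. The fourth coordinate makes the sum zero.\<close>

definition prepR :: com where
  "prepR = Seq (IAssign ''z'' (C 0) (IAdd (IRead ''y'' (ycell (C 0))) (IMul (V ''D'') (ISub (IDiv (V ''q'') (C 49)) (C 3)))))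
    (Seq (IAssign ''z'' (C 1) (IAdd (IRead ''y'' (ycell (C 1))) (IMul (V ''D'')
       (ISub (ISub (IDiv (V ''q'') (C 7)) (IMul (C 7) (IDiv (V ''q'') (C 49)))) (C 3)))))
    (Seq (IAssign ''z'' (C 2) (IAdd (IRead ''y'' (ycell (C 2))) (IMul (V ''D'')
       (ISub (ISub (V ''q'') (IMul (C 7) (IDiv (V ''q'') (C 7)))) (C 3)))))
      (IAssign ''z'' (C 3) (ISub (ISub (ISub (C 0) (IRead ''z'' (C 0))) (IRead ''z'' (C 1))) (IRead ''z'' (C 2))))))"

definition shiftR :: "int \<Rightarrow> com" where
  "shiftR v = Seq (IAssign ''e'' (C v) (IAdd (IRead ''e'' (C v)) (ISub (IRead ''z'' (C v)) (IRead ''y'' (ycell (C v))))))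
     (IAssign ''y'' (ycell (C v)) (IRead ''z'' (C v)))"

definition finishR :: com where
  "finishR = Seq (ISet ''q'' (V ''B'')) (Seq prepR (Seq (shiftR 0) (Seq (shiftR 1) (Seq (shiftR 2) (shiftR 3)))))"

definition reopt :: com where
  "reopt = Seq (ISet ''i'' (IAdd (V ''x'') (C 1)))
     (Seq (argmin (C 343) prepR admexp (valexp ''z'' (C 0))) finishR)"

text \<open>The candidates are the triples of a tail position \<open>j\<close>, a head \<open>v\<close> and a station \<open>i\<close>, numbered lexicographically with
\<open>j\<close> leading, so that the first minimiser has the earliest tail.\<close>

definition prepS :: com where
  "prepS = Seq (ISet ''j'' (IDiv (V ''q'') (IMul (C 4) (V ''N''))))
    (Seq (ISet ''v'' (ISub (IDiv (V ''q'') (V ''N'')) (IMul (C 4) (V ''j''))))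
    (Seq (ISet ''i'' (IAdd (ISub (V ''q'') (IMul (V ''N'') (IDiv (V ''q'') (V ''N'')))) (C 1)))
    (Seq (ISet ''s'' (IRead ''o'' (V ''j'')))
    (Seq (IAssign ''z'' (C 0) (IRead ''y'' (ycell (C 0))))
    (Seq (IAssign ''z'' (C 1) (IRead ''y'' (ycell (C 1))))
    (Seq (IAssign ''z'' (C 2) (IRead ''y'' (ycell (C 2))))
    (Seq (IAssign ''z'' (C 3) (IRead ''y'' (ycell (C 3))))
    (Seq (IAssign ''z'' (V ''s'') (ISub (IRead ''z'' (V ''s'')) (V ''D'')))
         (IAssign ''z'' (V ''v'') (IAdd (IRead ''z'' (V ''v'')) (V ''D'')))))))))))"

definition okS :: bexp where
  "okS = BAnd (ILe (IAdd (V ''j'') (C 1)) (V ''k'')) (BAnd (ILe (IRead ''r'' (V ''v'')) (C 0)) admexp)"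

definition valS :: rexp where
  "valS = RSub (valexp ''z'' (C 0)) (valexp ''y'' (IMul (C 4) (V ''i'')))"

definition raiseS :: "int \<Rightarrow> com" where
  "raiseS v = Cond (ILe (C 1) (IRead ''r'' (C v)))
     (RAssign ''p'' (C v) (RAdd (RRead ''p'' (C v)) (RDiv (RRead ''t'' (C 0)) (ROfInt (V ''D''))))) Skip"

definition finishS :: com where
  "finishS = Cond (ILe (V ''w'') (C 0)) (ISet ''g'' (C 2))
    (Seq (ISet ''q'' (V ''B'')) (Seq prepS
    (Seq (raiseS 0) (Seq (raiseS 1) (Seq (raiseS 2) (Seq (raiseS 3)
    (Seq (IAssign ''r'' (V ''v'') (C 1)) (Seq (IAssign ''o'' (V ''k'') (V ''v''))
    (Seq (IAssign ''P'' (V ''k'') (V ''j'')) (Seq (IAssign ''A'' (V ''k'') (V ''i''))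
    (Seq (ISet ''k'' (IAdd (V ''k'') (C 1)))
      (Cond (ILe (IAdd (IRead ''e'' (V ''v'')) (V ''D'')) (C 0)) (ISet ''g'' (C 1)) Skip))))))))))))"

definition roundS :: com where
  "roundS = Cond (ILe (V ''g'') (C 0)) (Seq (argmin (IMul (C 16) (V ''N'')) prepS okS valS) finishS) Skip"

definition rootR :: com where
  "rootR = Seq (IAssign ''r'' (V ''x'') (C 0)) (Cond (ILe (V ''D'') (IRead ''e'' (V ''x'')))
     (Seq (IAssign ''r'' (V ''x'') (C 1)) (Seq (IAssign ''o'' (V ''k'') (V ''x''))
     (Seq (IAssign ''P'' (V ''k'') (C (-1))) (ISet ''k'' (IAdd (V ''k'') (C 1)))))) Skip)"

definition rootsR :: com where
  "rootsR = Seq (ISet ''k'' (C 0)) (Seq (ISet ''g'' (C 0)) (For ''x'' (C 4) rootR))"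

text \<open>One step towards the root. It does nothing at a root, so that three repetitions suffice for any path
on four nodes.\<close>

definition pushA :: com where
  "pushA = Cond (ILe (C 0) (IRead ''P'' (V ''k'')))
    (Seq (ISet ''i'' (IRead ''A'' (V ''k'')))
    (Seq (IAssign ''y'' (ycell (IRead ''o'' (IRead ''P'' (V ''k'')))) (ISub (IRead ''y'' (ycell (IRead ''o'' (IRead ''P'' (V ''k''))))) (V ''D'')))
    (Seq (IAssign ''y'' (ycell (IRead ''o'' (V ''k''))) (IAdd (IRead ''y'' (ycell (IRead ''o'' (V ''k'')))) (V ''D'')))
      (ISet ''k'' (IRead ''P'' (V ''k'')))))) Skip"

text \<open>The excess is only adjusted at the two ends of the path, \<open>e\<close> being stale in between.\<close>

definition augA :: com where
  "augA = Cond (BAnd (ILe (C 1) (V ''g'')) (ILe (V ''g'') (C 1)))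
    (Seq (Seq (ISet ''k'' (ISub (V ''k'') (C 1)))
      (IAssign ''e'' (IRead ''o'' (V ''k'')) (IAdd (IRead ''e'' (IRead ''o'' (V ''k''))) (V ''D''))))
    (Seq (For ''x'' (C 3) pushA)
      (IAssign ''e'' (IRead ''o'' (V ''k'')) (ISub (IRead ''e'' (IRead ''o'' (V ''k''))) (V ''D''))))) Skip"

text \<open>Four rounds decide the search, because each of them adds a node to a nonempty forest or gets stuck.\<close>

definition attempt :: com where
  "attempt = Seq rootsR (Seq (For ''h'' (C 4) roundS) augA)"

text \<open>The number of attempts is fixed in advance. Those after the last possible augmentation get stuck.\<close>

definition phase :: com where
  "phase = Seq (ISet ''D'' (IDiv (V ''D'') (C 2))) (Seq (For ''x'' (V ''N'') reopt)
     (For ''c'' (IMul (C 60) (V ''N'')) attempt))"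

lemma imods_prepR [simp]: "imods prepR = {''z''}" "rmods prepR = {}" "loopfree prepR"
  by (auto simp: prepR_def)

lemma imods_finishR [simp]: "imods finishR = {''z'', ''q'', ''e'', ''y''}" "rmods finishR = {}" "loopfree finishR"
  by (auto simp: finishR_def shiftR_def)

lemma imods_argmin [simp]: "imods (argmin h P ok val) = imods P \<union> {''w'', ''B'', ''q''}"
  "rmods (argmin h P ok val) = insert ''t'' (rmods P)"
  by (auto simp: argmin_def argmin_body_def)

lemma imods_reopt [simp]: "imods reopt = {''i'', ''z'', ''q'', ''e'', ''y'', ''w'', ''B''}" "rmods reopt = {''t''}"
  by (auto simp: reopt_def)

lemma imods_prepS [simp]: "imods prepS = {''j'', ''v'', ''i'', ''s'', ''z''}" "rmods prepS = {}" "loopfree prepS"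
  by (auto simp: prepS_def)

lemma imods_finishS [simp]:
  "imods finishS = {''j'', ''v'', ''i'', ''s'', ''z'', ''g'', ''q'', ''r'', ''o'', ''P'', ''A'', ''k''}"
  "rmods finishS = {''p''}" "loopfree finishS"
  by (auto simp: finishS_def raiseS_def)

lemma imods_roundS [simp]:
  "imods roundS = {''j'', ''v'', ''i'', ''s'', ''z'', ''g'', ''q'', ''r'', ''o'', ''P'', ''A'', ''k'', ''w'', ''B''}"
  "rmods roundS = {''t'', ''p''}"
  by (auto simp: roundS_def)

lemma imods_rootR [simp]: "imods rootR = {''r'', ''o'', ''P'', ''k''}" "rmods rootR = {}" "loopfree rootR"
  by (auto simp: rootR_def)

lemma imods_rootsR [simp]: "imods rootsR = {''x'', ''r'', ''o'', ''P'', ''k'', ''g''}" "rmods rootsR = {}"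
  by (auto simp: rootsR_def)

lemma imods_pushA [simp]: "imods pushA = {''i'', ''y'', ''k''}" "rmods pushA = {}" "loopfree pushA"
  by (auto simp: pushA_def)

lemma imods_augA [simp]: "imods augA = {''x'', ''i'', ''y'', ''k'', ''e''}" "rmods augA = {}"
  by (auto simp: augA_def)

lemma imods_attempt [simp]:
  "imods attempt = {''j'', ''v'', ''i'', ''s'', ''z'', ''g'', ''q'', ''r'', ''o'', ''P'', ''A'', ''k'', ''w'', ''B'', ''x'', ''h'', ''y'', ''e''}"
  "rmods attempt = {''t'', ''p''}"
  by (auto simp: attempt_def)

section \<open>Re-optimising one station\<close>

lemma sem_prepR:
  fixes s c
  defines "s' \<equiv> sem c prepR s"
  assumes q: "imem s ''q'' 0 = q" and i: "imem s ''i'' 0 = i" and D: "imem s ''D'' 0 = D"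
  shows "imem s' ''z'' 0 = imem s ''y'' (4 * i) + D * (q div 49 - 3)"
    "imem s' ''z'' 1 = imem s ''y'' (4 * i + 1) + D * (q div 7 - 7 * (q div 49) - 3)"
    "imem s' ''z'' 2 = imem s ''y'' (4 * i + 2) + D * (q - 7 * (q div 7) - 3)"
    "imem s' ''z'' 3 = - imem s' ''z'' 0 - imem s' ''z'' 1 - imem s' ''z'' 2"
  unfolding s'_def prepR_def ycell_def using q i D by simp_all

lemma sem_prepS:
  fixes s c
  defines "s' \<equiv> sem c prepS s"
  assumes q: "imem s ''q'' 0 = q" and N: "imem s ''N'' 0 = n" and D: "imem s ''D'' 0 = D"
  defines "j \<equiv> q div (4 * n)" and "i \<equiv> q - n * (q div n) + 1"
  defines "v \<equiv> q div n - 4 * j"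
  shows "imem s' ''j'' 0 = j" "imem s' ''v'' 0 = v" "imem s' ''i'' 0 = i"
    "k \<in> nodes \<Longrightarrow> imem s' ''z'' k = move (vec (imem s ''y'') i) (imem s ''o'' j) v D k"
proof -
  have a: "imem s' ''j'' 0 = j \<and> imem s' ''v'' 0 = v \<and> imem s' ''i'' 0 = i"
    unfolding s'_def prepS_def ycell_def using q N D by (simp add: j_def v_def i_def)
  then show "imem s' ''j'' 0 = j" "imem s' ''v'' 0 = v" "imem s' ''i'' 0 = i" by auto
  define z where "z = (imem s ''z'')(0 := imem s ''y'' (4 * i), 1 := imem s ''y'' (4 * i + 1),
      2 := imem s ''y'' (4 * i + 2), 3 := imem s ''y'' (4 * i + 3))"
  define z' where "z' = z(imem s ''o'' j := z (imem s ''o'' j) - D)"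
  have "imem s' ''z'' = z'(v := z' v + D)"
    unfolding s'_def prepS_def ycell_def z_def z'_def using q N D by (simp add: j_def v_def i_def)
  moreover have "z k = vec (imem s ''y'') i k" if "k \<in> nodes" for k
    using that unfolding z_def vec_def nodes_eq by auto
  ultimately show "imem s' ''z'' k = move (vec (imem s ''y'') i) (imem s ''o'' j) v D k" if "k \<in> nodes"
    using that unfolding z'_def move_def by auto
qed

lemma runs_SeqI: "runs c P k s Q' \<Longrightarrow> (\<And>s'. Q' s' \<Longrightarrow> runs c P' k' s' Q) \<Longrightarrow> runs c (Seq P P') (k + k') s Q"
  by (rule runs_Seq) (rule runs_mono[OF _ order_refl])

lemma sem_finishR:
  fixes s c
  defines "s' \<equiv> sem c finishR s" and "z \<equiv> imem (sem c prepR (iwrite ''q'' 0 (imem s ''B'' 0) s)) ''z''"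
  assumes i: "imem s ''i'' 0 = i"
  shows "imem s' ''y'' = (imem s ''y'')(4 * i := z 0, 4 * i + 1 := z 1, 4 * i + 2 := z 2, 4 * i + 3 := z 3)"
    "v \<in> nodes \<Longrightarrow> imem s' ''e'' v = imem s ''e'' v + (z v - imem s ''y'' (4 * i + v))"
proof -
  let ?t = "sem c prepR (iwrite ''q'' 0 (imem s ''B'' 0) s)"
  have ag: "agree {''z''} {} (iwrite ''q'' 0 (imem s ''B'' 0) s) ?t"
    using sem_agree[of prepR "iwrite ''q'' 0 (imem s ''B'' 0) s" c] by simp
  have t: "imem ?t ''y'' = imem s ''y''" "imem ?t ''e'' = imem s ''e''" "imem ?t ''i'' 0 = i"
    using agreeD(1)[OF ag] i by simp_all
  have s': "s' = sem c (Seq (shiftR 0) (Seq (shiftR 1) (Seq (shiftR 2) (shiftR 3)))) ?t"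
    unfolding s'_def finishR_def by simp
  show "imem s' ''y'' = (imem s ''y'')(4 * i := z 0, 4 * i + 1 := z 1, 4 * i + 2 := z 2, 4 * i + 3 := z 3)"
    unfolding s' shiftR_def ycell_def by (simp add: t z_def)
  show "imem s' ''e'' v = imem s ''e'' v + (z v - imem s ''y'' (4 * i + v))" if "v \<in> nodes"
    using that unfolding nodes_eq s' shiftR_def ycell_def by (auto simp: t z_def)
qed

text \<open>The point denoted by the number \<open>q\<close> in \<open>prepR\<close>.\<close>

definition cand :: "(int \<Rightarrow> int) \<Rightarrow> int \<Rightarrow> int \<Rightarrow> int \<Rightarrow> int \<Rightarrow> int" where
  "cand Y i D q = (\<lambda>v.
     let z0 = Y (4 * i) + D * (q div 49 - 3); z1 = Y (4 * i + 1) + D * (q div 7 - 7 * (q div 49) - 3);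
         z2 = Y (4 * i + 2) + D * (q - 7 * (q div 7) - 3)
     in if v = 0 then z0 else if v = 1 then z1 else if v = 2 then z2 else - z0 - z1 - z2)"

lemma cand_prepR:
  assumes "imem s ''q'' 0 = q" "imem s ''i'' 0 = i" "imem s ''D'' 0 = D" "k \<in> nodes"
  shows "imem (sem c prepR s) ''z'' k = cand (imem s ''y'') i D q k"
  using assms(4) sem_prepR[OF assms(1-3), of c] unfolding nodes_eq cand_def Let_def by auto

lemma base7_digits:
  fixes q :: int
  assumes "0 \<le> q" "q < 343"
  shows "0 \<le> q div 49" "q div 49 \<le> 6" "0 \<le> q div 7 - 7 * (q div 49)" "q div 7 - 7 * (q div 49) \<le> 6"
    "0 \<le> q - 7 * (q div 7)" "q - 7 * (q div 7) \<le> 6"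
proof -
  have "q div 49 = q div 7 div 7" using zdiv_zmult2_eq[of 7 q 7] by simp
  then have "q div 7 - 7 * (q div 49) = q div 7 mod 7" "q - 7 * (q div 7) = q mod 7"
    by (simp_all add: minus_mult_div_eq_mod)
  moreover have "0 \<le> x mod 7" "x mod 7 \<le> 6" for x :: int
    using pos_mod_sign[of 7 x] pos_mod_bound[of 7 x] by linarith+
  ultimately show "0 \<le> q div 7 - 7 * (q div 49)" "q div 7 - 7 * (q div 49) \<le> 6"
    "0 \<le> q - 7 * (q div 7)" "q - 7 * (q div 7) \<le> 6" by metis+
  show "0 \<le> q div 49" "q div 49 \<le> 6" using assms by linarith+
qed

lemma base7_div:
  fixes a b e :: int
  assumes "0 \<le> b" "b \<le> 6" "0 \<le> e" "e \<le> 6"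
  shows "(49 * a + 7 * b + e) div 49 = a" "(49 * a + 7 * b + e) div 7 = 7 * a + b"
  using assms by linarith+

lemma cand_surj:
  assumes "adm l u m (vec Y i)" "adm l u m x" "same_grid D x (vec Y i)" "\<forall>k\<in>nodes. \<bar>x k - vec Y i k\<bar> \<le> 3 * D" "0 < D"
  obtains q :: nat where "q < 343" "\<And>k. k \<in> nodes \<Longrightarrow> cand Y i D (int q) k = x k"
proof -
  have "\<exists>t. x k = vec Y i k + D * t \<and> - 3 \<le> t \<and> t \<le> 3" if "k \<in> nodes" for k
  proof -
    have "D dvd x k - vec Y i k" using assms(3) that unfolding same_grid_def by blast
    then obtain t where t: "x k - vec Y i k = D * t" by (elim dvdE)
    have "\<bar>D * t\<bar> \<le> 3 * D" using assms(4) that t[symmetric] by simp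
    then have "D * \<bar>t\<bar> \<le> D * 3" using assms(5) by (simp add: abs_mult)
    then have "\<bar>t\<bar> \<le> 3" using assms(5) by simp
    with t show ?thesis by (intro exI[of _ t]) auto
  qed
  note ex = this
  obtain a where a: "x 0 = vec Y i 0 + D * a" "- 3 \<le> a" "a \<le> 3" using ex[of 0] by auto
  obtain b where b: "x 1 = vec Y i 1 + D * b" "- 3 \<le> b" "b \<le> 3" using ex[of 1] by auto
  obtain e where e: "x 2 = vec Y i 2 + D * e" "- 3 \<le> e" "e \<le> 3" using ex[of 2] by auto
  define q where "q = 49 * (a + 3) + 7 * (b + 3) + (e + 3)"
  have q: "q div 49 = a + 3" "q div 7 = 7 * (a + 3) + (b + 3)" "0 \<le> q" "q < 343"
    using base7_div[of "b + 3" "e + 3" "a + 3"] a(2,3) b(2,3) e(2,3) unfolding q_def by auto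
  have s: "x 0 + x 1 + x 2 + x 3 = 0" using assms(2) unfolding adm_def by auto
  show thesis
  proof (rule that[of "nat q"])
    show "nat q < 343" using q by simp
    have qe: "q - 7 * (q div 7) = e + 3" unfolding q(2) unfolding q_def by simp
    have vY: "vec Y i 0 = Y (4 * i)" "vec Y i 1 = Y (4 * i + 1)" "vec Y i 2 = Y (4 * i + 2)"
      by (auto simp: vec_def)
    fix k assume "k \<in> nodes"
    then show "cand Y i D (int (nat q)) k = x k"
      using s a(1) b(1) e(1) q qe unfolding cand_def Let_def vY nodes_eq by auto
  qed
qed

definition reopt_time :: nat where
  "reopt_time = 6 + (argmin_time 343 (C 343) prepR admexp (valexp ''z'' (C 0)) + maxtime finishR)"

text \<open>The factor \<open>G i\<close> switches off the cost of the dummy station, at which the oracle may answer anything.\<close>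

locale prog = network N "\<lambda>i a b. real_of_int (G i) * c (nat i) a b" L U M Z
  for N :: nat and c :: oracle_fun and G L U M :: "int \<Rightarrow> int" and Z :: "int \<Rightarrow> int \<Rightarrow> int"
begin

abbreviation F :: "int \<Rightarrow> int \<Rightarrow> int \<Rightarrow> real" where
  "F \<equiv> \<lambda>i a b. real_of_int (G i) * c (nat i) a b"

definition static :: "state \<Rightarrow> bool" where
  "static s \<longleftrightarrow> imem s ''N'' 0 = int N \<and> imem s ''lo'' = L \<and> imem s ''up'' = U \<and> imem s ''m'' = M \<and> imem s ''f'' = G"

lemma static_agree: "static s \<Longrightarrow> agree W R s s' \<Longrightarrow> W \<inter> {''N'', ''lo'', ''up'', ''m'', ''f''} = {} \<Longrightarrow> static s'"
  unfolding static_def agree_def by auto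

definition balanced :: "state \<Rightarrow> bool" where
  "balanced s \<longleftrightarrow> (\<forall>v\<in>nodes. imem s ''e'' v = excess (imem s ''y'') v)"

lemma excess_update:
  assumes "i \<in> {1..int N}" "\<And>i'. i' \<noteq> i \<Longrightarrow> vec Y' i' = vec Y i'"
  shows "excess Y' v = excess Y v + (vec Y' i v - vec Y i v)"
proof -
  have "excess Y' v = (\<Sum>i'\<in>{1..int N}. (vec Y i' v - Z i' v) + (if i' = i then vec Y' i v - vec Y i v else 0))"
    unfolding excess_def using assms(2) by (intro sum.cong) auto
  then show ?thesis using assms(1) unfolding sum.distrib excess_def by simp
qed

text \<open>The search window contains a minimum on the finer grid by proximity. The fourth coordinate moves by at most the sum
of the other three, which explains the bound \<open>(3 + 3 + 3 + 9) * D\<close> for the change of the surplus.\<close>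

lemma runs_reopt:
  assumes st: "static s" and x: "imem s ''x'' 0 = int j" and j: "j < N" and Ds: "imem s ''D'' 0 = D" and D: "0 < D"
    and bal: "balanced s" and i: "i = int j + 1" and Y: "Y = imem s ''y''" and p: "p = rmem s ''p''"
    and op: "grid_opt (F i) (L i) (U i) (M i) p (2 * D) (vec Y i)"
  shows "runs c reopt reopt_time s (\<lambda>s'. frame reopt s s' \<and> balanced s' \<and>
     grid_opt (F i) (L i) (U i) (M i) p D (vec (imem s' ''y'') i) \<and>
     (\<forall>i'. i' \<noteq> i \<longrightarrow> vec (imem s' ''y'') i' = vec Y i') \<and>
     surplus (imem s' ''e'') \<le> surplus (imem s ''e'') + 18 * D)"
proof -
  have iN: "i \<in> {1..int N}" using i j by auto
  let ?s1 = "iwrite ''i'' 0 i s"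
  let ?A = "adm (L i) (U i) (M i)"
  let ?okf = "\<lambda>q::nat. ?A (cand Y i D (int q))" and ?valf = "\<lambda>q::nat. red (F i) p (cand Y i D (int q))"
  have am: "runs c (argmin (C 343) prepR admexp (valexp ''z'' (C 0)))
     (argmin_time 343 (C 343) prepR admexp (valexp ''z'' (C 0))) ?s1 (\<lambda>s'.
      agree (imods prepR \<union> {''w'', ''B'', ''q''}) {''t''} ?s1 s' \<and>
      first_min 343 ?okf ?valf (imem s' ''w'' 0) (imem s' ''B'' 0) (rmem s' ''t'' 0))"
  proof (rule runs_argmin)
    fix s' and q :: nat
    assume q: "q < 343" and ag: "agree (imods prepR \<union> {''w'', ''B'', ''q''}) {''t''} ?s1 s'"
      and sq: "imem s' ''q'' 0 = int q"
    let ?t = "sem c prepR s'"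
    have s': "imem s' ''i'' 0 = i" "imem s' ''D'' 0 = D" "imem s' ''y'' = Y" "rmem s' ''p'' = p"
      "imem s' ''lo'' = L" "imem s' ''up'' = U" "imem s' ''m'' = M" "imem s' ''f'' = G"
      using agreeD[OF ag] st Ds Y p unfolding static_def by simp_all
    have ag2: "agree {''z''} {} s' ?t" using sem_agree[of prepR s' c] by simp
    have t: "imem ?t ''i'' 0 = i" "imem ?t ''lo'' = L" "imem ?t ''up'' = U" "imem ?t ''m'' = M" "imem ?t ''f'' = G"
       "rmem ?t ''p'' = p"
      using agreeD[OF ag2] s' by simp_all
    have z: "imem ?t ''z'' k = cand Y i D (int q) k" if "k \<in> nodes" for k
      using cand_prepR[OF sq s'(1,2) that, of c] s'(3) by simp
    have "bval c ?t admexp \<longleftrightarrow> ?A (imem ?t ''z'')"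
      using bval_admexp[of c ?t] sem_prepR(4)[OF sq s'(1,2), of c] unfolding t by auto
    also have "\<dots> \<longleftrightarrow> ?okf q" by (rule adm_cong[OF z])
    finally show "bval c ?t admexp = ?okf q \<and> rval c ?t (valexp ''z'' (C 0)) = ?valf q"
      using red_cong[OF z] unfolding rval_valexp t by simp
  qed simp_all
  have fin: "frame reopt s s3 \<and> balanced s3 \<and>
     grid_opt (F i) (L i) (U i) (M i) p D (vec (imem s3 ''y'') i) \<and>
     (\<forall>i'. i' \<noteq> i \<longrightarrow> vec (imem s3 ''y'') i' = vec Y i') \<and>
     surplus (imem s3 ''e'') \<le> surplus (imem s ''e'') + 18 * D"
    if ag: "agree (imods prepR \<union> {''w'', ''B'', ''q''}) {''t''} ?s1 s2"
      and fm: "first_min 343 ?okf ?valf (imem s2 ''w'' 0) (imem s2 ''B'' 0) (rmem s2 ''t'' 0)"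
      and s3: "s3 = sem c finishR s2" for s2 s3
  proof -
    have s2: "imem s2 ''i'' 0 = i" "imem s2 ''D'' 0 = D" "imem s2 ''y'' = Y" "imem s2 ''e'' = imem s ''e''"
      using agreeD[OF ag] Ds Y by simp_all
    have admY: "?A (vec Y i)" using grid_optD(1)[OF op] .
    \<comment> \<open>The number with all digits 3 denotes the old point itself, so a candidate exists.\<close>
    have "?okf 171"
      using admY unfolding adm_def cand_def Let_def vec_def by simp
    moreover have "(171::nat) < 343" by simp
    ultimately have "\<not> (\<forall>q<343. \<not> ?okf q)" by blast
    then obtain b where b: "b < 343" "imem s2 ''B'' 0 = int b" "?okf b" "\<forall>q<343. ?okf q \<longrightarrow> ?valf b \<le> ?valf q"
      using fm unfolding first_min_def by blast
    let ?z = "imem (sem c prepR (iwrite ''q'' 0 (imem s2 ''B'' 0) s2)) ''z''"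
    have z: "?z k = cand Y i D (int b) k" if "k \<in> nodes" for k
      using cand_prepR[of "iwrite ''q'' 0 (imem s2 ''B'' 0) s2" "int b" i D k c] s2 b(2) that by simp
    note e3 = sem_finishR[where c = c, OF s2(1), folded s3]
    have vi: "vec (imem s3 ''y'') i k = cand Y i D (int b) k" if "k \<in> nodes" for k
      using that z unfolding e3(1) vec_def nodes_eq by auto
    have vo: "vec (imem s3 ''y'') i' = vec Y i'" if "i' \<noteq> i" for i'
    proof -
      have "4 * i' + v \<noteq> 4 * i \<and> 4 * i' + v \<noteq> 4 * i + 1 \<and> 4 * i' + v \<noteq> 4 * i + 2 \<and> 4 * i' + v \<noteq> 4 * i + 3"
        if "v \<in> nodes" for v using that \<open>i' \<noteq> i\<close> unfolding nodes_eq by auto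
      then show ?thesis unfolding e3(1) vec_def s2(3) by (auto simp: fun_eq_iff)
    qed
    have eD: "imem s3 ''e'' k = imem s ''e'' k + (cand Y i D (int b) k - vec Y i k)" if "k \<in> nodes" for k
      using e3(2)[OF that] z[OF that] that s2 unfolding vec_def by simp
    have bal3: "balanced s3"
      unfolding balanced_def
    proof
      fix k assume k: "k \<in> nodes"
      show "imem s3 ''e'' k = excess (imem s3 ''y'') k"
        using excess_update[OF iN vo, of k] eD[OF k] vi[OF k] bal k unfolding balanced_def Y by simp
    qed
    have cg: "same_grid D (cand Y i D (int b)) (vec Y i)"
    proof -
      have s0: "Y (4 * i) + Y (4 * i + 1) + Y (4 * i + 2) + Y (4 * i + 3) = 0"
        using admY unfolding adm_def vec_def by simp
      then have Y3: "Y (4 * i + 3) = - Y (4 * i) - Y (4 * i + 1) - Y (4 * i + 2)" by linarith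
      have "cand Y i D (int b) 3 - vec Y i 3 = D * (- (int b div 49 - 3) - (int b div 7 - 7 * (int b div 49) - 3) - (int b - 7 * (int b div 7) - 3))"
        unfolding cand_def vec_def Let_def using Y3 by (simp add: algebra_simps)
      then have "D dvd cand Y i D (int b) 3 - vec Y i 3" by simp
      then show ?thesis unfolding same_grid_def ball_nodes unfolding cand_def vec_def Let_def by simp
    qed
    have opc: "grid_opt (F i) (L i) (U i) (M i) p D (cand Y i D (int b))"
    proof (rule grid_opt_halve[OF mm[OF iN] op D b(3) cg])
      fix x assume x: "?A x" "same_grid D x (vec Y i)" "\<forall>k\<in>nodes. \<bar>x k - vec Y i k\<bar> \<le> 3 * D"
      obtain q :: nat where q: "q < 343" "\<And>k. k \<in> nodes \<Longrightarrow> cand Y i D (int q) k = x k"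
        using cand_surj[OF admY x D] by blast
      have "?okf q \<longleftrightarrow> ?A x" by (rule adm_cong[OF q(2)])
      then have "?okf q" using x(1) by blast
      then have "?valf b \<le> ?valf q" using b(4) q(1) by blast
      also have "\<dots> = red (F i) p x" by (rule red_cong[OF q(2)])
      finally show "?valf b \<le> red (F i) p x" .
    qed
    have ad3: "?A (vec (imem s3 ''y'') i)" using adm_cong[THEN iffD2, OF vi b(3)] .
    have rd3: "red (F i) p (vec (imem s3 ''y'') i) = ?valf b" by (rule red_cong[OF vi])
    have cg3: "same_grid D (vec (imem s3 ''y'') i) (cand Y i D (int b))" using vi unfolding same_grid_def by simp
    note op3 = grid_opt_congr[OF opc ad3 cg3 rd3]
    have d3: "\<bar>cand Y i D (int b) k - vec Y i k\<bar> \<le> (if k = 3 then 9 * D else 3 * D)" if k: "k \<in> nodes" for k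
    proof -
      have r: "0 \<le> int b div 49" "int b div 49 \<le> 6" "0 \<le> int b div 7 - 7 * (int b div 49)" "int b div 7 - 7 * (int b div 49) \<le> 6"
        "0 \<le> int b - 7 * (int b div 7)" "int b - 7 * (int b div 7) \<le> 6"
        using base7_digits[of "int b"] b(1) by auto
      have m: "\<bar>D * (t - 3)\<bar> \<le> 3 * D" if "0 \<le> t" "t \<le> 6" for t
      proof -
        have "\<bar>D * (t - 3)\<bar> = D * \<bar>t - 3\<bar>" using D by (simp add: abs_mult)
        also have "\<dots> \<le> D * 3" using that D by (intro mult_left_mono) auto
        finally show ?thesis by simp
      qed
      have v: "vec Y i 0 = Y (4 * i)" "vec Y i 1 = Y (4 * i + 1)" "vec Y i 2 = Y (4 * i + 2)"
        "vec Y i 3 = - Y (4 * i) - Y (4 * i + 1) - Y (4 * i + 2)"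
        using admY unfolding adm_def vec_def by simp_all
      define t0 where "t0 = D * (int b div 49 - 3)"
      define t1 where "t1 = D * (int b div 7 - 7 * (int b div 49) - 3)"
      define t2 where "t2 = D * (int b - 7 * (int b div 7) - 3)"
      have t: "\<bar>t0\<bar> \<le> 3 * D" "\<bar>t1\<bar> \<le> 3 * D" "\<bar>t2\<bar> \<le> 3 * D"
        using m[OF r(1,2)] m[OF r(3,4)] m[OF r(5,6)] unfolding t0_def t1_def t2_def by auto
      have "cand Y i D (int b) 0 - vec Y i 0 = t0" "cand Y i D (int b) 1 - vec Y i 1 = t1"
        "cand Y i D (int b) 2 - vec Y i 2 = t2" "cand Y i D (int b) 3 - vec Y i 3 = - t0 - t1 - t2"
        unfolding v cand_def Let_def t0_def t1_def t2_def by simp_all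
      with t have "\<forall>k\<in>nodes. \<bar>cand Y i D (int b) k - vec Y i k\<bar> \<le> (if k = 3 then 9 * D else 3 * D)"
        unfolding ball_nodes by simp
      then show ?thesis using k by blast
    qed
    have "surplus (imem s3 ''e'') \<le> (\<Sum>k\<in>nodes. max 0 (imem s ''e'' k) + (if k = 3 then 9 * D else 3 * D))"
      unfolding surplus_def
    proof (rule sum_mono)
      fix k assume "k \<in> nodes"
      then show "max 0 (imem s3 ''e'' k) \<le> max 0 (imem s ''e'' k) + (if k = 3 then 9 * D else 3 * D)"
        using eD[of k] d3[of k] D by auto
    qed
    also have "\<dots> = surplus (imem s ''e'') + 18 * D" unfolding sum.distrib surplus_def by (simp add: sum_nodes)
    finally have px: "surplus (imem s3 ''e'') \<le> surplus (imem s ''e'') + 18 * D" .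
    have "frame finishR s2 s3" unfolding s3 by (rule sem_agree) simp
    then have "frame reopt ?s1 s3"
      using agree_trans[of _ _ ?s1 s2 s3] agree_mono[OF ag] agree_mono[of "imods finishR" "rmods finishR" s2 s3] by simp
    moreover have "frame reopt s ?s1" by (intro agree_iwrite) auto
    ultimately show ?thesis using agree_trans bal3 op3 vo px by blast
  qed
  have 1: "runs c (ISet ''i'' (IAdd (V ''x'') (C 1))) 6 s (\<lambda>s'. s' = ?s1)"
    by (rule runs_exec[OF exec.IAssign]) (simp_all add: x i)
  show ?thesis unfolding reopt_time_def
    unfolding reopt_def
  proof (rule runs_SeqI[OF 1], unfold reopt_def[symmetric], erule ssubst, rule runs_SeqI[OF am], erule conjE)
    fix s2 assume "agree (imods prepR \<union> {''w'', ''B'', ''q''}) {''t''} ?s1 s2"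
      "first_min 343 ?okf ?valf (imem s2 ''w'' 0) (imem s2 ''B'' 0) (rmem s2 ''t'' 0)"
    note f = fin[OF this refl]
    show "runs c finishR (maxtime finishR) s2 (\<lambda>s'. frame reopt s s' \<and> balanced s' \<and>
      grid_opt (F i) (L i) (U i) (M i) p D (vec (imem s' ''y'') i) \<and>
      (\<forall>i'. i' \<noteq> i \<longrightarrow> vec (imem s' ''y'') i' = vec Y i') \<and>
      surplus (imem s' ''e'') \<le> surplus (imem s ''e'') + 18 * D)"
      by (rule runs_sem[OF imods_finishR(3)]) (rule f)
  qed
qed

end

section \<open>Growing the search tree\<close>

lemma sem_rootR:
  fixes s c
  defines "s' \<equiv> sem c rootR s" and "b \<equiv> imem s ''D'' 0 \<le> imem s ''e'' (imem s ''x'' 0)"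
  shows "imem s' ''r'' = (imem s ''r'')(imem s ''x'' 0 := if b then 1 else 0)"
    "imem s' ''o'' = (if b then (imem s ''o'')(imem s ''k'' 0 := imem s ''x'' 0) else imem s ''o'')"
    "imem s' ''P'' = (if b then (imem s ''P'')(imem s ''k'' 0 := -1) else imem s ''P'')"
    "imem s' ''k'' 0 = (if b then imem s ''k'' 0 + 1 else imem s ''k'' 0)"
  unfolding s'_def b_def rootR_def by simp_all

lemma sem_finishS:
  fixes s c
  defines "s' \<equiv> sem c finishS s" and "t \<equiv> sem c prepS (iwrite ''q'' 0 (imem s ''B'' 0) s)"
  assumes w: "\<not> imem s ''w'' 0 \<le> 0"
  shows "rmem s' ''p'' = (\<lambda>v. if v \<in> nodes \<and> 1 \<le> imem s ''r'' v then rmem s ''p'' v + rmem s ''t'' 0 / of_int (imem s ''D'' 0) else rmem s ''p'' v)"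
    "imem s' ''r'' = (imem s ''r'')(imem t ''v'' 0 := 1)"
    "imem s' ''o'' = (imem s ''o'')(imem s ''k'' 0 := imem t ''v'' 0)"
    "imem s' ''P'' = (imem s ''P'')(imem s ''k'' 0 := imem t ''j'' 0)"
    "imem s' ''A'' = (imem s ''A'')(imem s ''k'' 0 := imem t ''i'' 0)"
    "imem s' ''k'' 0 = imem s ''k'' 0 + 1"
    "imem s' ''g'' 0 = (if imem s ''e'' (imem t ''v'' 0) + imem s ''D'' 0 \<le> 0 then 1 else imem s ''g'' 0)"
proof -
  have ag: "frame prepS (iwrite ''q'' 0 (imem s ''B'' 0) s) t"
    unfolding t_def by (rule sem_agree) simp
  have t: "imem t ''r'' = imem s ''r''" "imem t ''o'' = imem s ''o''" "imem t ''P'' = imem s ''P''" "imem t ''A'' = imem s ''A''"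
    "imem t ''k'' = imem s ''k''" "imem t ''e'' = imem s ''e''" "imem t ''D'' = imem s ''D''" "imem t ''g'' = imem s ''g''"
    "rmem t = rmem s"
    using agreeD[OF ag] by (simp_all add: fun_eq_iff)
  let ?R = "Seq (raiseS 0) (Seq (raiseS 1) (Seq (raiseS 2) (raiseS 3)))"
  define u where "u = sem c ?R t"
  have um: "imem u = imem t" unfolding u_def raiseS_def by simp
  have up: "rmem u ''p'' = (\<lambda>v. if v \<in> nodes \<and> 1 \<le> imem s ''r'' v then rmem s ''p'' v + rmem s ''t'' 0 / of_int (imem s ''D'' 0) else rmem s ''p'' v)"
    unfolding u_def raiseS_def nodes_eq by (auto simp: t fun_eq_iff)
  have s': "s' = sem c (Seq (IAssign ''r'' (V ''v'') (C 1)) (Seq (IAssign ''o'' (V ''k'') (V ''v''))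
    (Seq (IAssign ''P'' (V ''k'') (V ''j'')) (Seq (IAssign ''A'' (V ''k'') (V ''i''))
    (Seq (ISet ''k'' (IAdd (V ''k'') (C 1)))
      (Cond (ILe (IAdd (IRead ''e'' (V ''v'')) (V ''D'')) (C 0)) (ISet ''g'' (C 1)) Skip)))))) u"
    using w unfolding s'_def finishS_def t_def u_def by simp
  show "rmem s' ''p'' = (\<lambda>v. if v \<in> nodes \<and> 1 \<le> imem s ''r'' v then rmem s ''p'' v + rmem s ''t'' 0 / of_int (imem s ''D'' 0) else rmem s ''p'' v)"
    unfolding up[symmetric] s' by simp
  show "imem s' ''r'' = (imem s ''r'')(imem t ''v'' 0 := 1)"
    "imem s' ''o'' = (imem s ''o'')(imem s ''k'' 0 := imem t ''v'' 0)"
    "imem s' ''P'' = (imem s ''P'')(imem s ''k'' 0 := imem t ''j'' 0)"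
    "imem s' ''A'' = (imem s ''A'')(imem s ''k'' 0 := imem t ''i'' 0)"
    "imem s' ''k'' 0 = imem s ''k'' 0 + 1"
    "imem s' ''g'' 0 = (if imem s ''e'' (imem t ''v'' 0) + imem s ''D'' 0 \<le> 0 then 1 else imem s ''g'' 0)"
    unfolding s' by (simp_all add: um t)
qed

lemma scan_decode:
  fixes n q :: int
  assumes "0 < n" "0 \<le> q" "q < 16 * n"
  defines "j \<equiv> q div (4 * n)"
  shows "0 \<le> j" "q div n - 4 * j \<in> nodes" "q - n * (q div n) + 1 \<in> {1..n}"
proof -
  have "j = q div n div 4" unfolding j_def using zdiv_zmult2_eq[of 4 q n] by (simp add: mult.commute)
  then have "q div n - 4 * j = q div n mod 4" by (simp add: minus_mult_div_eq_mod)
  then show "q div n - 4 * j \<in> nodes" by simp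
  have "q - n * (q div n) = q mod n" by (simp add: minus_mult_div_eq_mod)
  then show "q - n * (q div n) + 1 \<in> {1..n}"
    using pos_mod_sign[OF assms(1), of q] pos_mod_bound[OF assms(1), of q] unfolding atLeastAtMost_iff by linarith
  show "0 \<le> j" unfolding j_def using assms by (simp add: pos_imp_zdiv_nonneg_iff)
qed

lemma scan_encode:
  fixes n :: int
  assumes "0 < n" "0 \<le> j" "j < 4" "v \<in> nodes" "i \<in> {1..n}"
  defines "q \<equiv> (4 * j + v) * n + (i - 1)"
  shows "0 \<le> q" "q < 16 * n" "q div n = 4 * j + v" "q div (4 * n) = j" "q - n * (q div n) + 1 = i"
proof -
  show d: "q div n = 4 * j + v" unfolding q_def using assms(1,5)
    by (simp add: div_pos_pos_trivial)
  have v: "0 \<le> v" "v \<le> 3" using assms(4) by auto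
  have "q div (4 * n) = q div n div 4" using zdiv_zmult2_eq[of 4 q n] by (simp add: mult.commute)
  also have "\<dots> = j" unfolding d using v by linarith
  finally show "q div (4 * n) = j" .
  show "q - n * (q div n) + 1 = i" unfolding d unfolding q_def by (simp add: algebra_simps)
  have i: "1 \<le> i" "i \<le> n" using assms(5) by auto
  have "0 \<le> (4 * j + v) * n" using assms v by simp
  then show "0 \<le> q" unfolding q_def using i by linarith
  have "(4 * j + v) * n \<le> 15 * n" using assms v by (intro mult_right_mono) auto
  then show "q < 16 * n" unfolding q_def using i by linarith
qed

definition roots_time :: nat where
  "roots_time = 3 + (3 + fortime 4 (maxtime rootR) (C 4))"

definition round_time :: "nat \<Rightarrow> nat" where
  "round_time N = btime (ILe (V ''g'') (C 0)) + (argmin_time (16 * N) (IMul (C 16) (V ''N'')) prepS okS valS + maxtime finishS) + 1"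

context prog
begin

definition base :: "int \<Rightarrow> state \<Rightarrow> bool" where
  "base D s \<longleftrightarrow> static s \<and> imem s ''D'' 0 = D \<and> 0 < D \<and> balanced s \<and> all_opt (rmem s ''p'') D (imem s ''y'')"

definition tree :: "int \<Rightarrow> state \<Rightarrow> bool" where
  "tree D s \<longleftrightarrow> (let O' = imem s ''o''; k = imem s ''k'' 0 in
     0 \<le> k \<and> arcs (rmem s ''p'') D (imem s ''y'') O' k (imem s ''P'') (imem s ''A'') \<and>
     (\<forall>v\<in>nodes. imem s ''r'' v = (if v \<in> O' ` {0..<k} then 1 else 0)) \<and>
     (\<forall>j\<in>{0..<k}. imem s ''P'' j = -1 \<longrightarrow> D \<le> imem s ''e'' (O' j)) \<and>
     (\<forall>v\<in>nodes. D \<le> imem s ''e'' v \<longrightarrow> v \<in> O' ` {0..<k}))"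

text \<open>The last alternative of the first case measures progress: after \<open>h\<close> undecided rounds the forest has more than
\<open>h\<close> nodes, which is impossible for \<open>h = 4\<close>.\<close>

definition status :: "nat \<Rightarrow> int \<Rightarrow> state \<Rightarrow> bool" where
  "status h D s \<longleftrightarrow> (let O' = imem s ''o''; k = imem s ''k'' 0; g = imem s ''g'' 0 in
     (g = 0 \<and> (\<forall>j\<in>{0..<k}. - D < imem s ''e'' (O' j)) \<and> (h = 0 \<or> int h < k)) \<or>
     (g = 1 \<and> 1 \<le> k \<and> imem s ''e'' (O' (k - 1)) \<le> - D) \<or>
     (g = 2 \<and> surplus (imem s ''e'') \<le> (12 * int N + 8) * (D - 1)))"

lemma balanced_agree: "balanced s \<Longrightarrow> agree W R s s' \<Longrightarrow> ''e'' \<notin> W \<Longrightarrow> ''y'' \<notin> W \<Longrightarrow> balanced s'"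
  unfolding balanced_def agree_def by simp

lemma runs_roots:
  assumes b: "base D s"
  shows "runs c rootsR roots_time s (\<lambda>s'. frame rootsR s s' \<and> base D s' \<and> tree D s' \<and> status 0 D s')"
proof -
  let ?ag = "frame rootsR"
  define I where "I = (\<lambda>(j::nat) s'. ?ag s s' \<and> imem s' ''g'' 0 = 0 \<and> 0 \<le> imem s' ''k'' 0 \<and>
    inj_on (imem s' ''o'') {0..<imem s' ''k'' 0} \<and>
    (\<forall>a\<in>{0..<imem s' ''k'' 0}. imem s' ''o'' a \<in> {0..<int j} \<and> imem s' ''P'' a = -1 \<and> D \<le> imem s ''e'' (imem s' ''o'' a)) \<and>
    (\<forall>v\<in>{0..<int j}. imem s' ''r'' v = (if D \<le> imem s ''e'' v then 1 else 0) \<and>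
       (D \<le> imem s ''e'' v \<longrightarrow> v \<in> imem s' ''o'' ` {0..<imem s' ''k'' 0})))"
  let ?s2 = "iwrite ''g'' 0 0 (iwrite ''k'' 0 0 s)"
  have loop: "runs c (For ''x'' (C 4) rootR) (fortime 4 (maxtime rootR) (C 4)) ?s2 (I 4)"
  proof (rule runs_For[where I = I])
    show "I 0 (iwrite ''x'' 0 0 ?s2)" unfolding I_def agree_def by simp
  next
    fix j s' assume j: "j < 4" and I: "I j s'" and x: "imem s' ''x'' 0 = int j"
    let ?k = "imem s' ''k'' 0" and ?t = "sem c rootR s'"
    have ag: "?ag s s'" using I unfolding I_def by blast
    have s': "imem s' ''D'' 0 = D" "imem s' ''e'' = imem s ''e''"
      using agreeD[OF ag] b unfolding base_def by simp_all
    have ag2: "frame rootR s' ?t" by (rule sem_agree) simp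
    have t0: "imem ?t ''x'' 0 = int j" "imem ?t ''g'' 0 = 0"
      using agreeD[OF ag2] x I unfolding I_def by simp_all
    have agt: "?ag s (iwrite ''x'' 0 (int j + 1) ?t)"
      by (rule agree_iwrite, simp, rule agree_trans[OF ag agree_mono[OF ag2]]) auto
    note R = sem_rootR[of c s', unfolded x s']
    have "I (Suc j) (iwrite ''x'' 0 (int j + 1) ?t)"
    proof (cases "D \<le> imem s ''e'' (int j)")
      case False
      have "v \<in> {0..<int j} \<or> v = int j" if "v \<in> {0..<int (Suc j)}" for v using that by auto
      then show ?thesis using I agt False t0 unfolding I_def by (auto simp: R)
    next
      case True
      have k: "{0..<?k + 1} = insert ?k {0..<?k}" using I unfolding I_def by auto
      let ?O = "(imem s' ''o'')(?k := int j)"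
      have I': "imem s' ''g'' 0 = 0" "0 \<le> ?k" "inj_on (imem s' ''o'') {0..<?k}"
        "\<And>a. a \<in> {0..<?k} \<Longrightarrow> imem s' ''o'' a \<in> {0..<int j} \<and> imem s' ''P'' a = -1 \<and> D \<le> imem s ''e'' (imem s' ''o'' a)"
        "\<And>v. v \<in> {0..<int j} \<Longrightarrow> imem s' ''r'' v = (if D \<le> imem s ''e'' v then 1 else 0) \<and>
           (D \<le> imem s ''e'' v \<longrightarrow> v \<in> imem s' ''o'' ` {0..<?k})"
        using I unfolding I_def by blast+
      have im: "?O ` {0..<?k + 1} = insert (int j) (imem s' ''o'' ` {0..<?k})" unfolding k by auto
      have inj: "inj_on ?O {0..<?k + 1}"
        unfolding k inj_on_insert
      proof (intro conjI)
        show "inj_on ?O {0..<?k}" using I'(3) unfolding inj_on_def by auto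
        show "?O ?k \<notin> ?O ` ({0..<?k} - {?k})"
        proof
          assume "?O ?k \<in> ?O ` ({0..<?k} - {?k})"
          then obtain a where "a \<in> {0..<?k}" "int j = imem s' ''o'' a" by auto
          with I'(4)[of a] show False by simp
        qed
      qed
      have a: "?O a \<in> {0..<int (Suc j)} \<and> ((imem s' ''P'')(?k := -1)) a = -1 \<and> D \<le> imem s ''e'' (?O a)"
        if "a \<in> {0..<?k + 1}" for a
      proof (cases "a = ?k")
        case False
        then have "a \<in> {0..<?k}" using that by simp
        from I'(4)[OF this] False show ?thesis by simp
      qed (use True in simp)
      have v: "((imem s' ''r'')(int j := 1)) v = (if D \<le> imem s ''e'' v then 1 else 0) \<and>
           (D \<le> imem s ''e'' v \<longrightarrow> v \<in> ?O ` {0..<?k + 1})" if "v \<in> {0..<int (Suc j)}" for v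
      proof (cases "v = int j")
        case False
        then have "v \<in> {0..<int j}" using that by auto
        from I'(5)[OF this] False show ?thesis unfolding im by auto
      qed (use True im in simp)
      have "imem (iwrite ''x'' 0 (int j + 1) ?t) ''o'' = ?O" "imem (iwrite ''x'' 0 (int j + 1) ?t) ''k'' 0 = ?k + 1"
        "imem (iwrite ''x'' 0 (int j + 1) ?t) ''r'' = (imem s' ''r'')(int j := 1)"
        "imem (iwrite ''x'' 0 (int j + 1) ?t) ''P'' = (imem s' ''P'')(?k := -1)"
        "imem (iwrite ''x'' 0 (int j + 1) ?t) ''g'' 0 = 0"
        using True t0 by (simp_all add: R)
      note e = this
      have "0 \<le> ?k + 1" using I'(2) by simp
      then show ?thesis unfolding I_def e using agt inj a v by blast
    qed
    then show "runs c rootR (maxtime rootR) s' (\<lambda>s'. imem s' ''x'' 0 = int j \<and> I (Suc j) (iwrite ''x'' 0 (int j + 1) s'))"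
      using t0 by (intro runs_sem) auto
  qed auto
  have fin: "?ag s s' \<and> base D s' \<and> tree D s' \<and> status 0 D s'" if I: "I 4 s'" for s'
  proof -
    have ag: "?ag s s'" using I unfolding I_def by blast
    have s': "imem s' ''D'' 0 = D" "imem s' ''e'' = imem s ''e''" "imem s' ''y'' = imem s ''y''" "rmem s' ''p'' = rmem s ''p''" "0 < D"
      using agreeD[OF ag] b unfolding base_def by simp_all
    have bs: "base D s'" using b s' static_agree[OF _ ag] balanced_agree[OF _ ag] unfolding base_def by simp
    let ?k = "imem s' ''k'' 0" and ?O = "imem s' ''o''"
    have int4: "x \<in> {0..<int 4} \<longleftrightarrow> x \<in> nodes" for x by auto
    have o: "?O a \<in> nodes" "imem s' ''P'' a = -1" "D \<le> imem s ''e'' (?O a)" if "a \<in> {0..<?k}" for a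
      using I that unfolding I_def int4 by blast+
    have r: "imem s' ''r'' v = (if D \<le> imem s ''e'' v then 1 else 0)" "D \<le> imem s ''e'' v \<longrightarrow> v \<in> ?O ` {0..<?k}"
      if "v \<in> nodes" for v using I that int4[of v] unfolding I_def by blast+
    have ar: "arcs (rmem s' ''p'') D (imem s' ''y'') ?O ?k (imem s' ''P'') (imem s' ''A'')"
      unfolding arcs_def using o I unfolding I_def by blast
    have r': "imem s' ''r'' v = (if v \<in> ?O ` {0..<?k} then 1 else 0)" if "v \<in> nodes" for v
      using r[OF that] o(3) by auto
    have k0: "0 \<le> ?k" "imem s' ''g'' 0 = 0" using I unfolding I_def by blast+
    have "tree D s'" unfolding tree_def Let_def s'(2) using k0 ar r' r(2) o(3) by blast
    moreover have "- D < imem s ''e'' (?O a)" if "a \<in> {0..<?k}" for a using o(3)[OF that] s'(5) by linarith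
    then have "status 0 D s'" unfolding status_def Let_def s'(2) using k0 by blast
    ultimately show ?thesis using ag bs by blast
  qed
  have 1: "runs c (ISet ''k'' (C 0)) 3 s (\<lambda>s'. s' = iwrite ''k'' 0 0 s)"
    by (rule runs_exec[OF exec.IAssign]) simp_all
  have 2: "runs c (ISet ''g'' (C 0)) 3 (iwrite ''k'' 0 0 s) (\<lambda>s'. s' = ?s2)"
    by (rule runs_exec[OF exec.IAssign]) simp_all
  show ?thesis unfolding roots_time_def
    by (subst (1) rootsR_def, rule runs_SeqI[OF 1], simp only:, rule runs_SeqI[OF 2], simp only:, rule runs_mono[OF loop order_refl fin])
qed

lemma arcs_card:
  assumes "arcs p D Y O' k P A" shows "k \<le> 4"
proof -
  have "card {0..<k} = card (O' ` {0..<k})" using card_image[OF arcsD(1)[OF assms]] by simp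
  also have "\<dots> \<le> card nodes" using arcsD(2)[OF assms] by (intro card_mono) auto
  finally show ?thesis by simp
qed

lemma runs_round:
  assumes b: "base D s" and tr: "tree D s" and ss: "status h D s"
  shows "runs c roundS (round_time N) s (\<lambda>s'. frame roundS s s' \<and> base D s' \<and> tree D s' \<and> status (Suc h) D s')"
    (is "runs c _ _ s ?Q")
  unfolding round_time_def
  unfolding roundS_def
proof (rule runs_Cond, unfold roundS_def[symmetric])
  assume "\<not> bval c s (ILe (V ''g'') (C 0))"
  then have "status (Suc h) D s" using ss unfolding status_def Let_def by auto
  then show "runs c Skip (argmin_time (16 * N) (IMul (C 16) (V ''N'')) prepS okS valS + maxtime finishS) s
     ?Q"
    using b tr by (intro runs_exec[OF exec.Skip]) (auto simp: argmin_time_def)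
next
  assume g: "bval c s (ILe (V ''g'') (C 0))"
  define n Y p O' k P A e where "n = int N" and "Y = imem s ''y''" and "p = rmem s ''p''" and "O' = imem s ''o''"
    and "k = imem s ''k'' 0" and "P = imem s ''P''" and "A = imem s ''A''" and "e = imem s ''e''"
  note defs = n_def Y_def p_def O'_def k_def P_def A_def e_def
  define S where "S = O' ` {0..<k}"
  have B: "static s" "imem s ''D'' 0 = D" "0 < D" "balanced s" "all_opt p D Y"
    using b unfolding base_def defs by auto
  have T: "0 \<le> k" "arcs p D Y O' k P A" "\<And>v. v \<in> nodes \<Longrightarrow> imem s ''r'' v = (if v \<in> S then 1 else 0)"
    "\<And>j. j \<in> {0..<k} \<Longrightarrow> P j = -1 \<Longrightarrow> D \<le> e (O' j)" "\<And>v. v \<in> nodes \<Longrightarrow> D \<le> e v \<Longrightarrow> v \<in> S"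
    using tr unfolding tree_def Let_def defs S_def by auto
  have St: "imem s ''g'' 0 = 0" "\<And>j. j \<in> {0..<k} \<Longrightarrow> - D < e (O' j)" "h = 0 \<or> int h < k"
    using ss g unfolding status_def Let_def defs by auto
  have k4: "k \<le> 4" using arcs_card[OF T(2)] .
  have Sn: "S \<subseteq> nodes" unfolding S_def using arcsD(2)[OF T(2)] by auto
  have ex: "excess Y v = e v" if "v \<in> nodes" for v using B(4) that unfolding balanced_def defs by simp
  have px: "surplus (excess Y) = surplus e" unfolding surplus_def using ex by simp
  define dj dv di where "dj = (\<lambda>q::int. q div (4 * n))" and "dv = (\<lambda>q::int. q div n - 4 * (q div (4 * n)))"
    and "di = (\<lambda>q::int. q - n * (q div n) + 1)"
  let ?okf = "\<lambda>q::nat. dj (int q) < k \<and> dv (int q) \<notin> S \<and> can_move D Y (di (int q)) (O' (dj (int q))) (dv (int q))"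
  let ?valf = "\<lambda>q::nat. move_cost p D Y (di (int q)) (O' (dj (int q))) (dv (int q))"
  have dec: "0 < n" "0 \<le> dj (int q)" "dv (int q) \<in> nodes" "di (int q) \<in> {1..n}" if "q < 16 * N" for q :: nat
  proof -
    show "0 < n" using that unfolding n_def by (cases N) auto
    from scan_decode[OF this, of "int q"] that show "0 \<le> dj (int q)" "dv (int q) \<in> nodes" "di (int q) \<in> {1..n}"
      unfolding dj_def dv_def di_def n_def by auto
  qed
  have am: "runs c (argmin (IMul (C 16) (V ''N'')) prepS okS valS)
     (argmin_time (16 * N) (IMul (C 16) (V ''N'')) prepS okS valS) s (\<lambda>s'.
      agree (imods prepS \<union> {''w'', ''B'', ''q''}) {''t''} s s' \<and>
      first_min (16 * N) ?okf ?valf (imem s' ''w'' 0) (imem s' ''B'' 0) (rmem s' ''t'' 0))"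
  proof (rule runs_argmin)
    fix s' assume ag: "agree (imods prepS \<union> {''w'', ''B'', ''q''}) {''t''} s s'"
    show "ival s' (IMul (C 16) (V ''N'')) = int (16 * N)"
      using agreeD[OF ag] B(1) unfolding static_def by simp
  next
    fix s' and q :: nat
    assume q: "q < 16 * N" and ag: "agree (imods prepS \<union> {''w'', ''B'', ''q''}) {''t''} s s'"
      and sq: "imem s' ''q'' 0 = int q"
    let ?t = "sem c prepS s'"
    let ?j = "dj (int q)" and ?v = "dv (int q)" and ?i = "di (int q)"
    have s': "imem s' ''N'' 0 = n" "imem s' ''D'' 0 = D" "imem s' ''y'' = Y" "imem s' ''o'' = O'" "imem s' ''k'' 0 = k"
      "imem s' ''r'' = imem s ''r''" "rmem s' ''p'' = p"
      "imem s' ''lo'' = L" "imem s' ''up'' = U" "imem s' ''m'' = M" "imem s' ''f'' = G"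
      using agreeD[OF ag] B unfolding static_def defs by simp_all
    have ag2: "frame prepS s' ?t" by (rule sem_agree) simp
    note pr = sem_prepS[OF sq s'(1,2), folded dj_def dv_def di_def, unfolded s'(3,4)]
    have t: "imem ?t ''i'' 0 = ?i" "imem ?t ''j'' 0 = ?j" "imem ?t ''v'' 0 = ?v" "imem ?t ''k'' 0 = k" "imem ?t ''r'' = imem s ''r''"
      "imem ?t ''lo'' = L" "imem ?t ''up'' = U" "imem ?t ''m'' = M" "imem ?t ''f'' = G" "rmem ?t ''p'' = p" "imem ?t ''y'' = Y"
      using agreeD[OF ag2] s' pr by (simp_all add: dj_def dv_def di_def)
    let ?m = "move (vec Y ?i) (O' ?j) ?v D"
    have z: "imem ?t ''z'' x = ?m x" if "x \<in> nodes" for x using pr(4)[OF that] unfolding dj_def dv_def di_def .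
    have rz: "red f p (imem ?t ''z'') = red f p ?m" for f p by (rule red_cong[OF z])
    have rY: "red f p (\<lambda>x. Y (4 * ?i + x)) = red f p (vec Y ?i)" for f p by (rule red_cong) (simp add: vec_def)
    have "bval c ?t admexp \<longleftrightarrow> can_move D Y ?i (O' ?j) ?v" if j: "?j < k"
    proof -
      have on: "O' ?j \<in> nodes" "?v \<in> nodes" using arcsD(2)[OF T(2)] dec[OF q] j by auto
      have "adm (L ?i) (U ?i) (M ?i) (vec Y ?i)" using B(5) dec(4)[OF q] grid_optD(1) unfolding all_opt_def n_def by blast
      then have "vec Y ?i 0 + vec Y ?i 1 + vec Y ?i 2 + vec Y ?i 3 = 0" unfolding adm_def by blast
      then have "?m 0 + ?m 1 + ?m 2 + ?m 3 = 0" using on unfolding move_def nodes_eq by auto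
      then have "imem ?t ''z'' 0 + imem ?t ''z'' 1 + imem ?t ''z'' 2 + imem ?t ''z'' 3 = 0" using z by simp
      then have "bval c ?t admexp \<longleftrightarrow> adm (L ?i) (U ?i) (M ?i) (imem ?t ''z'')"
        using bval_admexp[of c ?t] unfolding t by auto
      also have "\<dots> \<longleftrightarrow> adm (L ?i) (U ?i) (M ?i) ?m" by (rule adm_cong[OF z])
      finally show ?thesis unfolding can_move_def .
    qed
    then have "bval c ?t okS \<longleftrightarrow> ?okf q" using T(3)[OF dec(3)[OF q]] unfolding okS_def by (auto simp: t)
    moreover have "rval c ?t valS = ?valf q"
      unfolding valS_def move_cost_def rval.simps rval_valexp by (simp add: t rz rY)
    ultimately show "bval c ?t okS = ?okf q \<and> rval c ?t valS = ?valf q" by blast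
  qed simp_all
  have fin: "frame roundS s s3 \<and> base D s3 \<and> tree D s3 \<and> status (Suc h) D s3"
    if ag: "agree (imods prepS \<union> {''w'', ''B'', ''q''}) {''t''} s s2"
      and fm: "first_min (16 * N) ?okf ?valf (imem s2 ''w'' 0) (imem s2 ''B'' 0) (rmem s2 ''t'' 0)"
      and s3: "s3 = sem c finishS s2" for s2 s3
  proof -
    have "frame finishS s2 s3" unfolding s3 by (rule sem_agree) simp
    then have ag3: "frame roundS s s3"
      using agree_trans[of _ _ s s2 s3] agree_mono[OF ag] agree_mono[of "imods finishS" "rmods finishS" s2 s3] by simp
    have st3: "static s3" "balanced s3" "imem s3 ''D'' 0 = D" "imem s3 ''y'' = Y" "imem s3 ''e'' = e"
      using static_agree[OF B(1) ag3] balanced_agree[OF B(4) ag3] agreeD[OF ag3] B unfolding defs by simp_all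
    have s2: "imem s2 ''N'' 0 = n" "imem s2 ''D'' 0 = D" "imem s2 ''y'' = Y" "imem s2 ''o'' = O'" "imem s2 ''k'' 0 = k"
      "imem s2 ''r'' = imem s ''r''" "rmem s2 ''p'' = p" "imem s2 ''e'' = e" "imem s2 ''P'' = P" "imem s2 ''A'' = A"
      "imem s2 ''g'' 0 = 0"
      using agreeD[OF ag] B St unfolding static_def defs by simp_all
    have enc: "\<exists>q<16 * N. dj (int q) = j \<and> dv (int q) = v \<and> di (int q) = i"
      if "0 \<le> j" "j < k" "v \<in> nodes" "i \<in> {1..int N}" for i j v
    proof -
      have n: "0 < n" using that unfolding n_def by auto
      define q where "q = (4 * j + v) * n + (i - 1)"
      note E = scan_encode[OF n that(1) _ that(3), of i, folded q_def]
      have E: "0 \<le> q" "q < 16 * n" "q div n = 4 * j + v" "q div (4 * n) = j" "q - n * (q div n) + 1 = i"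
        using E that k4 unfolding n_def by auto
      show ?thesis
        by (rule exI[of _ "nat q"]) (use E in \<open>auto simp: dj_def dv_def di_def n_def\<close>)
    qed
    show ?thesis
    proof (cases "imem s2 ''w'' 0 = 0")
      case True
      then have s3': "s3 = iwrite ''g'' 0 2 s2" unfolding s3 finishS_def by simp
      have none: "\<not> ?okf q" if "q < 16 * N" for q using fm True that unfolding first_min_def by auto
      have "surplus (excess Y) \<le> (12 * int N + 8) * (D - 1)"
      proof (rule stuck_posx[OF B(5,3) Sn])
        fix i a b assume iab: "i \<in> {1..int N}" "a \<in> S" "b \<in> nodes - S"
        then obtain j where j: "0 \<le> j" "j < k" "a = O' j" unfolding S_def by auto
        obtain q where "q < 16 * N" "dj (int q) = j" "dv (int q) = b" "di (int q) = i"
          using enc[OF j(1,2) _ iab(1), of b] iab by auto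
        with none[of q] j iab show "\<not> can_move D Y i a b" by auto
      next
        fix v assume v: "v \<in> S"
        then obtain j where "j \<in> {0..<k}" "v = O' j" unfolding S_def by auto
        with St(2) ex Sn v show "- D < excess Y v" by auto
      next
        fix v assume "v \<in> nodes - S"
        with T(5)[of v] ex[of v] show "excess Y v < D" by force
      qed
      then have "status (Suc h) D s3" unfolding status_def Let_def s3' px by (simp add: s2)
      moreover have "base D s3" unfolding base_def using st3 B by (simp add: s3' s2)
      moreover have "tree D s3" unfolding tree_def Let_def using T unfolding S_def by (simp add: s3' s2)
      ultimately show ?thesis using ag3 by blast
    next
      case False
      then obtain b where b: "b < 16 * N" "imem s2 ''w'' 0 = 1" "imem s2 ''B'' 0 = int b" "?okf b" "rmem s2 ''t'' 0 = ?valf b"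
        "\<And>q. q < 16 * N \<Longrightarrow> ?okf q \<Longrightarrow> ?valf b \<le> ?valf q" "\<And>q. q < b \<Longrightarrow> ?okf q \<Longrightarrow> ?valf b < ?valf q"
        using fm unfolding first_min_def by blast
      let ?j = "dj (int b)" and ?v = "dv (int b)" and ?i = "di (int b)"
      let ?t = "sem c prepS (iwrite ''q'' 0 (imem s2 ''B'' 0) s2)"
      have t: "imem ?t ''j'' 0 = ?j" "imem ?t ''v'' 0 = ?v" "imem ?t ''i'' 0 = ?i"
        using sem_prepS(1-3)[of "iwrite ''q'' 0 (imem s2 ''B'' 0) s2" "int b" n D c] s2 b(3)
        by (simp_all add: dj_def dv_def di_def)
      have w: "\<not> imem s2 ''w'' 0 \<le> 0" using b by simp
      note f = sem_finishS[OF w, of c, folded s3, unfolded t s2 b(5)]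
      have d: "0 \<le> ?j" "?j < k" "?v \<in> nodes - S" "?i \<in> {1..int N}" "can_move D Y ?i (O' ?j) ?v"
        using dec[OF b(1)] b(4) unfolding n_def by auto
      let ?p = "lift p S (?valf b / of_int D)"
      have p3: "rmem s3 ''p'' = ?p"
      proof
        fix v show "rmem s3 ''p'' v = ?p v"
          using T(3)[of v] Sn unfolding f(1) lift_def by auto
      qed
      have min: "?valf b \<le> move_cost p D Y i' (O' j') b'"
        if a: "i' \<in> {1..int N}" "0 \<le> j'" "j' < k" "b' \<in> nodes - S" "can_move D Y i' (O' j') b'" for i' j' b'
      proof -
        obtain q where "q < 16 * N" "dj (int q) = j'" "dv (int q) = b'" "di (int q) = i'"
          using enc[OF a(2,3) _ a(1), of b'] a(4) by auto
        with b(6)[of q] a show ?thesis by auto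
      qed
      have first: "?valf b < move_cost p D Y i' (O' j') ?v"
        if a: "i' \<in> {1..int N}" "0 \<le> j'" "j' < ?j" "can_move D Y i' (O' j') ?v" for i' j'
      proof -
        have jk: "j' < k" using a(3) d(2) by linarith
        obtain q where q: "q < 16 * N" "dj (int q) = j'" "dv (int q) = ?v" "di (int q) = i'"
          using enc[OF a(2) jk _ a(1), of ?v] d(3) by auto
        have "q < b"
        proof (rule ccontr)
          assume "\<not> q < b"
          then have "dj (int b) \<le> dj (int q)" unfolding dj_def using dec(1)[OF b(1)] by (intro zdiv_mono1) auto
          with q a show False by simp
        qed
        moreover have "?okf q" using q(2-4) jk a(4) d(3) by simp
        ultimately have "?valf b < ?valf q" by (rule b(7))
        then show ?thesis unfolding q(2-4) .
      qed
      note ext = arcs_extend[OF B(5,3) T(2) d(1,2,3) S_def d(4,5) refl min first]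
      have im: "(O'(k := ?v)) ` {0..<k + 1} = insert ?v S"
      proof -
        have "{0..<k + 1} = insert k {0..<k}" using T(1) by auto
        then show ?thesis unfolding S_def by auto
      qed
      have tr3: "tree D s3"
        unfolding tree_def Let_def f(2-) p3 st3(3-) im
      proof (intro conjI ballI impI)
        show "0 \<le> k + 1" using T by simp
        show "arcs ?p D Y (O'(k := ?v)) (k + 1) (P(k := ?j)) (A(k := ?i))" using ext by blast
        fix v assume v: "v \<in> nodes"
        show "((imem s ''r'')(?v := 1)) v = (if v \<in> insert ?v S then 1 else 0)" using T(3)[OF v] by auto
      next
        fix v assume "v \<in> nodes" "D \<le> e v"
        then show "v \<in> insert ?v S" using T(5) by simp
      next
        fix j assume j: "j \<in> {0..<k + 1}" "(P(k := ?j)) j = -1"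
        then have "j \<in> {0..<k}" using d by (auto split: if_splits)
        then show "D \<le> e ((O'(k := ?v)) j)" using T(4)[of j] j by auto
      qed
      have ss3: "status (Suc h) D s3"
      proof (cases "e ?v + D \<le> 0")
        case True
        then show ?thesis unfolding status_def Let_def f(2-) st3(3-) using T(1) by simp
      next
        case F: False
        have "- D < e ((O'(k := ?v)) j)" if "j \<in> {0..<k + 1}" for j
          using St(2)[of j] F that by auto
        moreover have "int (Suc h) < k + 1" using St(3) d T(1) by auto
        ultimately show ?thesis unfolding status_def Let_def f(2-) st3(3-) using F by simp
      qed
      have "base D s3" unfolding base_def p3 st3(4) using st3 B(3) ext by blast
      with tr3 ss3 ag3 show ?thesis by blast
    qed
  qed
  show "runs c (Seq (argmin (IMul (C 16) (V ''N'')) prepS okS valS) finishS)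
     (argmin_time (16 * N) (IMul (C 16) (V ''N'')) prepS okS valS + maxtime finishS) s
     ?Q"
  proof (rule runs_SeqI[OF am])
    fix s2 assume a: "agree (imods prepS \<union> {''w'', ''B'', ''q''}) {''t''} s s2 \<and>
      first_min (16 * N) ?okf ?valf (imem s2 ''w'' 0) (imem s2 ''B'' 0) (rmem s2 ''t'' 0)"
    show "runs c finishS (maxtime finishS) s2
     ?Q"
      by (rule runs_sem[OF imods_finishS(3)]) (rule fin[OF conjunct1[OF a] conjunct2[OF a] refl])
  qed
qed

end

section \<open>Augmentation and one scaling phase\<close>

lemma sem_pushA:
  fixes s c
  defines "s' \<equiv> sem c pushA s" and "k \<equiv> imem s ''k'' 0"
  defines "pk \<equiv> imem s ''P'' k"
  shows "imem s' ''y'' = (if 0 \<le> pk then push (imem s ''y'') (imem s ''A'' k) (imem s ''o'' pk) (imem s ''o'' k) (imem s ''D'' 0)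
      else imem s ''y'')"
    "imem s' ''k'' 0 = (if 0 \<le> pk then pk else k)"
  unfolding s'_def k_def pk_def pushA_def ycell_def push_def Let_def by simp_all

definition aug_time :: nat where
  "aug_time = btime (BAnd (ILe (C 1) (V ''g'')) (ILe (V ''g'') (C 1))) + (50 + (fortime 3 (maxtime pushA) (C 3) + 50)) + 1"

definition attempt_time :: "nat \<Rightarrow> nat" where
  "attempt_time N = roots_time + (fortime 4 (round_time N) (C 4) + aug_time)"

definition phase_time :: "nat \<Rightarrow> nat" where
  "phase_time N = 20 + (fortime N reopt_time (V ''N'') + fortime (60 * N) (attempt_time N) (IMul (C 60) (V ''N'')))"

context prog
begin

lemma runs_aug:
  assumes b: "base D s" and tr: "tree D s" and ss: "status 4 D s"
  shows "runs c augA aug_time s (\<lambda>s'. frame augA s s' \<and> base D s' \<and>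
    surplus (imem s' ''e'') \<le> surplus (imem s ''e'') \<and>
    (surplus (imem s' ''e'') \<le> surplus (imem s ''e'') - D \<or> surplus (imem s' ''e'') \<le> (12 * int N + 8) * (D - 1)))"
    (is "runs c augA aug_time s ?Q")
  unfolding aug_time_def
  unfolding augA_def
proof (rule runs_Cond, unfold augA_def[symmetric])
  assume "\<not> bval c s (BAnd (ILe (C 1) (V ''g'')) (ILe (V ''g'') (C 1)))"
  moreover have "imem s ''k'' 0 \<le> 4" using tr arcs_card unfolding tree_def Let_def by blast
  ultimately have "surplus (imem s ''e'') \<le> (12 * int N + 8) * (D - 1)"
    using ss unfolding status_def Let_def by auto
  then show "runs c Skip (50 + (fortime 3 (maxtime pushA) (C 3) + 50)) s ?Q"
    using b by (intro runs_exec[OF exec.Skip]) auto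
next
  assume g: "bval c s (BAnd (ILe (C 1) (V ''g'')) (ILe (V ''g'') (C 1)))"
  define Y p O' k P A e where "Y = imem s ''y''" and "p = rmem s ''p''" and "O' = imem s ''o''"
    and "k = imem s ''k'' 0 - 1" and "P = imem s ''P''" and "A = imem s ''A''" and "e = imem s ''e''"
  note defs = Y_def p_def O'_def k_def P_def A_def e_def
  have B: "static s" "imem s ''D'' 0 = D" "0 < D" "balanced s" "all_opt p D Y"
    using b unfolding base_def defs by auto
  have T: "arcs p D Y O' (k + 1) P A"  "\<And>j. j \<in> {0..<k+1} \<Longrightarrow> P j = -1 \<Longrightarrow> D \<le> e (O' j)"
    using tr unfolding tree_def Let_def defs by auto
  have St: "0 \<le> k" "e (O' k) \<le> - D"
    using ss g unfolding status_def Let_def defs by auto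
  have k3: "k \<le> 3" using arcs_card[OF T(1)] by simp
  have ex: "excess Y v = e v" if "v \<in> nodes" for v using B(4) that unfolding balanced_def defs by simp
  define t where "t = O' k"
  have tn: "t \<in> nodes" unfolding t_def using arcsD(2)[OF T(1)] St by simp
  let ?s0 = "iwrite ''k'' 0 k s"
  let ?s1 = "iwrite ''e'' t (e t + D) ?s0"
  have ag1: "frame augA s ?s1" by (intro agree_iwrite) auto
  let ?W = "{''x'', ''i'', ''y'', ''k''}"
  define I where "I = (\<lambda>(j::nat) s'. let k' = imem s' ''k'' 0; Y' = imem s' ''y'' in
     agree ?W {} ?s1 s' \<and> all_opt p D Y' \<and> arcs p D Y' O' (k' + 1) P A \<and> 0 \<le> k' \<and> k' \<le> k \<and> (k' \<le> 3 - int j \<or> P k' = -1) \<and>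
     (\<forall>v\<in>nodes. excess Y' v = e v + (if v = t then D else 0) - (if v = O' k' then D else 0)))"
  have loop: "runs c (For ''x'' (C 3) pushA) (fortime 3 (maxtime pushA) (C 3)) ?s1 (I 3)"
  proof (rule runs_For[where I = I])
    show "I 0 (iwrite ''x'' 0 0 ?s1)"
      unfolding I_def Let_def agree_def using B T St k3 ex by (simp add: t_def Y_def[symmetric])
  next
    fix j s' assume j: "j < 3" and I: "I j s'" and x: "imem s' ''x'' 0 = int j"
    let ?t = "sem c pushA s'"
    define k' Y' where "k' = imem s' ''k'' 0" and "Y' = imem s' ''y''"
    have I': "agree ?W {} ?s1 s'" "all_opt p D Y'" "arcs p D Y' O' (k' + 1) P A" "0 \<le> k'" "k' \<le> k" "k' \<le> 3 - int j \<or> P k' = -1"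
      "\<And>v. v \<in> nodes \<Longrightarrow> excess Y' v = e v + (if v = t then D else 0) - (if v = O' k' then D else 0)"
      using I unfolding I_def Let_def k'_def Y'_def by blast+
    have s': "imem s' ''o'' = O'" "imem s' ''P'' = P" "imem s' ''A'' = A" "imem s' ''D'' 0 = D"
      using agreeD[OF I'(1)] B(2) by (simp_all add: defs)
    have ag2: "frame pushA s' ?t" by (rule sem_agree) simp
    have "agree ?W {} ?s1 ?t" by (rule agree_trans[OF I'(1) agree_mono[OF ag2]]) auto
    then have ag3: "agree ?W {} ?s1 (iwrite ''x'' 0 (int j + 1) ?t)" by (intro agree_iwrite) auto
    have xt: "imem ?t ''x'' 0 = int j" using agreeD[OF ag2] x by simp
    note R = sem_pushA[of c s', unfolded s', folded k'_def Y'_def]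
    have "I (Suc j) (iwrite ''x'' 0 (int j + 1) ?t)"
    proof (cases "0 \<le> P k'")
      case True
      have r: "imem (iwrite ''x'' 0 (int j + 1) ?t) ''k'' 0 = P k'"
        "imem (iwrite ''x'' 0 (int j + 1) ?t) ''y'' = push Y' (A k') (O' (P k')) (O' k') D"
        using True by (simp_all add: R)
      note pa = push_arcs[OF I'(2) B(3) I'(3,4) True refl]
      have "excess (push Y' (A k') (O' (P k')) (O' k') D) v = e v + (if v = t then D else 0) - (if v = O' (P k') then D else 0)"
        if "v \<in> nodes" for v unfolding pa(7) I'(7)[OF that] by simp
      moreover have "P k' \<le> 3 - int (Suc j)" using pa(3) I'(6) True by auto
      moreover have "P k' \<le> k" using pa(3) I'(5) by simp
      ultimately show ?thesis unfolding I_def Let_def r using ag3 pa(1,2) True by blast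
    next
      case False
      have r: "imem (iwrite ''x'' 0 (int j + 1) ?t) ''k'' 0 = k'"
        "imem (iwrite ''x'' 0 (int j + 1) ?t) ''y'' = Y'"
        using False by (simp_all add: R)
      have "P k' = -1" using arcsD(3)[OF I'(3), of k'] I'(4) False by auto
      then show ?thesis unfolding I_def Let_def r using ag3 I'(2-5,7) by blast
    qed
    then show "runs c pushA (maxtime pushA) s' (\<lambda>s'. imem s' ''x'' 0 = int j \<and> I (Suc j) (iwrite ''x'' 0 (int j + 1) s'))"
      using xt by (intro runs_sem) auto
  qed auto
  have 1: "runs c (Seq (ISet ''k'' (ISub (V ''k'') (C 1)))
      (IAssign ''e'' (IRead ''o'' (V ''k'')) (IAdd (IRead ''e'' (IRead ''o'' (V ''k''))) (V ''D'')))) 50 s (\<lambda>s'. s' = ?s1)"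
  proof (rule runs_mono[OF runs_sem])
    show "sem c (Seq (ISet ''k'' (ISub (V ''k'') (C 1)))
      (IAssign ''e'' (IRead ''o'' (V ''k'')) (IAdd (IRead ''e'' (IRead ''o'' (V ''k''))) (V ''D'')))) s = ?s1"
      using B(2) by (simp add: defs t_def)
  qed simp_all
  have 3: "runs c (IAssign ''e'' (IRead ''o'' (V ''k'')) (ISub (IRead ''e'' (IRead ''o'' (V ''k''))) (V ''D''))) 50 s3 ?Q"
    if I: "I 3 s3" for s3
  proof (rule runs_exec[OF exec.IAssign])
    define k' Y' where "k' = imem s3 ''k'' 0" and "Y' = imem s3 ''y''"
    have I': "agree ?W {} ?s1 s3" "all_opt p D Y'" "arcs p D Y' O' (k' + 1) P A" "0 \<le> k'" "k' \<le> k" "k' \<le> 0 \<or> P k' = -1"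
      "\<And>v. v \<in> nodes \<Longrightarrow> excess Y' v = e v + (if v = t then D else 0) - (if v = O' k' then D else 0)"
      using I unfolding I_def Let_def k'_def Y'_def by auto
    have s3: "imem s3 ''o'' = O'" "imem s3 ''e'' = e(t := e t + D)" "imem s3 ''D'' 0 = D" "rmem s3 ''p'' = p"
      using agreeD[OF I'(1)] B(2) by (simp_all add: defs)
    have "P k' = -1" using arcsD(3)[OF I'(3), of k'] I'(4,6) by auto
    then have root: "D \<le> e (O' k')" using T(2)[of k'] I'(4,5) by simp
    have rn: "O' k' \<in> nodes" using arcsD(2)[OF I'(3), of k'] I'(4) by simp
    have "t \<noteq> O' k'" using root St B(3) unfolding t_def by auto
    let ?s4 = "iwrite ''e'' (ival s3 (IRead ''o'' (V ''k''))) (ival s3 (ISub (IRead ''e'' (IRead ''o'' (V ''k''))) (V ''D''))) s3"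
    have e4: "imem ?s4 ''e'' v = excess Y' v" if "v \<in> nodes" for v
      unfolding I'(7)[OF that] using \<open>t \<noteq> O' k'\<close> by (simp add: s3 k'_def[symmetric])
    have ag4: "frame augA s ?s4"
      by (rule agree_iwrite, simp, rule agree_trans[OF ag1 agree_mono[OF I'(1)]]) auto
    have px: "surplus (imem ?s4 ''e'') = surplus e - D"
    proof (rule surplus_augment[where a = "O' k'" and b = t and e = e, OF rn tn root _ B(3)])
      show "e t \<le> - D" using St(2) unfolding t_def .
      show "imem ?s4 ''e'' v = e v - (if v = O' k' then D else 0) + (if v = t then D else 0)" if "v \<in> nodes" for v
        unfolding e4[OF that] I'(7)[OF that] by simp
    qed
    have "base D ?s4"
      unfolding base_def balanced_def
      using e4 static_agree[OF B(1) ag4] B(3) I'(2) s3 by (simp add: Y'_def)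
    then show "?Q ?s4" using ag4 px B(3) unfolding e_def by (simp del: mem_write)
  qed simp
  show "runs c (Seq (Seq (ISet ''k'' (ISub (V ''k'') (C 1)))
      (IAssign ''e'' (IRead ''o'' (V ''k'')) (IAdd (IRead ''e'' (IRead ''o'' (V ''k''))) (V ''D''))))
    (Seq (For ''x'' (C 3) pushA)
      (IAssign ''e'' (IRead ''o'' (V ''k'')) (ISub (IRead ''e'' (IRead ''o'' (V ''k''))) (V ''D'')))))
    (50 + (fortime 3 (maxtime pushA) (C 3) + 50)) s ?Q"
  proof (rule runs_SeqI[OF 1])
    fix s' assume "s' = ?s1"
    then show "runs c (Seq (For ''x'' (C 3) pushA) (IAssign ''e'' (IRead ''o'' (V ''k'')) (ISub (IRead ''e'' (IRead ''o'' (V ''k''))) (V ''D''))))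
      (fortime 3 (maxtime pushA) (C 3) + 50) s' ?Q"
      using runs_SeqI[OF loop 3] by blast
  qed
qed

lemma runs_attempt:
  assumes b: "base D s"
  shows "runs c attempt (attempt_time N) s (\<lambda>s'. frame attempt s s' \<and> base D s' \<and>
    surplus (imem s' ''e'') \<le> surplus (imem s ''e'') \<and>
    (surplus (imem s' ''e'') \<le> surplus (imem s ''e'') - D \<or> surplus (imem s' ''e'') \<le> (12 * int N + 8) * (D - 1)))"
    (is "runs c attempt (attempt_time N) s ?Q")
proof -
  let ?Q' = "\<lambda>s'. base D s' \<and>
    surplus (imem s' ''e'') \<le> surplus (imem s ''e'') \<and>
    (surplus (imem s' ''e'') \<le> surplus (imem s ''e'') - D \<or> surplus (imem s' ''e'') \<le> (12 * int N + 8) * (D - 1))"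
  have "runs c attempt (attempt_time N) s ?Q'"
    unfolding attempt_def attempt_time_def
  proof (rule runs_SeqI[OF runs_roots[OF b]], rule runs_SeqI)
    fix s1 assume a: "frame rootsR s s1 \<and> base D s1 \<and> tree D s1 \<and> status 0 D s1"
    then have e1: "imem s1 ''e'' = imem s ''e''" using agreeD(1)[of "imods rootsR" "rmods rootsR" s s1 "''e''"] by simp
    let ?I = "\<lambda>h s'. imem s' ''e'' = imem s ''e'' \<and> base D s' \<and> tree D s' \<and> status h D s'"
    have hx: "?I h (iwrite ''h'' 0 x s') \<longleftrightarrow> ?I h s'" for h x s'
      unfolding base_def tree_def status_def static_def balanced_def by simp
    show "runs c (For ''h'' (C 4) roundS) (fortime 4 (round_time N) (C 4)) s1 (?I 4)"
    proof (rule runs_For[where I = ?I])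
      show "?I 0 (iwrite ''h'' 0 0 s1)" unfolding hx using a e1 by blast
    next
      fix j s' assume "j < 4" "?I j s'" "imem s' ''h'' 0 = int j"
      then have I: "imem s' ''e'' = imem s ''e''" "base D s'" "tree D s'" "status j D s'" and x: "imem s' ''h'' 0 = int j" by auto
      show "runs c roundS (round_time N) s' (\<lambda>s'. imem s' ''h'' 0 = int j \<and> ?I (Suc j) (iwrite ''h'' 0 (int j + 1) s'))"
      proof (rule runs_mono[OF runs_round[OF I(2-4)] order_refl])
        fix s'' assume q: "frame roundS s' s'' \<and> base D s'' \<and> tree D s'' \<and> status (Suc j) D s''"
        then have "imem s'' ''e'' = imem s ''e''" "imem s'' ''h'' 0 = int j"
          using agreeD(1)[of "imods roundS" "rmods roundS" s' s''] I x by simp_all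
        then show "imem s'' ''h'' 0 = int j \<and> ?I (Suc j) (iwrite ''h'' 0 (int j + 1) s'')" unfolding hx using q by blast
      qed
    qed auto
  next
    fix s2 assume "imem s2 ''e'' = imem s ''e'' \<and> base D s2 \<and> tree D s2 \<and> status 4 D s2"
    then show "runs c augA aug_time s2 ?Q'"
      using runs_mono[OF runs_aug[of D s2] order_refl] by (metis (no_types, lifting))
  qed
  from runs_agree[OF this] show ?thesis by (rule runs_mono) auto
qed

text \<open>The surplus left by the preceding phase and the changes made by re-optimisation amount to at most
\<open>(42 * N + 16) * D\<close>, which \<open>60 * N\<close> augmentations exhaust unless the search gets stuck before.\<close>

lemma runs_phase:
  assumes st: "static s" and Ds: "imem s ''D'' 0 = 2 * D" and D: "0 < D" and bal: "balanced s"
    and so: "all_opt (rmem s ''p'') (2 * D) (imem s ''y'')" and N: "0 < N"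
    and px: "surplus (imem s ''e'') \<le> (12 * int N + 8) * (2 * D)"
  shows "runs c phase (phase_time N) s (\<lambda>s'. frame phase s s' \<and> base D s' \<and>
    surplus (imem s' ''e'') \<le> (12 * int N + 8) * (D - 1))"
proof -
  let ?s1 = "iwrite ''D'' 0 D s"
  define Y p where "Y = imem s ''y''" and "p = rmem s ''p''"
  have 1: "runs c (ISet ''D'' (IDiv (V ''D'') (C 2))) 20 s (\<lambda>s'. s' = ?s1)"
    by (rule runs_exec[OF exec.IAssign]) (simp_all add: Ds)
  define I1 where "I1 = (\<lambda>(j::nat) s'. agree (insert ''x'' (imods reopt)) (rmods reopt) ?s1 s' \<and> balanced s' \<and>
     (\<forall>i\<in>{1..int j}. grid_opt (F i) (L i) (U i) (M i) p D (vec (imem s' ''y'') i)) \<and>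
     (\<forall>i. int j < i \<longrightarrow> vec (imem s' ''y'') i = vec Y i) \<and>
     surplus (imem s' ''e'') \<le> surplus (imem s ''e'') + 18 * D * int j)"
  have l1: "runs c (For ''x'' (V ''N'') reopt) (fortime N reopt_time (V ''N'')) ?s1
     (\<lambda>s'. base D s' \<and> surplus (imem s' ''e'') \<le> int (60 * N) * D)"
  proof (rule runs_For[where I = I1])
    have "agree (insert ''x'' (imods reopt)) (rmods reopt) ?s1 (iwrite ''x'' 0 0 ?s1)"
      by (rule agree_iwrite) simp_all
    moreover have "balanced (iwrite ''x'' 0 0 ?s1)" using bal unfolding balanced_def by simp
    ultimately show "I1 0 (iwrite ''x'' 0 0 ?s1)" unfolding I1_def by (simp add: Y_def)
  next
    fix j s' assume j: "j \<le> N" "I1 j s'"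
    show "ival s' (V ''N'') = int N"
      using j st agreeD(1)[of "insert ''x'' (imods reopt)" "rmods reopt" ?s1 s' "''N''"] unfolding I1_def static_def by simp
  next
    fix j s' assume j: "j < N" and I: "I1 j s'" and x: "imem s' ''x'' 0 = int j"
    let ?i = "int j + 1"
    have ag: "agree (insert ''x'' (imods reopt)) (rmods reopt) ?s1 s'" using I unfolding I1_def by blast
    have p': "rmem s' ''p'' = p" "imem s' ''D'' 0 = D" using agreeD[OF ag] by (simp_all add: p_def)
    have st': "static s'" by (rule static_agree[OF _ ag]) (use st in \<open>simp_all add: static_def\<close>)
    have iN: "?i \<in> {1..int N}" using j by auto
    have "grid_opt (F ?i) (L ?i) (U ?i) (M ?i) p (2 * D) (vec Y ?i)"
      using so iN unfolding all_opt_def Y_def p_def by blast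
    then have op: "grid_opt (F ?i) (L ?i) (U ?i) (M ?i) p (2 * D) (vec (imem s' ''y'') ?i)"
      using I unfolding I1_def by simp
    have bal': "balanced s'" using I unfolding I1_def by blast
    note R = runs_reopt[OF st' x j p'(2) D bal' refl refl p'(1)[symmetric] op]
    show "runs c reopt reopt_time s' (\<lambda>s'. imem s' ''x'' 0 = int j \<and> I1 (Suc j) (iwrite ''x'' 0 (int j + 1) s'))"
    proof (rule runs_mono[OF R order_refl], elim conjE)
      fix s'' assume q: "frame reopt s' s''" "balanced s''"
        "grid_opt (F ?i) (L ?i) (U ?i) (M ?i) p D (vec (imem s'' ''y'') ?i)"
        "\<forall>i'. i' \<noteq> ?i \<longrightarrow> vec (imem s'' ''y'') i' = vec (imem s' ''y'') i'"
        "surplus (imem s'' ''e'') \<le> surplus (imem s' ''e'') + 18 * D"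
      have "imem s'' ''x'' 0 = int j" using agreeD(1)[OF q(1)] x by simp
      moreover have "agree (insert ''x'' (imods reopt)) (rmods reopt) ?s1 s''"
        by (rule agree_trans[OF ag agree_mono[OF q(1)]]) auto
      then have "agree (insert ''x'' (imods reopt)) (rmods reopt) ?s1 (iwrite ''x'' 0 (int j + 1) s'')"
        by (rule agree_iwrite[rotated]) simp
      moreover have "balanced (iwrite ''x'' 0 (int j + 1) s'')" using q(2) unfolding balanced_def by simp
      moreover have "grid_opt (F i) (L i) (U i) (M i) p D (vec (imem s'' ''y'') i)" if "i \<in> {1..int (Suc j)}" for i
      proof (cases "i = ?i")
        case True then show ?thesis using q(3) by simp
      next
        case False
        then have "i \<in> {1..int j}" using that by auto
        then show ?thesis using I q(4) False unfolding I1_def by simp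
      qed
      moreover have "vec (imem s'' ''y'') i = vec Y i" if "int (Suc j) < i" for i
        using I q(4) that unfolding I1_def by simp
      moreover have "surplus (imem s'' ''e'') \<le> surplus (imem s ''e'') + 18 * D * int (Suc j)"
        using I q(5) unfolding I1_def by (simp add: algebra_simps)
      ultimately show "imem s'' ''x'' 0 = int j \<and> I1 (Suc j) (iwrite ''x'' 0 (int j + 1) s'')"
        unfolding I1_def by simp
    qed
  next
    fix s' assume I: "I1 N s'"
    have ag: "agree (insert ''x'' (imods reopt)) (rmods reopt) ?s1 s'" using I unfolding I1_def by blast
    have p': "rmem s' ''p'' = p" "imem s' ''D'' 0 = D" using agreeD[OF ag] by (simp_all add: p_def)
    have st': "static s'" by (rule static_agree[OF _ ag]) (use st in \<open>simp_all add: static_def\<close>)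
    have "surplus (imem s' ''e'') \<le> (12 * int N + 8) * (2 * D) + 18 * D * int N" using I px unfolding I1_def by auto
    also have "\<dots> = (42 * int N + 16) * D" by (simp add: algebra_simps)
    also have "\<dots> \<le> int (60 * N) * D" using N D by (intro mult_right_mono) auto
    finally have "surplus (imem s' ''e'') \<le> int (60 * N) * D" .
    moreover have "base D s'" using I st' p' D unfolding I1_def base_def all_opt_def by auto
    ultimately show "base D s' \<and> surplus (imem s' ''e'') \<le> int (60 * N) * D" by blast
  qed
  let ?b = "(12 * int N + 8) * (D - 1)"
  have l2: "runs c (For ''c'' (IMul (C 60) (V ''N'')) attempt) (fortime (60 * N) (attempt_time N) (IMul (C 60) (V ''N''))) s2
      (\<lambda>s'. base D s' \<and> surplus (imem s' ''e'') \<le> ?b)"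
    if s2: "base D s2" "surplus (imem s2 ''e'') \<le> int (60 * N) * D" for s2
  proof (rule runs_For[where I = "\<lambda>j s'. base D s' \<and> surplus (imem s' ''e'') \<le> max ?b (int (60 * N - j) * D)"])
    show "base D (iwrite ''c'' 0 0 s2) \<and> surplus (imem (iwrite ''c'' 0 0 s2) ''e'') \<le> max ?b (int (60 * N - 0) * D)"
      using s2 unfolding base_def static_def balanced_def by auto
  next
    fix j :: nat and s' assume "base D s' \<and> surplus (imem s' ''e'') \<le> max ?b (int (60 * N - j) * D)"
    then show "ival s' (IMul (C 60) (V ''N'')) = int (60 * N)" unfolding base_def static_def by simp
  next
    fix j s' assume j: "j < 60 * N" and I: "base D s' \<and> surplus (imem s' ''e'') \<le> max ?b (int (60 * N - j) * D)"
      and x: "imem s' ''c'' 0 = int j"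
    show "runs c attempt (attempt_time N) s' (\<lambda>s'. imem s' ''c'' 0 = int j \<and>
       base D (iwrite ''c'' 0 (int j + 1) s') \<and> surplus (imem (iwrite ''c'' 0 (int j + 1) s') ''e'') \<le> max ?b (int (60 * N - Suc j) * D))"
    proof (rule runs_mono[OF runs_attempt[OF conjunct1[OF I]] order_refl], elim conjE)
      fix s'' assume q: "frame attempt s' s''" "base D s''"
        "surplus (imem s'' ''e'') \<le> surplus (imem s' ''e'')"
        "surplus (imem s'' ''e'') \<le> surplus (imem s' ''e'') - D \<or> surplus (imem s'' ''e'') \<le> ?b"
      have "imem s'' ''c'' 0 = int j" using agreeD(1)[OF q(1)] x by simp
      moreover have "base D (iwrite ''c'' 0 (int j + 1) s'')" using q(2) unfolding base_def static_def balanced_def by simp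
      moreover have "int (60 * N - j) * D = int (60 * N - Suc j) * D + D"
        using j by (simp add: of_nat_diff algebra_simps)
      then have "surplus (imem s'' ''e'') \<le> max ?b (int (60 * N - Suc j) * D)"
        using q(3,4) conjunct2[OF I] D unfolding le_max_iff_disj by linarith
      ultimately show "imem s'' ''c'' 0 = int j \<and> base D (iwrite ''c'' 0 (int j + 1) s'') \<and>
         surplus (imem (iwrite ''c'' 0 (int j + 1) s'') ''e'') \<le> max ?b (int (60 * N - Suc j) * D)" by simp
    qed
  next
    fix s' assume "base D s' \<and> surplus (imem s' ''e'') \<le> max ?b (int (60 * N - 60 * N) * D)"
    moreover have "0 \<le> ?b" using D by simp
    ultimately show "base D s' \<and> surplus (imem s' ''e'') \<le> ?b" by simp
  qed
  have "runs c phase (phase_time N) s (\<lambda>s'. base D s' \<and> surplus (imem s' ''e'') \<le> ?b)"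
    unfolding phase_def phase_time_def
  proof (rule runs_SeqI[OF 1])
    fix s' assume "s' = ?s1"
    then show "runs c (Seq (For ''x'' (V ''N'') reopt) (For ''c'' (IMul (C 60) (V ''N'')) attempt))
      (fortime N reopt_time (V ''N'') + fortime (60 * N) (attempt_time N) (IMul (C 60) (V ''N''))) s'
      (\<lambda>s'. base D s' \<and> surplus (imem s' ''e'') \<le> ?b)"
      using runs_SeqI[OF l1 l2] by blast
  qed
  from runs_agree[OF this] show ?thesis by (rule runs_mono) auto
qed

end

section \<open>Initial point and output\<close>

definition maxset :: "string \<Rightarrow> iexp \<Rightarrow> com" where
  "maxset x a = Cond (ILe (V x) a) (ISet x a) Skip"

definition minset :: "string \<Rightarrow> iexp \<Rightarrow> com" where
  "minset x a = Cond (ILe a (V x)) (ISet x a) Skip"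

lemma iwrite_same [simp]: "iwrite x k (imem s x k) s = s"
  by (simp add: iwrite_def)

lemma sem_maxset [simp]: "sem c (maxset x a) s = iwrite x 0 (max (imem s x 0) (ival s a)) s"
  by (simp add: maxset_def max_def)

lemma sem_minset [simp]: "sem c (minset x a) s = iwrite x 0 (min (imem s x 0) (ival s a)) s"
  by (simp add: minset_def min_def)

lemma mods_maxset [simp]:
  "imods (maxset x a) = {x}" "rmods (maxset x a) = {}" "loopfree (maxset x a)"
  "imods (minset x a) = {x}" "rmods (minset x a) = {}" "loopfree (minset x a)"
  by (auto simp: maxset_def minset_def)

definition total_body :: com where
  "total_body = Seq (ISet ''i'' (IAdd (V ''x'') (C 1)))
    (Seq (ISet ''T'' (IAdd (V ''T'') (IAdd (IRead ''dbar'' (V ''i'')) (IRead ''bbar'' (V ''i'')))))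
         (ISet ''Q'' (IAdd (V ''Q'') (IRead ''bbar'' (V ''i'')))))"

definition clamp_body :: com where
  "clamp_body = Seq (ISet ''i'' (IAdd (V ''x'') (C 1)))
    (Seq (ISet ''X'' (IAdd (IRead ''dbar'' (V ''i'')) (IRead ''bbar'' (V ''i''))))
    (Seq (ISet ''aa'' (IRead ''l'' (V ''i''))) (Seq (maxset ''aa'' (C 0))
    (Seq (ISet ''vv'' (IRead ''u'' (V ''i''))) (Seq (minset ''vv'' (V ''T''))
    (Seq (ISet ''mm'' (V ''X'')) (Seq (minset ''mm'' (V ''vv'')) (maxset ''mm'' (V ''aa'')))))))))"

definition store_body :: com where
  "store_body = Seq (IAssign ''lo'' (V ''i'') (V ''aa'')) (Seq (IAssign ''up'' (V ''i'') (V ''vv''))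
    (Seq (IAssign ''m'' (V ''i'') (V ''mm'')) (Seq (IAssign ''f'' (V ''i'') (C 1))
    (Seq (IAssign ''y'' (ycell (C 0)) (ISub (C 0) (V ''mm''))) (IAssign ''y'' (ycell (C 2)) (V ''mm''))))))"

definition sum_body :: com where
  "sum_body = Seq (ISet ''S'' (IAdd (V ''S'') (V ''mm'')))
    (Seq (ISet ''cc'' (ISub (V ''mm'') (V ''X''))) (Seq (maxset ''cc'' (C 0))
      (ISet ''G'' (ISub (V ''G'') (V ''cc'')))))"

definition station_body :: com where
  "station_body = Seq clamp_body (Seq store_body sum_body)"

definition dummy_bounds :: com where
  "dummy_bounds = Seq (ISet ''i'' (V ''N'')) (Seq (ISet ''W'' (IAdd (V ''Q'') (V ''G'')))
    (Seq (IAssign ''lo'' (V ''i'') (V ''W'')) (Seq (IAssign ''up'' (V ''i'') (V ''W''))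
    (IAssign ''m'' (V ''i'') (V ''W'')))))"

definition dummy_point :: com where
  "dummy_point = Seq (IAssign ''y'' (ycell (C 0)) (ISub (C 0) (V ''Q''))) (Seq (IAssign ''y'' (ycell (C 1)) (ISub (C 0) (V ''G'')))
    (Seq (IAssign ''y'' (ycell (C 2)) (V ''G'')) (Seq (IAssign ''y'' (ycell (C 3)) (V ''Q''))
    (Seq (IAssign ''e'' (C 0) (ISub (V ''T'') (V ''S''))) (Seq (IAssign ''e'' (C 2) (ISub (V ''S'') (V ''T'')))
    (Seq (ISet ''D'' (C 2)) (ISet ''K'' (C 1))))))))"

text \<open>The dummy has \<open>Q + G\<close> docks. It starts with all \<open>Q\<close> bikes that may be used and all \<open>G\<close> additional docks, so
that the totals of two of the nodes are correct from the beginning.\<close>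

definition dummy_init :: com where
  "dummy_init = Seq dummy_bounds dummy_point"

definition double_body :: com where
  "double_body = Seq (ISet ''D'' (IMul (V ''D'') (C 2))) (ISet ''K'' (IAdd (V ''K'') (C 1)))"

definition output_body :: com where
  "output_body = Seq (ISet ''i'' (IAdd (V ''x'') (C 1)))
    (Seq (IAssign ''d'' (V ''i'') (IRead ''y'' (ycell (C 2)))) (IAssign ''b'' (V ''i'') (IRead ''y'' (ycell (C 3)))))"

definition prepare :: com where
  "prepare = Seq (ISet ''N'' (IAdd (V ''n'') (C 1))) (Seq (For ''x'' (V ''n'') total_body)
    (Seq (ISet ''G'' (V ''gamma'')) (Seq (For ''x'' (V ''n'') station_body) dummy_init)))"

definition solve_DR :: com where
  "solve_DR = Seq prepare (Seq (While (ILe (V ''D'') (V ''T'')) double_body)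
     (Seq (For ''H'' (V ''K'') phase) (For ''x'' (V ''n'') output_body)))"

lemma mods_parts [simp]:
  "imods clamp_body = {''i'', ''X'', ''aa'', ''vv'', ''mm''}" "rmods clamp_body = {}" "loopfree clamp_body"
  "imods store_body = {''lo'', ''up'', ''m'', ''f'', ''y''}" "rmods store_body = {}" "loopfree store_body"
  "imods sum_body = {''S'', ''cc'', ''G''}" "rmods sum_body = {}" "loopfree sum_body"
  "imods dummy_bounds = {''i'', ''W'', ''lo'', ''up'', ''m''}" "rmods dummy_bounds = {}" "loopfree dummy_bounds"
  "imods dummy_point = {''y'', ''e'', ''D'', ''K''}" "rmods dummy_point = {}" "loopfree dummy_point"
  by (auto simp: clamp_body_def store_body_def sum_body_def dummy_bounds_def dummy_point_def)

lemma mods_bodies [simp]: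
  "imods total_body = {''i'', ''T'', ''Q''}" "rmods total_body = {}" "loopfree total_body"
  "imods station_body = {''i'', ''X'', ''aa'', ''vv'', ''mm'', ''lo'', ''up'', ''m'', ''f'', ''y'', ''S'', ''cc'', ''G''}"
  "rmods station_body = {}" "loopfree station_body"
  "imods dummy_init = {''i'', ''W'', ''lo'', ''up'', ''m'', ''y'', ''e'', ''D'', ''K''}" "rmods dummy_init = {}" "loopfree dummy_init"
  "imods double_body = {''D'', ''K''}" "rmods double_body = {}" "loopfree double_body"
  "imods output_body = {''i'', ''d'', ''b''}" "rmods output_body = {}" "loopfree output_body"
  by (auto simp: total_body_def station_body_def dummy_init_def double_body_def output_body_def)

lemma imods_phase [simp]:
  "imods phase = {''j'', ''v'', ''i'', ''s'', ''z'', ''g'', ''q'', ''r'', ''o'', ''P'', ''A'', ''k'', ''w'', ''B'', ''x'', ''h'', ''y'', ''e'', ''D'', ''c''}"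
  "rmods phase = {''t'', ''p''}"
  by (auto simp: phase_def)

text \<open>The number of iterations is known in advance, because \<open>\<kappa>\<close> is the least positive exponent with \<open>T < 2 ^ \<kappa>\<close>.\<close>

lemma runs_double:
  assumes "T < 2 ^ \<kappa>" "\<kappa> \<le> 1 \<or> 2 ^ (\<kappa> - 1) \<le> T"
    and "1 \<le> k" "k \<le> \<kappa>" "imem s ''D'' 0 = 2 ^ k" "imem s ''K'' 0 = int k" "imem s ''T'' 0 = T"
  shows "runs c (While (ILe (V ''D'') (V ''T'')) double_body) ((\<kappa> - k) * (maxtime double_body + 6) + 6) s
    (\<lambda>s'. agree {''D'', ''K''} {} s s' \<and> imem s' ''D'' 0 = 2 ^ \<kappa> \<and> imem s' ''K'' 0 = int \<kappa>)"
  using assms(3-)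
proof (induction "\<kappa> - k" arbitrary: k s)
  case 0
  then have k: "k = \<kappa>" by simp
  show ?case
  proof (rule runs_exec[OF exec.WhileFalse])
    show "\<not> bval c s (ILe (V ''D'') (V ''T''))" using 0 k assms(1) by simp
  qed (use 0 k in auto)
next
  case (Suc d)
  then have k: "k < \<kappa>" by simp
  have "(2::int) ^ k \<le> 2 ^ (\<kappa> - 1)" using k by (intro power_increasing) auto
  moreover have "2 ^ (\<kappa> - 1) \<le> T" using assms(2) Suc.prems k by auto
  ultimately have "2 ^ k \<le> T" by linarith
  then have b: "bval c s (ILe (V ''D'') (V ''T''))" using Suc.prems by simp
  let ?t = "sem c double_body s"
  have t: "imem ?t ''D'' 0 = 2 ^ Suc k" "imem ?t ''K'' 0 = int (Suc k)" "imem ?t ''T'' 0 = T"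
    using Suc.prems by (simp_all add: double_body_def)
  have ag: "agree {''D'', ''K''} {} s ?t" using sem_agree[of double_body s c] by simp
  obtain t1 where e1: "exec c double_body s t1 ?t" "t1 \<le> maxtime double_body"
    using runs_sem[of double_body "\<lambda>s'. s' = ?t" c s] unfolding runs_def by auto
  have "runs c (While (ILe (V ''D'') (V ''T'')) double_body) ((\<kappa> - Suc k) * (maxtime double_body + 6) + 6) ?t
    (\<lambda>s'. agree {''D'', ''K''} {} ?t s' \<and> imem s' ''D'' 0 = 2 ^ \<kappa> \<and> imem s' ''K'' 0 = int \<kappa>)"
    using Suc.hyps(2) k t by (intro Suc.hyps(1)) auto
  then obtain t2 s2 where e2: "exec c (While (ILe (V ''D'') (V ''T'')) double_body) ?t t2 s2"
    "t2 \<le> (\<kappa> - Suc k) * (maxtime double_body + 6) + 6" "agree {''D'', ''K''} {} ?t s2"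
    "imem s2 ''D'' 0 = 2 ^ \<kappa>" "imem s2 ''K'' 0 = int \<kappa>" unfolding runs_def by blast
  have "\<kappa> - k = Suc (\<kappa> - Suc k)" using k by simp
  then have "btime (ILe (V ''D'') (V ''T'')) + t1 + t2 + 1 \<le> (\<kappa> - k) * (maxtime double_body + 6) + 6"
    using e1(2) e2(2) by simp
  with exec.WhileTrue[OF b e1(1) e2(1)] agree_trans[OF ag e2(3)] e2(4,5) show ?case
    unfolding runs_def by blast
qed

lemma sem_station:
  fixes s c
  defines "s' \<equiv> sem c station_body s" and "i \<equiv> imem s ''x'' 0 + 1"
  defines "xb \<equiv> imem s ''dbar'' i + imem s ''bbar'' i"
  defines "a \<equiv> max (imem s ''l'' i) 0" and "v \<equiv> min (imem s ''u'' i) (imem s ''T'' 0)"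
  defines "m \<equiv> max (min xb v) a"
  shows "imem s' ''lo'' = (imem s ''lo'')(i := a)" "imem s' ''up'' = (imem s ''up'')(i := v)"
    "imem s' ''m'' = (imem s ''m'')(i := m)" "imem s' ''f'' = (imem s ''f'')(i := 1)"
    "imem s' ''y'' = (imem s ''y'')(4 * i := - m, 4 * i + 2 := m)"
    "imem s' ''S'' 0 = imem s ''S'' 0 + m" "imem s' ''G'' 0 = imem s ''G'' 0 - max (m - xb) 0"
proof -
  define t where "t = sem c clamp_body s"
  define u where "u = sem c store_body t"
  have t: "imem t ''i'' 0 = i" "imem t ''X'' 0 = xb" "imem t ''aa'' 0 = a" "imem t ''vv'' 0 = v" "imem t ''mm'' 0 = m"
    unfolding t_def clamp_body_def m_def a_def v_def xb_def i_def by simp_all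
  have ag: "frame clamp_body s t" unfolding t_def by (rule sem_agree) simp
  have ag2: "frame store_body t u" unfolding u_def by (rule sem_agree) simp
  have s': "s' = sem c sum_body u" unfolding s'_def station_body_def u_def t_def by simp
  have ag3: "frame sum_body u s'" unfolding s' by (rule sem_agree) simp
  have "imem u ''lo'' = (imem t ''lo'')(i := a)" "imem u ''up'' = (imem t ''up'')(i := v)"
    "imem u ''m'' = (imem t ''m'')(i := m)" "imem u ''f'' = (imem t ''f'')(i := 1)"
    "imem u ''y'' = (imem t ''y'')(4 * i := - m, 4 * i + 2 := m)"
    unfolding u_def store_body_def ycell_def by (simp_all add: t)
  with agreeD[OF ag] agreeD[OF ag3]
  show "imem s' ''lo'' = (imem s ''lo'')(i := a)" "imem s' ''up'' = (imem s ''up'')(i := v)"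
    "imem s' ''m'' = (imem s ''m'')(i := m)" "imem s' ''f'' = (imem s ''f'')(i := 1)"
    "imem s' ''y'' = (imem s ''y'')(4 * i := - m, 4 * i + 2 := m)"
    by simp_all
  have "imem u ''S'' = imem s ''S''" "imem u ''G'' = imem s ''G''" "imem u ''mm'' 0 = m" "imem u ''X'' 0 = xb"
    using agreeD[OF ag] agreeD[OF ag2] t by simp_all
  then show "imem s' ''S'' 0 = imem s ''S'' 0 + m" "imem s' ''G'' 0 = imem s ''G'' 0 - max (m - xb) 0"
    unfolding s' sum_body_def by simp_all
qed

lemma sem_dummy:
  fixes s c
  defines "s' \<equiv> sem c dummy_init s" and "i \<equiv> imem s ''N'' 0" and "W \<equiv> imem s ''Q'' 0 + imem s ''G'' 0"
  shows "imem s' ''lo'' = (imem s ''lo'')(i := W)" "imem s' ''up'' = (imem s ''up'')(i := W)"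
    "imem s' ''m'' = (imem s ''m'')(i := W)"
    "imem s' ''y'' = (imem s ''y'')(4 * i := - imem s ''Q'' 0, 4 * i + 1 := - imem s ''G'' 0, 4 * i + 2 := imem s ''G'' 0, 4 * i + 3 := imem s ''Q'' 0)"
    "imem s' ''e'' = (imem s ''e'')(0 := imem s ''T'' 0 - imem s ''S'' 0, 2 := imem s ''S'' 0 - imem s ''T'' 0)"
    "imem s' ''D'' 0 = 2" "imem s' ''K'' 0 = 1"
proof -
  define t where "t = sem c dummy_bounds s"
  have s': "s' = sem c dummy_point t" unfolding s'_def dummy_init_def t_def by simp
  have ag: "frame dummy_bounds s t" unfolding t_def by (rule sem_agree) simp
  have ag2: "frame dummy_point t s'" unfolding s' by (rule sem_agree) simp
  have t: "imem t ''i'' 0 = i" "imem t ''lo'' = (imem s ''lo'')(i := W)" "imem t ''up'' = (imem s ''up'')(i := W)"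
    "imem t ''m'' = (imem s ''m'')(i := W)"
    unfolding t_def dummy_bounds_def i_def W_def by simp_all
  then show "imem s' ''lo'' = (imem s ''lo'')(i := W)" "imem s' ''up'' = (imem s ''up'')(i := W)"
    "imem s' ''m'' = (imem s ''m'')(i := W)"
    using agreeD[OF ag2] by simp_all
  have t': "imem t ''Q'' = imem s ''Q''" "imem t ''G'' = imem s ''G''" "imem t ''T'' = imem s ''T''" "imem t ''S'' = imem s ''S''"
    "imem t ''y'' = imem s ''y''" "imem t ''e'' = imem s ''e''"
    using agreeD[OF ag] by simp_all
  show "imem s' ''y'' = (imem s ''y'')(4 * i := - imem s ''Q'' 0, 4 * i + 1 := - imem s ''G'' 0, 4 * i + 2 := imem s ''G'' 0, 4 * i + 3 := imem s ''Q'' 0)"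
    "imem s' ''e'' = (imem s ''e'')(0 := imem s ''T'' 0 - imem s ''S'' 0, 2 := imem s ''S'' 0 - imem s ''T'' 0)"
    "imem s' ''D'' 0 = 2" "imem s' ''K'' 0 = 1"
    unfolding s' dummy_point_def ycell_def by (simp_all add: t t')
qed

section \<open>The reduced instance\<close>

definition xbar :: "instance_DR \<Rightarrow> nat \<Rightarrow> int" where
  "xbar I i = dbar I i + bbar I i"

definition Ttot :: "instance_DR \<Rightarrow> int" where
  "Ttot I = Dtot I + Btot I"

definition low :: "instance_DR \<Rightarrow> nat \<Rightarrow> int" where
  "low I i = max (lo I i) 0"

definition upp :: "instance_DR \<Rightarrow> nat \<Rightarrow> int" where
  "upp I i = min (up I i) (Ttot I)"

definition mid :: "instance_DR \<Rightarrow> nat \<Rightarrow> int" where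
  "mid I i = max (min (xbar I i) (upp I i)) (low I i)"

text \<open>The additional docks that remain available after those forced by the bounds.\<close>

definition slack :: "instance_DR \<Rightarrow> int" where
  "slack I = gam I - (\<Sum>i = 1..nstations I. max (mid I i - xbar I i) 0)"

lemma Ttot_sum: "Ttot I = (\<Sum>i = 1..nstations I. xbar I i)"
  unfolding Ttot_def Dtot_def Btot_def xbar_def by (simp add: sum.distrib)

abbreviation station_start :: "instance_DR \<Rightarrow> state \<Rightarrow> nat \<Rightarrow> bool" where
  "station_start I s i \<equiv> imem s ''lo'' (int i) = low I i \<and> imem s ''up'' (int i) = upp I i \<and> imem s ''m'' (int i) = mid I i \<and>
        imem s ''f'' (int i) = 1 \<and> imem s ''y'' (4 * int i) = - mid I i \<and> imem s ''y'' (4 * int i + 1) = 0 \<and>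
        imem s ''y'' (4 * int i + 2) = mid I i \<and> imem s ''y'' (4 * int i + 3) = 0"

definition start :: "instance_DR \<Rightarrow> state \<Rightarrow> bool" where
  "start I s \<longleftrightarrow> (let n = nstations I; Y = imem s ''y'' in
     imem s ''n'' 0 = int n \<and> imem s ''N'' 0 = int n + 1 \<and>
     (\<forall>i\<in>{1..n}. station_start I s i) \<and>
     (let i = int n + 1; W = Btot I + slack I in imem s ''lo'' i = W \<and> imem s ''up'' i = W \<and> imem s ''m'' i = W \<and>
        imem s ''f'' i = 0 \<and> Y (4 * i) = - Btot I \<and> Y (4 * i + 1) = - slack I \<and>
        Y (4 * i + 2) = slack I \<and> Y (4 * i + 3) = Btot I) \<and>
     (let S = (\<Sum>i = 1..n. mid I i) in imem s ''e'' 0 = Ttot I - S \<and> imem s ''e'' 1 = 0 \<and> imem s ''e'' 2 = S - Ttot I \<and>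
        imem s ''e'' 3 = 0) \<and>
     rmem s ''p'' = (\<lambda>_. 0) \<and> imem s ''D'' 0 = 2 \<and> imem s ''K'' 0 = 1 \<and> imem s ''T'' 0 = Ttot I)"

definition prepare_time :: "nat \<Rightarrow> nat" where
  "prepare_time n = 50 + (fortime n (maxtime total_body) (V ''n'') + (50 + (fortime n (maxtime station_body) (V ''n'') + maxtime dummy_init)))"

lemma runs_prepare: "runs c prepare (prepare_time (nstations I)) (input_DR I) (start I)"
proof -
  let ?s = "input_DR I"
  define n where "n = nstations I"
  have inp: "imem ?s ''n'' 0 = int n" "imem ?s ''gamma'' 0 = gam I" "imem ?s ''dbar'' = input_vec n (dbar I)"
    "imem ?s ''bbar'' = input_vec n (bbar I)" "imem ?s ''l'' = input_vec n (lo I)" "imem ?s ''u'' = input_vec n (up I)"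
    "imem ?s ''T'' = (\<lambda>_. 0)" "imem ?s ''Q'' = (\<lambda>_. 0)" "imem ?s ''S'' = (\<lambda>_. 0)" "imem ?s ''y'' = (\<lambda>_. 0)"
    "imem ?s ''e'' = (\<lambda>_. 0)" "imem ?s ''f'' = (\<lambda>_. 0)" "rmem ?s = (\<lambda>_ _. 0)"
    unfolding input_DR_def n_def by simp_all
  let ?s1 = "iwrite ''N'' 0 (int n + 1) ?s"
  have 1: "runs c (ISet ''N'' (IAdd (V ''n'') (C 1))) 50 ?s (\<lambda>s'. s' = ?s1)"
    by (rule runs_exec[OF exec.IAssign]) (simp_all add: inp)
  define I1 where "I1 = (\<lambda>(j::nat) s'. agree {''x'', ''i'', ''T'', ''Q''} {} ?s1 s' \<and>
     imem s' ''T'' 0 = (\<Sum>i = 1..j. xbar I i) \<and> imem s' ''Q'' 0 = (\<Sum>i = 1..j. bbar I i))"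
  have l1: "runs c (For ''x'' (V ''n'') total_body) (fortime n (maxtime total_body) (V ''n'')) ?s1 (I1 n)"
  proof (rule runs_For[where I = I1])
    show "I1 0 (iwrite ''x'' 0 0 ?s1)" unfolding I1_def agree_def by (simp add: inp)
  next
    fix j :: nat and s' assume "I1 j s'"
    then show "ival s' (V ''n'') = int n"
      using agreeD(1)[of "{''x'', ''i'', ''T'', ''Q''}" "{}" ?s1 s' "''n''"] inp unfolding I1_def by simp
  next
    fix j :: nat and s' assume j: "j < n" "I1 j s'" "imem s' ''x'' 0 = int j"
    let ?t = "sem c total_body s'"
    have ag: "agree {''x'', ''i'', ''T'', ''Q''} {} ?s1 s'" using j unfolding I1_def by blast
    have ag2: "agree {''i'', ''T'', ''Q''} {} s' ?t" using sem_agree[of total_body s' c] by simp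
    have ag3: "agree {''x'', ''i'', ''T'', ''Q''} {} ?s1 (iwrite ''x'' 0 (int j + 1) ?t)"
      by (rule agree_iwrite, simp, rule agree_trans[OF ag agree_mono[OF ag2]]) auto
    have b: "imem s' ''dbar'' (int j + 1) = dbar I (Suc j)" "imem s' ''bbar'' (int j + 1) = bbar I (Suc j)"
      using agreeD(1)[OF ag] inp j by (simp_all add: input_vec_def nat_add_distrib)
    have "imem ?t ''T'' 0 = (\<Sum>i = 1..Suc j. xbar I i)" "imem ?t ''Q'' 0 = (\<Sum>i = 1..Suc j. bbar I i)"
      using j b unfolding total_body_def I1_def xbar_def by simp_all
    then show "runs c total_body (maxtime total_body) s' (\<lambda>s'. imem s' ''x'' 0 = int j \<and> I1 (Suc j) (iwrite ''x'' 0 (int j + 1) s'))"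
      using ag3 agreeD(1)[OF ag2] j unfolding I1_def by (intro runs_sem) auto
  qed auto
  let ?W = "{''x'', ''i'', ''X'', ''aa'', ''vv'', ''mm'', ''lo'', ''up'', ''m'', ''f'', ''y'', ''S'', ''cc'', ''G''}"
  have l2: "runs c (Seq (ISet ''G'' (V ''gamma'')) (Seq (For ''x'' (V ''n'') station_body) dummy_init))
     (50 + (fortime n (maxtime station_body) (V ''n'') + maxtime dummy_init)) s2 (start I)"
    if I1: "I1 n s2" for s2
  proof -
    have ag: "agree {''x'', ''i'', ''T'', ''Q''} {} ?s1 s2" using I1 unfolding I1_def by blast
    have T2: "imem s2 ''T'' 0 = Ttot I" "imem s2 ''Q'' 0 = Btot I"
      using I1 unfolding I1_def Ttot_sum Btot_def n_def by auto
    have inp2: "imem s2 ''n'' 0 = int n" "imem s2 ''N'' 0 = int n + 1" "imem s2 ''gamma'' 0 = gam I" "imem s2 ''dbar'' = input_vec n (dbar I)"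
      "imem s2 ''bbar'' = input_vec n (bbar I)" "imem s2 ''l'' = input_vec n (lo I)" "imem s2 ''u'' = input_vec n (up I)"
      "imem s2 ''S'' = (\<lambda>_. 0)" "imem s2 ''y'' = (\<lambda>_. 0)"
      "imem s2 ''e'' = (\<lambda>_. 0)" "imem s2 ''f'' = (\<lambda>_. 0)" "rmem s2 = (\<lambda>_ _. 0)"
      using agreeD[OF ag] inp by (simp_all add: fun_eq_iff)
    let ?s3 = "iwrite ''G'' 0 (gam I) s2"
    have 2: "runs c (ISet ''G'' (V ''gamma'')) 50 s2 (\<lambda>s'. s' = ?s3)"
      by (rule runs_exec[OF exec.IAssign]) (simp_all add: inp2)
    define I2 where "I2 = (\<lambda>(j::nat) s'. agree ?W {} ?s3 s' \<and>
      (\<forall>i\<in>{1..j}. station_start I s' i) \<and>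
      (\<forall>x. int j < x \<longrightarrow> imem s' ''f'' x = 0) \<and> (\<forall>x\<ge>4 * int j + 4. imem s' ''y'' x = 0) \<and>
      imem s' ''S'' 0 = (\<Sum>i = 1..j. mid I i) \<and> imem s' ''G'' 0 = gam I - (\<Sum>i = 1..j. max (mid I i - xbar I i) 0))"
    have l3: "runs c (For ''x'' (V ''n'') station_body) (fortime n (maxtime station_body) (V ''n'')) ?s3 (I2 n)"
    proof (rule runs_For[where I = I2])
      show "I2 0 (iwrite ''x'' 0 0 ?s3)" unfolding I2_def agree_def by (simp add: inp2)
    next
      fix j :: nat and s' assume "I2 j s'"
      then show "ival s' (V ''n'') = int n"
        using agreeD(1)[of ?W "{}" ?s3 s' "''n''"] inp2 unfolding I2_def by simp
    next
      fix j :: nat and s' assume j: "j < n" and I: "I2 j s'" and x: "imem s' ''x'' 0 = int j"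
      let ?t = "sem c station_body s'"
      have ag: "agree ?W {} ?s3 s'" using I unfolding I2_def by blast
      have ag2: "frame station_body s' ?t" by (rule sem_agree) simp
      have ag3: "agree ?W {} ?s3 (iwrite ''x'' 0 (int j + 1) ?t)"
        by (rule agree_iwrite, simp, rule agree_trans[OF ag agree_mono[OF ag2]]) auto
      have b: "imem s' ''dbar'' (int j + 1) = dbar I (Suc j)" "imem s' ''bbar'' (int j + 1) = bbar I (Suc j)"
        "imem s' ''l'' (int j + 1) = lo I (Suc j)" "imem s' ''u'' (int j + 1) = up I (Suc j)" "imem s' ''T'' 0 = Ttot I"
        using agreeD(1)[OF ag] inp2 T2 j by (simp_all add: input_vec_def nat_add_distrib)
      note st = sem_station[of c s', unfolded x b, folded xbar_def low_def upp_def, folded mid_def]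
      have xt: "imem ?t ''x'' 0 = int j" using agreeD(1)[OF ag2] x by simp
      have I': "\<forall>i\<in>{1..j}. station_start I s' i"
        "\<forall>x. int j < x \<longrightarrow> imem s' ''f'' x = 0" "\<forall>x\<ge>4 * int j + 4. imem s' ''y'' x = 0"
        "imem s' ''S'' 0 = (\<Sum>i = 1..j. mid I i)" "imem s' ''G'' 0 = gam I - (\<Sum>i = 1..j. max (mid I i - xbar I i) 0)"
        using I unfolding I2_def by blast+
      have A: "station_start I ?t i" if i: "i \<in> {1..Suc j}" for i
      proof (cases "i = Suc j")
        case True
        have "4 * (int j + 1) + 1 \<ge> 4 * int j + 4" "4 * (int j + 1) + 3 \<ge> 4 * int j + 4" by auto
        then show ?thesis using I'(3) unfolding st True by (simp add: add.commute)
      next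
        case False
        then have i': "i \<in> {1..j}" "int i \<noteq> int j + 1" using i by auto
        have "4 * int i + a \<noteq> 4 * (int j + 1) \<and> 4 * int i + a \<noteq> 4 * (int j + 1) + 2" if "a \<in> nodes" for a
          using i' that unfolding nodes_eq by (elim insertE emptyE; simp; presburger)
        from this[of 0] this[of 1] this[of 2] this[of 3] show ?thesis
          using bspec[OF I'(1) i'(1)] i'(2) unfolding st by simp
      qed
      have "I2 (Suc j) (iwrite ''x'' 0 (int j + 1) ?t)"
        unfolding I2_def using ag3 A I'(2-5) by (simp add: st)
      then show "runs c station_body (maxtime station_body) s' (\<lambda>s'. imem s' ''x'' 0 = int j \<and> I2 (Suc j) (iwrite ''x'' 0 (int j + 1) s'))"
        using xt by (intro runs_sem) auto
    qed auto
    have 4: "runs c dummy_init (maxtime dummy_init) s4 (start I)" if I2: "I2 n s4" for s4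
    proof (rule runs_sem)
      let ?t = "sem c dummy_init s4"
      have ag: "agree ?W {} ?s3 s4" using I2 unfolding I2_def by blast
      have s4: "imem s4 ''n'' 0 = int n" "imem s4 ''N'' 0 = int n + 1" "imem s4 ''T'' 0 = Ttot I" "imem s4 ''Q'' 0 = Btot I"
        "imem s4 ''e'' = (\<lambda>_. 0)" "rmem s4 = (\<lambda>_ _. 0)"
        using agreeD[OF ag] inp2 T2 by (simp_all add: fun_eq_iff)
      have SG: "imem s4 ''S'' 0 = (\<Sum>i = 1..n. mid I i)" "imem s4 ''G'' 0 = slack I" "imem s4 ''f'' (int n + 1) = 0"
        using I2 unfolding I2_def slack_def n_def by auto
      have ag2: "frame dummy_init s4 ?t" by (rule sem_agree) simp
      have t: "imem ?t ''n'' 0 = int n" "imem ?t ''N'' 0 = int n + 1" "imem ?t ''T'' 0 = Ttot I" "rmem ?t ''p'' = (\<lambda>_. 0)" "imem ?t ''f'' = imem s4 ''f''"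
        using agreeD[OF ag2] s4 by simp_all
      note d = sem_dummy[of c s4, unfolded s4 SG]
      have A: "station_start I ?t i" if i: "i \<in> {1..n}" for i
      proof -
        have "4 * int i + a < 4 * (int n + 1)" if "a \<in> nodes" for a using i that by auto
        from this[of 0] this[of 1] this[of 2] this[of 3] show ?thesis
          using I2 i unfolding I2_def d t by auto
      qed
      show "start I ?t"
        unfolding start_def Let_def n_def[symmetric] using A t d SG by simp
    qed simp
    show ?thesis
      using runs_SeqI[OF 2, of "Seq (For ''x'' (V ''n'') station_body) dummy_init"
          "fortime n (maxtime station_body) (V ''n'') + maxtime dummy_init" "start I"] runs_SeqI[OF l3 4] by blast
  qed
  show ?thesis unfolding prepare_def prepare_time_def n_def[symmetric]
    using runs_SeqI[OF 1, of "Seq (For ''x'' (V ''n'') total_body)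
    (Seq (ISet ''G'' (V ''gamma'')) (Seq (For ''x'' (V ''n'') station_body) dummy_init))"
          _ "start I"] runs_SeqI[OF l1 l2] by blast
qed

section \<open>Feasible solutions as points of the network\<close>

lemma sum_int_nat: "(\<Sum>i\<in>{1..int n}. g i) = (\<Sum>i = 1..n. g (int i))"
proof (induction n)
  case (Suc n)
  have "{1..int (Suc n)} = insert (int n + 1) {1..int n}" by auto
  then show ?case using Suc by (simp add: add.commute)
qed simp

lemma sum_with_dummy: "(\<Sum>i\<in>{1..int (Suc n)}. g i) = (\<Sum>i = 1..n. g (int i)) + g (int n + 1)"
proof -
  have "{1..int (Suc n)} = insert (int n + 1) {1..int n}" by auto
  then show ?thesis by (simp add: sum_int_nat add.commute)
qed

definition above :: "instance_DR \<Rightarrow> (nat \<Rightarrow> int) \<Rightarrow> (nat \<Rightarrow> int) \<Rightarrow> nat \<Rightarrow> int" where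
  "above I d b i = max (d i + b i - mid I i) 0"

text \<open>The station \<open>nstations I + 1\<close> is the dummy, which holds the bikes and the additional docks not used by \<open>d\<close> and \<open>b\<close>.\<close>

definition embed :: "instance_DR \<Rightarrow> (nat \<Rightarrow> int) \<Rightarrow> (nat \<Rightarrow> int) \<Rightarrow> int \<Rightarrow> int \<Rightarrow> int" where
  "embed I d b i =
    (let n = nstations I; j = nat i; W = Btot I + slack I; b0 = Btot I - (\<Sum>i = 1..n. b i);
         e0 = slack I - (\<Sum>i = 1..n. above I d b i)
     in if i = int n + 1 then (\<lambda>v. if v = 0 then e0 - W else if v = 1 then - e0 else if v = 2 then W - b0 else b0)
        else (\<lambda>v. if v = 0 then above I d b j - (d j + b j) else if v = 1 then - above I d b j else if v = 2 then d j else b j))"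

definition target :: "instance_DR \<Rightarrow> int \<Rightarrow> int" where
  "target I v = (if v = 0 then - Ttot I - Btot I else if v = 1 then - slack I else if v = 2 then Ttot I + slack I else Btot I)"

lemma feasible_sums:
  assumes "feasible_DR I d b"
  shows "(\<Sum>i = 1..nstations I. d i + b i) = Ttot I"
    and "i \<in> {1..nstations I} \<Longrightarrow> low I i \<le> d i + b i \<and> d i + b i \<le> upp I i \<and> 0 \<le> d i \<and> 0 \<le> b i"
proof -
  show s: "(\<Sum>i = 1..nstations I. d i + b i) = Ttot I"
    using assms unfolding feasible_DR_def Ttot_def by (simp add: sum.distrib)
  assume i: "i \<in> {1..nstations I}"
  have nn: "0 \<le> d j" "0 \<le> b j" if "j \<in> {1..nstations I}" for j using assms that unfolding feasible_DR_def by auto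
  have "d i + b i \<le> (\<Sum>i = 1..nstations I. d i + b i)"
    by (rule member_le_sum[OF i]) (use nn in auto)
  then show "low I i \<le> d i + b i \<and> d i + b i \<le> upp I i \<and> 0 \<le> d i \<and> 0 \<le> b i"
    using assms i nn[OF i] unfolding s feasible_DR_def low_def upp_def by auto
qed

text \<open>For dock numbers within the bounds, the excess over \<open>xbar\<close> splits into that over \<open>mid\<close> and a constant. The sum of
the absolute differences is twice that of their positive parts, as the differences sum to 0.\<close>

lemma above_sum:
  assumes "feasible_DR I d b"
  shows "(\<Sum>i = 1..nstations I. above I d b i) \<le> slack I"
proof -
  let ?S = "\<lambda>g. \<Sum>i = 1..nstations I. g i :: int"
  have "above I d b i + max (mid I i - xbar I i) 0 = max (d i + b i - xbar I i) 0" if i: "i \<in> {1..nstations I}" for i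
    using feasible_sums(2)[OF assms i] unfolding above_def mid_def by (auto simp: max_def min_def)
  then have "?S (above I d b) + ?S (\<lambda>i. max (mid I i - xbar I i) 0) = ?S (\<lambda>i. max (d i + b i - xbar I i) 0)"
    unfolding sum.distrib[symmetric] by (intro sum.cong) auto
  moreover have "2 * ?S (\<lambda>i. max (d i + b i - xbar I i) 0) = ?S (\<lambda>i. \<bar>d i + b i - xbar I i\<bar> + (d i + b i - xbar I i))"
    unfolding sum_distrib_left by (intro sum.cong) (auto simp: max_def)
  moreover have "\<dots> = ?S (\<lambda>i. \<bar>d i + b i - xbar I i\<bar>)"
    using feasible_sums(1)[OF assms] Ttot_sum[of I] by (simp add: sum.distrib sum_subtractf)
  moreover have "\<dots> \<le> 2 * gam I" using assms unfolding feasible_DR_def xbar_def by blast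
  ultimately show ?thesis unfolding slack_def by linarith
qed

lemma embed_sum:
  assumes "feasible_DR I d b" "v \<in> nodes"
  shows "(\<Sum>i\<in>{1..int (Suc (nstations I))}. embed I d b i v) = target I v"
proof -
  have "v = 0 \<or> v = 1 \<or> v = 2 \<or> v = 3" using assms(2) unfolding nodes_eq by blast
  then show ?thesis
    using feasible_sums(1)[OF assms(1)] unfolding sum_with_dummy
    by (elim disjE) (simp_all add: embed_def Let_def target_def sum.distrib sum_subtractf sum_negf)
qed

lemma slack_nonneg:
  assumes "feasible_DR I d b" shows "0 \<le> slack I"
proof -
  have "0 \<le> (\<Sum>i = 1..nstations I. above I d b i)" unfolding above_def by (intro sum_nonneg) auto
  with above_sum[OF assms] show ?thesis by linarith
qed

lemma embed_adm:
  assumes "feasible_DR I d b"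
  shows "i \<in> {1..nstations I} \<Longrightarrow> adm (low I i) (upp I i) (mid I i) (embed I d b (int i))"
    "adm (Btot I + slack I) (Btot I + slack I) (Btot I + slack I) (embed I d b (int (nstations I) + 1))"
proof -
  assume i: "i \<in> {1..nstations I}"
  show "adm (low I i) (upp I i) (mid I i) (embed I d b (int i))"
    using feasible_sums(2)[OF assms i] i unfolding adm_def embed_def Let_def above_def by auto
next
  have "0 \<le> (\<Sum>i = 1..nstations I. b i)" "(\<Sum>i = 1..nstations I. b i) \<le> Btot I"
    using assms unfolding feasible_DR_def by (auto intro: sum_nonneg)
  moreover have "0 \<le> (\<Sum>i = 1..nstations I. above I d b i)" unfolding above_def by (intro sum_nonneg) auto
  ultimately show "adm (Btot I + slack I) (Btot I + slack I) (Btot I + slack I) (embed I d b (int (nstations I) + 1))"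
    using above_sum[OF assms] slack_nonneg[OF assms] unfolding adm_def embed_def Let_def by auto
qed

text \<open>Weak duality: the total price of the vectors depends only on the totals of the nodes, which are the same for the
computed point and for every feasible solution.\<close>

lemma optimal_certificate:
  assumes val: "valid_DR I" and n: "n = nstations I"
    and F: "\<And>i. i \<in> {1..n} \<Longrightarrow> F (int i) = cfun I i" "F (int n + 1) = (\<lambda>_ _. 0)"
    and op: "\<And>i. i \<in> {1..n} \<Longrightarrow> grid_opt (F (int i)) (low I i) (upp I i) (mid I i) p 1 (vec Y (int i))"
    and op0: "grid_opt (F (int n + 1)) (Btot I + slack I) (Btot I + slack I) (Btot I + slack I) p 1 (vec Y (int n + 1))"
    and tot: "\<And>v. v \<in> nodes \<Longrightarrow> (\<Sum>i\<in>{1..int (Suc n)}. vec Y i v) = target I v"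
    and db: "\<And>i. i \<in> {1..n} \<Longrightarrow> d i = Y (4 * int i + 2)" "\<And>i. i \<in> {1..n} \<Longrightarrow> b i = Y (4 * int i + 3)"
  shows "optimal_DR I d b"
proof -
  let ?W = "Btot I + slack I" and ?N = "{1..int (Suc n)}"
  let ?y0 = "vec Y (int n + 1)"
  have a: "adm (low I i) (upp I i) (mid I i) (vec Y (int i))" if "i \<in> {1..n}" for i using grid_optD(1)[OF op[OF that]] .
  have a0: "adm ?W ?W ?W ?y0" using grid_optD(1)[OF op0] .
  have v: "vec Y (int i) 2 = d i" "vec Y (int i) 3 = b i" if "i \<in> {1..n}" for i
    using db[OF that] unfolding vec_def by simp_all
  have s: "(\<Sum>i = 1..n. vec Y (int i) v) + ?y0 v = target I v" if "v \<in> nodes" for v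
    using tot[OF that] unfolding sum_with_dummy .
  have d: "(\<Sum>i = 1..n. d i) + ?y0 2 = Ttot I + slack I"
    using s[of 2] v(1) by (simp add: target_def)
  have bb: "(\<Sum>i = 1..n. b i) + ?y0 3 = Btot I"
    using s[of 3] v(2) by (simp add: target_def)
  have D0: "?y0 2 + ?y0 3 = ?W" "0 \<le> ?y0 3" "?y0 1 \<le> 0" using a0 unfolding adm_def by auto
  have sT: "(\<Sum>i = 1..n. d i) + (\<Sum>i = 1..n. b i) = Ttot I" using d bb D0 by linarith
  have e: "max (d i + b i - mid I i) 0 \<le> - vec Y (int i) 1" if "i \<in> {1..n}" for i
    using a[OF that] unfolding adm_def v[OF that] by auto
  have "(\<Sum>i = 1..n. - vec Y (int i) 1) = slack I + ?y0 1"
    using s[of 1] by (simp add: target_def sum_negf)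
  moreover have "(\<Sum>i = 1..n. max (d i + b i - mid I i) 0) \<le> (\<Sum>i = 1..n. - vec Y (int i) 1)"
    using e by (intro sum_mono)
  ultimately have es: "(\<Sum>i = 1..n. max (d i + b i - mid I i) 0) \<le> slack I" using D0 by linarith
  have "(\<Sum>i = 1..n. \<bar>(d i + b i) - (dbar I i + bbar I i)\<bar>)
      \<le> (\<Sum>i = 1..n. 2 * (max (d i + b i - mid I i) 0 + max (mid I i - xbar I i) 0) - ((d i + b i) - xbar I i))"
    unfolding xbar_def by (intro sum_mono) (auto simp: max_def)
  also have "\<dots> = 2 * ((\<Sum>i = 1..n. max (d i + b i - mid I i) 0) + (\<Sum>i = 1..n. max (mid I i - xbar I i) 0))
      - ((\<Sum>i = 1..n. d i) + (\<Sum>i = 1..n. b i) - Ttot I)"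
    unfolding Ttot_sum n[symmetric] by (simp add: sum.distrib sum_subtractf sum_distrib_left)
  also have "\<dots> \<le> 2 * gam I" using es sT unfolding slack_def n by simp
  finally have L1: "(\<Sum>i = 1..n. \<bar>(d i + b i) - (dbar I i + bbar I i)\<bar>) \<le> 2 * gam I" .
  have bnd: "0 \<le> d i \<and> 0 \<le> b i \<and> lo I i \<le> d i + b i \<and> d i + b i \<le> up I i" if "i \<in> {1..n}" for i
    using a[OF that] unfolding adm_def v[OF that] low_def upp_def by auto
  have feas: "feasible_DR I d b"
    unfolding feasible_DR_def n[symmetric] using bnd sT bb D0 L1 unfolding Ttot_def by auto
  have "objective_DR I d b \<le> objective_DR I d' b'" if f: "feasible_DR I d' b'" for d' b'
  proof -
    let ?z = "embed I d' b'"
    have total: "(\<Sum>i\<in>?N. red (F i) p (x i)) = (\<Sum>i\<in>?N. F i (x i 2) (x i 3)) + (\<Sum>k\<in>nodes. p k * of_int (target I k))"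
      if "\<And>v. v \<in> nodes \<Longrightarrow> (\<Sum>i\<in>?N. x i v) = target I v" for x :: "int \<Rightarrow> int \<Rightarrow> int"
    proof -
      have "(\<Sum>i\<in>?N. \<Sum>k\<in>nodes. p k * real_of_int (x i k)) = (\<Sum>k\<in>nodes. p k * real_of_int (\<Sum>i\<in>?N. x i k))"
        by (subst sum.swap) (simp add: sum_distrib_left)
      also have "\<dots> = (\<Sum>k\<in>nodes. p k * of_int (target I k))" by (rule sum.cong) (simp_all only: that)
      finally show ?thesis unfolding red_def by (simp add: sum.distrib)
    qed
    have c1: "same_grid 1 x y" for x y by (simp add: same_grid_def)
    have "(\<Sum>i\<in>?N. red (F i) p (vec Y i)) \<le> (\<Sum>i\<in>?N. red (F i) p (?z i))"
    proof (rule sum_mono)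
      fix i assume "i \<in> ?N"
      then have "i = int n + 1 \<or> (nat i \<in> {1..n} \<and> i = int (nat i))" by auto
      then consider j where "j \<in> {1..n}" "i = int j" | "i = int n + 1" by blast
      then show "red (F i) p (vec Y i) \<le> red (F i) p (?z i)"
      proof cases
        case 1
        then show ?thesis using grid_optD(2)[OF op embed_adm(1)[OF f] c1] n by auto
      next
        case 2
        then show ?thesis using grid_optD(2)[OF op0 embed_adm(2)[OF f, folded n] c1] by auto
      qed
    qed
    then have "(\<Sum>i\<in>?N. F i (vec Y i 2) (vec Y i 3)) \<le> (\<Sum>i\<in>?N. F i (?z i 2) (?z i 3))"
      using total[of "vec Y", OF tot] total[of ?z, OF embed_sum[OF f, folded n]] by simp
    then have "(\<Sum>i = 1..n. F (int i) (vec Y (int i) 2) (vec Y (int i) 3)) \<le> (\<Sum>i = 1..n. F (int i) (?z (int i) 2) (?z (int i) 3))"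
      unfolding sum_with_dummy F(2) by simp
    moreover have "(\<Sum>i = 1..n. F (int i) (vec Y (int i) 2) (vec Y (int i) 3)) = objective_DR I d b"
      unfolding objective_DR_def n[symmetric] by (intro sum.cong) (auto simp: F v)
    moreover have "(\<Sum>i = 1..n. F (int i) (?z (int i) 2) (?z (int i) 3)) = objective_DR I d' b'"
      unfolding objective_DR_def n[symmetric] by (intro sum.cong) (auto simp: F embed_def Let_def n)
    ultimately show ?thesis by simp
  qed
  with feas show ?thesis unfolding optimal_DR_def by blast
qed

section \<open>Running time\<close>

lemma fortime_linear: "1 \<le> n \<Longrightarrow> fortime n k h \<le> (k + 2 * itime h + 40) * n"
proof -
  assume "1 \<le> n"
  then have "itime h + 20 \<le> (itime h + 20) * n" by simp
  then show ?thesis unfolding fortime_def by (simp add: algebra_simps)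
qed

lemma const_le_mult: "1 \<le> (n::nat) \<Longrightarrow> a \<le> a * n"
  by simp

lemma linear_prepare: "\<exists>A. \<forall>n\<ge>1. prepare_time n + fortime n (maxtime output_body) h \<le> A * n"
proof -
  let ?a = "\<lambda>k h. k + 2 * itime h + 40"
  have "prepare_time n + fortime n (maxtime output_body) h \<le>
     (100 + maxtime dummy_init + ?a (maxtime total_body) (V ''n'') + ?a (maxtime station_body) (V ''n'') + ?a (maxtime output_body) h) * n"
    if n: "1 \<le> n" for n
    using fortime_linear[OF n, of "maxtime total_body" "V ''n''"] fortime_linear[OF n, of "maxtime station_body" "V ''n''"]
      fortime_linear[OF n, of "maxtime output_body" h] const_le_mult[OF n, of "100 + maxtime dummy_init"]
    unfolding prepare_time_def add_mult_distrib by linarith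
  then show ?thesis by blast
qed

lemma linear_round: "\<exists>A. \<forall>N\<ge>1. round_time N \<le> A * N"
proof -
  let ?h = "IMul (C 16) (V ''N'')" and ?k = "maxtime (argmin_body prepS okS valS)"
  let ?c = "btime (ILe (V ''g'') (C 0)) + 3 + maxtime finishS + 1"
  have "round_time N \<le> (?c + (?k + 2 * itime ?h + 40) * 16) * N" if N: "1 \<le> N" for N
  proof -
    have "fortime (16 * N) ?k ?h \<le> (?k + 2 * itime ?h + 40) * (16 * N)" using N by (intro fortime_linear) simp
    then have "round_time N \<le> ?c + (?k + 2 * itime ?h + 40) * (16 * N)"
      unfolding round_time_def argmin_time_def by linarith
    also have "\<dots> \<le> ?c * N + (?k + 2 * itime ?h + 40) * (16 * N)" using const_le_mult[OF N, of ?c] by linarith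
    also have "\<dots> = (?c + (?k + 2 * itime ?h + 40) * 16) * N" by (simp only: add_mult_distrib mult.assoc)
    finally show ?thesis .
  qed
  then show ?thesis by blast
qed

lemma linear_attempt: "\<exists>A. \<forall>N\<ge>1. attempt_time N \<le> A * N"
proof -
  obtain A where A: "\<And>N. 1 \<le> N \<Longrightarrow> round_time N \<le> A * N" using linear_round by blast
  let ?c = "roots_time + aug_time + 5 * itime (C 4) + 100"
  have "attempt_time N \<le> (?c + 4 * A) * N" if N: "1 \<le> N" for N
  proof -
    have "attempt_time N \<le> ?c + 4 * round_time N" unfolding attempt_time_def fortime_def by simp
    also have "\<dots> \<le> ?c * N + 4 * (A * N)" using A[OF N] const_le_mult[OF N, of ?c] by linarith
    also have "\<dots> = (?c + 4 * A) * N" by (simp only: add_mult_distrib mult.assoc)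
    finally show ?thesis .
  qed
  then show ?thesis by blast
qed

lemma quadratic_phase: "\<exists>A. \<forall>N\<ge>1. phase_time N \<le> A * (N * N)"
proof -
  obtain A where A: "\<And>N. 1 \<le> N \<Longrightarrow> attempt_time N \<le> A * N" using linear_attempt by blast
  let ?h = "V ''N''" and ?g = "IMul (C 60) (V ''N'')"
  let ?a = "reopt_time + 2 * itime ?h + 40" and ?b = "A + 2 * itime ?g + 40"
  have "phase_time N \<le> (20 + ?a + ?b * 60) * (N * N)" if N: "1 \<le> N" for N
  proof -
    have NN: "1 \<le> N * N" "N \<le> N * N" using N by auto
    have 1: "fortime N reopt_time ?h \<le> ?a * (N * N)"
      using fortime_linear[OF N, of reopt_time ?h] mult_le_mono2[OF NN(2), of ?a] by linarith
    have "fortime (60 * N) (attempt_time N) ?g \<le> (attempt_time N + 2 * itime ?g + 40) * (60 * N)"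
      using N by (intro fortime_linear) simp
    also have "attempt_time N + 2 * itime ?g + 40 \<le> ?b * N"
      using A[OF N] const_le_mult[OF N, of "2 * itime ?g + 40"] unfolding add_mult_distrib by linarith
    then have "(attempt_time N + 2 * itime ?g + 40) * (60 * N) \<le> (?b * N) * (60 * N)" by (rule mult_le_mono1)
    also have "\<dots> = ?b * 60 * (N * N)" by (simp add: algebra_simps)
    finally have "phase_time N \<le> 20 + ?a * (N * N) + ?b * 60 * (N * N)" using 1 unfolding phase_time_def by linarith
    also have "\<dots> \<le> 20 * (N * N) + ?a * (N * N) + ?b * 60 * (N * N)" using NN(1) by linarith
    also have "\<dots> = (20 + ?a + ?b * 60) * (N * N)" by (simp only: add_mult_distrib)
    finally show ?thesis .
  qed
  then show ?thesis by blast
qed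

definition solve_time :: "nat \<Rightarrow> nat \<Rightarrow> nat" where
  "solve_time n \<kappa> = prepare_time n + (((\<kappa> - 1) * (maxtime double_body + 6) + 6) +
     (fortime \<kappa> (phase_time (Suc n)) (V ''K'') + fortime n (maxtime output_body) (V ''n'')))"

lemma solve_time_bound: "\<exists>A. \<forall>n\<ge>1. \<forall>\<kappa>\<ge>1. solve_time n \<kappa> \<le> A * (n * n * \<kappa>)"
proof -
  obtain P where P: "\<And>n. 1 \<le> n \<Longrightarrow> prepare_time n + fortime n (maxtime output_body) (V ''n'') \<le> P * n"
    using linear_prepare by blast
  obtain B where B: "\<And>N. 1 \<le> N \<Longrightarrow> phase_time N \<le> B * (N * N)" using quadratic_phase by blast
  let ?d = "maxtime double_body + 12" and ?e = "2 * itime (V ''K'') + 40"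
  have "solve_time n \<kappa> \<le> (P + ?d + 4 * B + ?e) * (n * n * \<kappa>)" if n: "1 \<le> n" and k: "1 \<le> \<kappa>" for n \<kappa>
  proof -
    let ?m = "n * n * \<kappa>"
    have m: "n \<le> ?m" "\<kappa> \<le> ?m" using n k by auto
    have 1: "P * n \<le> P * ?m" by (rule mult_le_mono2[OF m(1)])
    have "(\<kappa> - 1) * (maxtime double_body + 6) + 6 \<le> \<kappa> * (maxtime double_body + 6) + 6 * \<kappa>"
      using k by (intro add_mono mult_le_mono1) auto
    also have "\<dots> = ?d * \<kappa>" by (simp add: algebra_simps)
    also have "\<dots> \<le> ?d * ?m" by (rule mult_le_mono2[OF m(2)])
    finally have 2: "(\<kappa> - 1) * (maxtime double_body + 6) + 6 \<le> ?d * ?m" .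
    have "Suc n * Suc n \<le> (2 * n) * (2 * n)" using n by (intro mult_le_mono) auto
    then have "phase_time (Suc n) \<le> B * (4 * (n * n))"
      using B[of "Suc n"] mult_le_mono2[of "Suc n * Suc n" "4 * (n * n)" B] by simp
    then have "phase_time (Suc n) * \<kappa> \<le> B * (4 * (n * n)) * \<kappa>" by (rule mult_le_mono1)
    also have "\<dots> = 4 * B * ?m" by (simp add: algebra_simps)
    finally have "fortime \<kappa> (phase_time (Suc n)) (V ''K'') \<le> 4 * B * ?m + ?e * \<kappa>"
      using fortime_linear[OF k, of "phase_time (Suc n)" "V ''K''"] unfolding add_mult_distrib by linarith
    also have "\<dots> \<le> 4 * B * ?m + ?e * ?m" using mult_le_mono2[OF m(2), of ?e] by linarith
    finally have "solve_time n \<kappa> \<le> P * ?m + ?d * ?m + 4 * B * ?m + ?e * ?m"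
      using P[OF n] 1 2 unfolding solve_time_def by linarith
    then show ?thesis by (simp only: add_mult_distrib)
  qed
  then show ?thesis by blast
qed

context prog
begin

lemma runs_phases:
  assumes N: "0 < N" and st: "static s" and Ds: "imem s ''D'' 0 = 2 ^ \<kappa>" and K: "imem s ''K'' 0 = int \<kappa>" "1 \<le> \<kappa>"
    and bal: "balanced s" and so: "all_opt (rmem s ''p'') (2 ^ \<kappa>) (imem s ''y'')"
    and px: "surplus (imem s ''e'') \<le> (12 * int N + 8) * 2 ^ \<kappa>"
  shows "runs c (For ''H'' (V ''K'') phase) (fortime \<kappa> (phase_time N) (V ''K'')) s
    (\<lambda>s'. agree (insert ''H'' (imods phase)) (rmods phase) s s' \<and> base 1 s' \<and> surplus (imem s' ''e'') \<le> 0)"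
proof -
  let ?W = "insert ''H'' (imods phase)" and ?R = "rmods phase"
  define J where "J = (\<lambda>j s'. agree ?W ?R s s' \<and> j \<le> \<kappa> \<and> imem s' ''D'' 0 = 2 ^ (\<kappa> - j) \<and> static s' \<and> balanced s' \<and>
     all_opt (rmem s' ''p'') (2 ^ (\<kappa> - j)) (imem s' ''y'') \<and> surplus (imem s' ''e'') \<le> (12 * int N + 8) * 2 ^ (\<kappa> - j) \<and>
     (0 < j \<longrightarrow> surplus (imem s' ''e'') \<le> (12 * int N + 8) * (2 ^ (\<kappa> - j) - 1)))"
  have Jx: "J j (iwrite ''H'' 0 x s')" if "J j s'" for j x s'
    using that agree_iwrite[of "''H''" ?W ?R s s' 0 x] unfolding J_def static_def balanced_def by simp
  show ?thesis
  proof (rule runs_For[where I = J])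
    show "J 0 (iwrite ''H'' 0 0 s)" by (rule Jx) (simp add: J_def st Ds bal so px)
  next
    fix j s' assume "J j s'"
    then show "ival s' (V ''K'') = int \<kappa>"
      using agreeD(1)[of ?W ?R s s' "''K''"] K unfolding J_def by simp
  next
    fix j s' assume j: "j < \<kappa>" and J: "J j s'" and H: "imem s' ''H'' 0 = int j"
    let ?D = "2 ^ (\<kappa> - Suc j) :: int"
    have "\<kappa> - j = Suc (\<kappa> - Suc j)" using j by simp
    then have d: "(2::int) ^ (\<kappa> - j) = 2 * ?D" by simp
    have J': "agree ?W ?R s s'" "static s'" "imem s' ''D'' 0 = 2 * ?D" "balanced s'"
      "all_opt (rmem s' ''p'') (2 * ?D) (imem s' ''y'')" "surplus (imem s' ''e'') \<le> (12 * int N + 8) * (2 * ?D)"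
      using J unfolding J_def d by blast+
    have D0: "0 < ?D" by simp
    show "runs c phase (phase_time N) s' (\<lambda>s'. imem s' ''H'' 0 = int j \<and> J (Suc j) (iwrite ''H'' 0 (int j + 1) s'))"
    proof (rule runs_mono[OF runs_phase[OF J'(2,3) D0 J'(4,5) N J'(6)] order_refl], elim conjE)
      fix s'' assume q: "frame phase s' s''" "base ?D s''"
        "surplus (imem s'' ''e'') \<le> (12 * int N + 8) * (?D - 1)"
      have "agree ?W ?R s s''" by (rule agree_trans[OF J'(1) agree_mono[OF q(1)]]) auto
      moreover have "(12 * int N + 8) * (?D - 1) \<le> (12 * int N + 8) * ?D" by (intro mult_left_mono) auto
      then have "surplus (imem s'' ''e'') \<le> (12 * int N + 8) * ?D" using q(3) by linarith
      ultimately have "J (Suc j) s''" using q(2,3) j unfolding J_def base_def by simp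
      then have "J (Suc j) (iwrite ''H'' 0 (int j + 1) s'')" by (rule Jx)
      moreover have "imem s'' ''H'' 0 = int j" using agreeD(1)[OF q(1), of "''H''"] H by simp
      ultimately show "imem s'' ''H'' 0 = int j \<and> J (Suc j) (iwrite ''H'' 0 (int j + 1) s'')" by blast
    qed
  next
    fix s' assume J: "J \<kappa> s'"
    then show "agree ?W ?R s s' \<and> base 1 s' \<and> surplus (imem s' ''e'') \<le> 0"
      using K unfolding J_def base_def by auto
  qed
qed

end

lemma runs_output:
  assumes n: "imem s ''n'' 0 = int n"
  shows "runs c (For ''x'' (V ''n'') output_body) (fortime n (maxtime output_body) (V ''n'')) s
    (\<lambda>s'. \<forall>i\<in>{1..n}. imem s' ''d'' (int i) = imem s ''y'' (4 * int i + 2) \<and> imem s' ''b'' (int i) = imem s ''y'' (4 * int i + 3))"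
proof -
  define J where "J = (\<lambda>(j::nat) s'. agree {''x'', ''i'', ''d'', ''b''} {} s s' \<and>
     (\<forall>i\<in>{1..j}. imem s' ''d'' (int i) = imem s ''y'' (4 * int i + 2) \<and> imem s' ''b'' (int i) = imem s ''y'' (4 * int i + 3)))"
  show ?thesis
  proof (rule runs_For[where I = J])
    show "J 0 (iwrite ''x'' 0 0 s)" unfolding J_def agree_def by simp
  next
    fix j :: nat and s' assume "J j s'"
    then show "ival s' (V ''n'') = int n" using agreeD(1)[of "{''x'', ''i'', ''d'', ''b''}" "{}" s s' "''n''"] n unfolding J_def by simp
  next
    fix j :: nat and s' assume J: "J j s'" and x: "imem s' ''x'' 0 = int j"
    let ?t = "sem c output_body s'"
    have ag: "agree {''x'', ''i'', ''d'', ''b''} {} s s'" using J unfolding J_def by blast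
    have ag2: "agree {''i'', ''d'', ''b''} {} s' ?t" using sem_agree[of output_body s' c] by simp
    have ag3: "agree {''x'', ''i'', ''d'', ''b''} {} s (iwrite ''x'' 0 (int j + 1) ?t)"
      by (rule agree_iwrite, simp, rule agree_trans[OF ag agree_mono[OF ag2]]) auto
    have y: "imem s' ''y'' = imem s ''y''" using agreeD(1)[OF ag] by simp
    have db: "imem ?t ''d'' = (imem s' ''d'')(int j + 1 := imem s ''y'' (4 * (int j + 1) + 2))"
      "imem ?t ''b'' = (imem s' ''b'')(int j + 1 := imem s ''y'' (4 * (int j + 1) + 3))"
      using x y unfolding output_body_def ycell_def by simp_all
    have "imem ?t ''d'' (int i) = imem s ''y'' (4 * int i + 2) \<and> imem ?t ''b'' (int i) = imem s ''y'' (4 * int i + 3)"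
      if "i \<in> {1..Suc j}" for i
    proof (cases "i = Suc j")
      case True
      then show ?thesis unfolding db by (simp add: add.commute)
    next
      case False
      then have "i \<in> {1..j}" "int i \<noteq> int j + 1" using that by auto
      then show ?thesis using J unfolding J_def db by simp
    qed
    then have "J (Suc j) (iwrite ''x'' 0 (int j + 1) ?t)" unfolding J_def using ag3 by simp
    moreover have "imem ?t ''x'' 0 = int j" using agreeD(1)[OF ag2] x by simp
    ultimately show "runs c output_body (maxtime output_body) s' (\<lambda>s'. imem s' ''x'' 0 = int j \<and> J (Suc j) (iwrite ''x'' 0 (int j + 1) s'))"
      by (intro runs_sem) auto
  next
    fix s' assume "J n s'"
    then show "\<forall>i\<in>{1..n}. imem s' ''d'' (int i) = imem s ''y'' (4 * int i + 2) \<and> imem s' ''b'' (int i) = imem s ''y'' (4 * int i + 3)"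
      unfolding J_def by blast
  qed
qed

text \<open>The starting point is optimal on the coarsest grid because no other cost is attained there.\<close>

lemma grid_opt_big_step:
  assumes a: "adm l u m y" and "0 \<le> l" "u < D" "y 3 = 0" and D: "0 < D"
  shows "grid_opt f l u m (\<lambda>_. 0) D y"
proof -
  have "red f (\<lambda>_. 0) y \<le> red f (\<lambda>_. 0) x" if x: "adm l u m x" "same_grid D x y" for x
  proof -
    have z: "t = 0" if "D dvd t" "\<bar>t\<bar> < D" for t using that dvd_imp_le_int[of t D] D by linarith
    have "D dvd x 3 - y 3" "D dvd x 2 - y 2" using x(2) unfolding same_grid_def ball_nodes by auto
    moreover have "\<bar>x 3 - y 3\<bar> < D" "\<bar>x 2 - y 2\<bar> < D" using x(1) a assms(2-4) unfolding adm_def by auto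
    ultimately have "x 3 - y 3 = 0" "x 2 - y 2 = 0" using z by blast+
    then show ?thesis unfolding red_def by simp
  qed
  with a show ?thesis unfolding grid_opt_def by blast
qed

lemma runs_solve:
  assumes val: "valid_DR I" and n: "n = nstations I"
    and \<kappa>: "1 \<le> \<kappa>" "Ttot I < 2 ^ \<kappa>" "\<kappa> \<le> 1 \<or> 2 ^ (\<kappa> - 1) \<le> Ttot I"
  shows "runs (cfun I) solve_DR (solve_time n \<kappa>) (input_DR I)
    (\<lambda>s. optimal_DR I (output_vec s ''d'') (output_vec s ''b''))"
proof -
  let ?c = "cfun I"
  obtain d0 b0 where f: "feasible_DR I d0 b0" using val unfolding valid_DR_def by blast
  have main: "runs ?c (Seq (While (ILe (V ''D'') (V ''T'')) double_body)
     (Seq (For ''H'' (V ''K'') phase) (For ''x'' (V ''n'') output_body)))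
     (((\<kappa> - 1) * (maxtime double_body + 6) + 6) + (fortime \<kappa> (phase_time (Suc n)) (V ''K'') + fortime n (maxtime output_body) (V ''n'')))
     s1 (\<lambda>s. optimal_DR I (output_vec s ''d'') (output_vec s ''b''))"
    if st: "start I s1" for s1
  proof -
    define Y G where "Y = imem s1 ''y''" and "G = imem s1 ''f''"
    let ?W = "Btot I + slack I" and ?S = "\<Sum>i = 1..n. mid I i"
    have S1: "imem s1 ''n'' 0 = int n" "imem s1 ''N'' 0 = int (Suc n)"
      "\<And>i. i \<in> {1..n} \<Longrightarrow> imem s1 ''lo'' (int i) = low I i \<and> imem s1 ''up'' (int i) = upp I i \<and> imem s1 ''m'' (int i) = mid I i \<and>
        G (int i) = 1 \<and> Y (4 * int i) = - mid I i \<and> Y (4 * int i + 1) = 0 \<and>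
        Y (4 * int i + 2) = mid I i \<and> Y (4 * int i + 3) = 0"
      "imem s1 ''lo'' (int n + 1) = ?W" "imem s1 ''up'' (int n + 1) = ?W" "imem s1 ''m'' (int n + 1) = ?W" "G (int n + 1) = 0"
      "Y (4 * (int n + 1)) = - Btot I" "Y (4 * (int n + 1) + 1) = - slack I" "Y (4 * (int n + 1) + 2) = slack I" "Y (4 * (int n + 1) + 3) = Btot I"
      "imem s1 ''e'' 0 = Ttot I - ?S" "imem s1 ''e'' 1 = 0" "imem s1 ''e'' 2 = ?S - Ttot I" "imem s1 ''e'' 3 = 0"
      "rmem s1 ''p'' = (\<lambda>_. 0)" "imem s1 ''D'' 0 = 2" "imem s1 ''K'' 0 = 1" "imem s1 ''T'' 0 = Ttot I"
      using st unfolding start_def Let_def n Y_def G_def by auto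
    define F where "F = (\<lambda>i a b. real_of_int (G i) * ?c (nat i) a b)"
    have F: "F (int i) = cfun I i" if "i \<in> {1..n}" for i using S1(3)[OF that] unfolding F_def by simp
    have F0: "F (int n + 1) = (\<lambda>_ _. 0)" unfolding F_def S1(7) by simp
    have split: "i = int n + 1 \<or> (\<exists>j\<in>{1..n}. i = int j)" if "i \<in> {1..int (Suc n)}" for i
      using that by (cases "i = int n + 1") (auto intro!: bexI[of _ "nat i"])
    have net: "network (Suc n) F (imem s1 ''lo'') (imem s1 ''up'') (imem s1 ''m'') (embed I d0 b0)"
    proof
      fix i assume "i \<in> {1..int (Suc n)}"
      then consider "i = int n + 1" | j where "j \<in> {1..n}" "i = int j" using split by blast
      then show "multimodular (F i)"
      proof cases
        case 1 then show ?thesis unfolding 1 F0 by (rule ssubst) (rule multimodular_zero)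
      next
        case 2 then show ?thesis using F[OF 2(1)] val unfolding valid_DR_def n by simp
      qed
    next
      fix i assume "i \<in> {1..int (Suc n)}"
      then consider "i = int n + 1" | j where "j \<in> {1..n}" "i = int j" using split by blast
      then show "adm (imem s1 ''lo'' i) (imem s1 ''up'' i) (imem s1 ''m'' i) (embed I d0 b0 i)"
      proof cases
        case 1 then show ?thesis using embed_adm(2)[OF f] S1(4-6) n by simp
      next
        case 2 then show ?thesis using embed_adm(1)[OF f] S1(3)[OF 2(1)] n by simp
      qed
    qed
    interpret prog "Suc n" ?c G "imem s1 ''lo''" "imem s1 ''up''" "imem s1 ''m''" "embed I d0 b0"
      unfolding prog_def using net unfolding F_def .
    have Fe: "real_of_int (G i) * ?c (nat i) a b = F i a b" for i a b by (simp add: F_def)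
    have excess_eq: "excess Y' v = (\<Sum>i\<in>{1..int (Suc n)}. vec Y' i v) - target I v" if "v \<in> nodes" for Y' v
      unfolding excess_def sum_subtractf using embed_sum[OF f that] n by simp
    have st1: "static s1" unfolding static_def using S1(2) G_def by simp
    have bal1: "balanced s1"
      unfolding balanced_def
    proof
      fix v assume v: "v \<in> nodes"
      then have "v = 0 \<or> v = 1 \<or> v = 2 \<or> v = 3" unfolding nodes_eq by blast
      then show "imem s1 ''e'' v = excess (imem s1 ''y'') v"
        unfolding excess_eq[OF v] sum_with_dummy Y_def[symmetric]
        using S1(3) S1(8-15)
        by (elim disjE) (simp_all add: vec_def target_def sum_negf)
    qed
    have lu: "low I i \<le> upp I i" "0 \<le> low I i" "low I i \<le> d0 i + b0 i" if "i \<in> {1..n}" for i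
      using feasible_sums(2)[OF f] that n unfolding low_def by force+
    have mid_bounds: "low I i \<le> mid I i" "mid I i \<le> upp I i" "0 \<le> mid I i" "mid I i \<le> xbar I i + low I i" if "i \<in> {1..n}" for i
    proof -
      have "0 \<le> xbar I i" using val that n unfolding valid_DR_def xbar_def by auto
      then show "low I i \<le> mid I i" "mid I i \<le> upp I i" "0 \<le> mid I i" "mid I i \<le> xbar I i + low I i"
        using lu[OF that] unfolding mid_def by auto
    qed
    have "0 \<le> ?S" using mid_bounds by (intro sum_nonneg) auto
    moreover have "?S \<le> (\<Sum>i = 1..n. xbar I i + (d0 i + b0 i))"
      using mid_bounds lu by (intro sum_mono) force
    moreover have "\<dots> = 2 * Ttot I" using feasible_sums(1)[OF f] n unfolding Ttot_sum by (simp add: sum.distrib)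
    ultimately have S: "0 \<le> ?S" "?S \<le> 2 * Ttot I" by auto
    have "surplus (imem s1 ''e'') \<le> Ttot I" unfolding surplus_def sum_nodes S1(12-15) using S by auto
    also have "\<dots> \<le> 2 ^ \<kappa>" using \<kappa> by simp
    also have "\<dots> \<le> (12 * int (Suc n) + 8) * 2 ^ \<kappa>" by simp
    finally have px: "surplus (imem s1 ''e'') \<le> (12 * int (Suc n) + 8) * 2 ^ \<kappa>" .
    have so: "all_opt (\<lambda>_. 0) (2 ^ \<kappa>) Y"
      unfolding all_opt_def unfolding Fe
    proof
      fix i assume "i \<in> {1..int (Suc n)}"
      then consider "i = int n + 1" | j where "j \<in> {1..n}" "i = int j" using split by blast
      then show "grid_opt (F i) (imem s1 ''lo'' i) (imem s1 ''up'' i) (imem s1 ''m'' i) (\<lambda>_. 0) (2 ^ \<kappa>) (vec Y i)"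
      proof cases
        case 1
        have "0 \<le> Btot I" using val unfolding valid_DR_def Btot_def by (intro sum_nonneg) auto
        then have "adm ?W ?W ?W (vec Y (int n + 1))"
          using slack_nonneg[OF f] S1(8-11) unfolding adm_def vec_def by simp
        then show ?thesis unfolding 1 S1(4-6) F0 grid_opt_def red_def by simp
      next
        case 2
        have "adm (low I j) (upp I j) (mid I j) (vec Y (int j))"
          using S1(3)[OF 2(1)] mid_bounds[OF 2(1)] unfolding adm_def vec_def by simp
        moreover have "upp I j < 2 ^ \<kappa>" using \<kappa>(2) unfolding upp_def by simp
        moreover have "vec Y (int j) 3 = 0" using S1(3)[OF 2(1)] unfolding vec_def by simp
        ultimately show ?thesis using S1(3)[OF 2(1)] lu(2)[OF 2(1)] unfolding 2(2) by (simp add: grid_opt_big_step)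
      qed
    qed
    have l1: "runs ?c (While (ILe (V ''D'') (V ''T'')) double_body) ((\<kappa> - 1) * (maxtime double_body + 6) + 6) s1
      (\<lambda>s'. agree {''D'', ''K''} {} s1 s' \<and> imem s' ''D'' 0 = 2 ^ \<kappa> \<and> imem s' ''K'' 0 = int \<kappa>)"
      using runs_double[OF \<kappa>(2,3), of 1 s1 ?c] \<kappa>(1) S1(17-19) by simp
    have l3: "runs ?c (For ''x'' (V ''n'') output_body) (fortime n (maxtime output_body) (V ''n'')) s3
        (\<lambda>s. optimal_DR I (output_vec s ''d'') (output_vec s ''b''))"
      if n3: "imem s3 ''n'' 0 = int n" and b3: "base 1 s3" and px3: "surplus (imem s3 ''e'') \<le> 0" for s3
    proof (rule runs_mono[OF runs_output[OF n3] order_refl])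
      fix s4 :: state assume o: "\<forall>i\<in>{1..n}. imem s4 ''d'' (int i) = imem s3 ''y'' (4 * int i + 2) \<and> imem s4 ''b'' (int i) = imem s3 ''y'' (4 * int i + 3)"
      let ?Y = "imem s3 ''y''" and ?p = "rmem s3 ''p''"
      have op: "grid_opt (F i) (imem s1 ''lo'' i) (imem s1 ''up'' i) (imem s1 ''m'' i) ?p 1 (vec ?Y i)" if "i \<in> {1..int (Suc n)}" for i
        using b3 that unfolding base_def all_opt_def unfolding Fe by blast
      have e3: "imem s3 ''e'' v = excess ?Y v" if "v \<in> nodes" for v using b3 that unfolding base_def balanced_def by blast
      have "excess ?Y 0 + excess ?Y 1 + excess ?Y 2 + excess ?Y 3 = (\<Sum>i\<in>{1..int (Suc n)}. (\<Sum>v\<in>nodes. vec ?Y i v) - (\<Sum>v\<in>nodes. embed I d0 b0 i v))"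
        unfolding excess_def sum_nodes by (simp add: sum.distrib sum_subtractf)
      also have "\<dots> = 0"
      proof (rule sum.neutral, rule ballI)
        fix i assume i: "i \<in> {1..int (Suc n)}"
        show "(\<Sum>v\<in>nodes. vec ?Y i v) - (\<Sum>v\<in>nodes. embed I d0 b0 i v) = 0"
          using grid_optD(1)[OF op[OF i]] Zadm[OF i] unfolding adm_def sum_nodes by simp
      qed
      finally have "imem s3 ''e'' 0 + imem s3 ''e'' 1 + imem s3 ''e'' 2 + imem s3 ''e'' 3 = 0" using e3 by simp
      then have "imem s3 ''e'' 0 = 0 \<and> imem s3 ''e'' 1 = 0 \<and> imem s3 ''e'' 2 = 0 \<and> imem s3 ''e'' 3 = 0"
        using px3 unfolding surplus_def sum_nodes by linarith
      then have "\<forall>v\<in>nodes. excess ?Y v = 0" using e3 unfolding ball_nodes by simp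
      then have tot: "(\<Sum>i\<in>{1..int (Suc n)}. vec ?Y i v) = target I v" if "v \<in> nodes" for v
        using excess_eq[OF that, of ?Y] that by simp
      show "optimal_DR I (output_vec s4 ''d'') (output_vec s4 ''b'')"
      proof (rule optimal_certificate[OF val n, where F = F and p = ?p and Y = ?Y])
        fix i assume i: "i \<in> {1..n}"
        then show "grid_opt (F (int i)) (low I i) (upp I i) (mid I i) ?p 1 (vec ?Y (int i))"
          using op[of "int i"] S1(3)[OF i] by simp
      next
        show "grid_opt (F (int n + 1)) ?W ?W ?W ?p 1 (vec ?Y (int n + 1))" using op[of "int n + 1"] S1(4-6) by simp
      qed (use F F0 tot o in \<open>auto simp: output_vec_def\<close>)
    qed
    show ?thesis
    proof (rule runs_SeqI[OF l1], elim conjE)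
      fix s2 assume a: "agree {''D'', ''K''} {} s1 s2" and D2: "imem s2 ''D'' 0 = 2 ^ \<kappa>" and K2: "imem s2 ''K'' 0 = int \<kappa>"
      have s2: "imem s2 ''e'' = imem s1 ''e''" "imem s2 ''y'' = Y" "rmem s2 ''p'' = (\<lambda>_. 0)" "imem s2 ''n'' 0 = int n"
        using agreeD[OF a] S1 unfolding Y_def by simp_all
      have st2: "static s2" by (rule static_agree[OF st1 a]) simp
      have bal2: "balanced s2" by (rule balanced_agree[OF bal1 a]) simp_all
      note ph = runs_phases[OF _ st2 D2 K2 \<kappa>(1) bal2, unfolded s2, OF _ so px]
      show "runs ?c (Seq (For ''H'' (V ''K'') phase) (For ''x'' (V ''n'') output_body))
        (fortime \<kappa> (phase_time (Suc n)) (V ''K'') + fortime n (maxtime output_body) (V ''n'')) s2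
        (\<lambda>s. optimal_DR I (output_vec s ''d'') (output_vec s ''b''))"
      proof (rule runs_SeqI[OF ph], simp, elim conjE)
        fix s3 assume q: "agree (insert ''H'' (imods phase)) (rmods phase) s2 s3" "base 1 s3" "surplus (imem s3 ''e'') \<le> 0"
        have "imem s3 ''n'' 0 = int n" using agreeD(1)[OF q(1), of "''n''"] s2 by simp
        then show "runs ?c (For ''x'' (V ''n'') output_body) (fortime n (maxtime output_body) (V ''n'')) s3
          (\<lambda>s. optimal_DR I (output_vec s ''d'') (output_vec s ''b''))" using l3 q by blast
      qed
    qed
  qed
  show ?thesis unfolding solve_DR_def solve_time_def n
    by (rule runs_SeqI[OF runs_prepare main[unfolded n]])
qed

text \<open>\<open>log T = log n + log (T / n)\<close>, and a sum of two factors that are at least 1 is at most twice their product.\<close>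

lemma phase_count:
  assumes T: "0 \<le> T" and n: "1 \<le> n"
  obtains \<kappa> :: nat where "1 \<le> \<kappa>" "T < 2 ^ \<kappa>" "\<kappa> \<le> 1 \<or> 2 ^ (\<kappa> - 1) \<le> T"
    "real \<kappa> \<le> 3 * logfac (real n) * logfac (real_of_int T / real n)"
proof -
  let ?a = "logfac (real n)" and ?b = "logfac (real_of_int T / real n)"
  have ab: "1 \<le> ?a" "1 \<le> ?b" unfolding logfac_def by auto
  then have ab1: "1 \<le> ?a * ?b" using mult_mono[of 1 ?a 1 ?b] by simp
  define Q where "Q = (\<lambda>k::nat. 1 \<le> k \<and> T < 2 ^ k)"
  have ex: "\<exists>k. Q k"
  proof (rule exI[of _ "Suc (nat T)"])
    have "nat T < 2 ^ nat T" by (rule less_exp)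
    then have "int (nat T) < int (2 ^ nat T)" by (simp only: of_nat_less_iff)
    then have "T < 2 ^ nat T" using T by simp
    also have "\<dots> \<le> 2 ^ Suc (nat T)" by simp
    finally show "Q (Suc (nat T))" unfolding Q_def by simp
  qed
  define \<kappa> where "\<kappa> = (LEAST k. Q k)"
  have q: "Q \<kappa>" unfolding \<kappa>_def by (rule LeastI_ex[OF ex])
  have least: "\<kappa> \<le> 1 \<or> 2 ^ (\<kappa> - 1) \<le> T"
  proof (cases "\<kappa> \<le> 1")
    case False
    then have "\<not> Q (\<kappa> - 1)" using not_less_Least[of "\<kappa> - 1" Q] unfolding \<kappa>_def[symmetric] by simp
    then show ?thesis using False unfolding Q_def by auto
  qed simp
  have "real \<kappa> \<le> 3 * ?a * ?b"
  proof (cases "\<kappa> \<le> 1")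
    case True
    then show ?thesis using ab1 by simp
  next
    case False
    then have p: "2 ^ (\<kappa> - 1) \<le> T" using least by simp
    have T1: "0 < T" using p less_le_trans[of 0 "2 ^ (\<kappa> - 1)" T] by simp
    have "(2::real) ^ (\<kappa> - 1) \<le> real_of_int T" using p by (metis of_int_le_iff of_int_numeral of_int_power)
    then have "2 powr real (\<kappa> - 1) \<le> real_of_int T" by (simp add: powr_realpow)
    then have "real (\<kappa> - 1) \<le> log 2 (real_of_int T)" using T1 by (subst le_log_iff) auto
    also have "\<dots> = log 2 (real n) + log 2 (real_of_int T / real n)"
      using T1 n by (simp add: log_divide)
    also have "\<dots> \<le> ?a + ?b" unfolding logfac_def by simp
    also have "\<dots> \<le> 2 * (?a * ?b)"
    proof -
      have "0 \<le> (?a - 1) * (?b - 1)" using ab by simp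
      then have "?a + ?b \<le> ?a * ?b + 1" by (simp add: algebra_simps)
      then show ?thesis using ab1 by linarith
    qed
    finally have "real \<kappa> \<le> 2 * (?a * ?b) + 1" using False by (simp add: of_nat_diff)
    then show ?thesis using ab1 by (simp add: mult.assoc)
  qed
  then show thesis using that q least unfolding Q_def by blast
qed

theorem mainTheorem2:
  "\<exists>(P :: com) (K :: real). \<forall>I :: instance_DR. valid_DR I \<longrightarrow>
     (\<exists>t s. exec (cfun I) P (input_DR I) t s \<and>
        optimal_DR I (output_vec s ''d'') (output_vec s ''b'') \<and>
        real t \<le> K * (real (nstations I))\<^sup>2 * logfac (real (nstations I)) *
                     logfac (real_of_int (Dtot I + Btot I) / real (nstations I)))"
proof -
  obtain A where A: "\<And>n \<kappa>. 1 \<le> n \<Longrightarrow> 1 \<le> \<kappa> \<Longrightarrow> solve_time n \<kappa> \<le> A * (n * n * \<kappa>)"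
    using solve_time_bound by blast
  have "\<exists>t s. exec (cfun I) solve_DR (input_DR I) t s \<and>
        optimal_DR I (output_vec s ''d'') (output_vec s ''b'') \<and>
        real t \<le> (3 * real A) * (real (nstations I))\<^sup>2 * logfac (real (nstations I)) *
                     logfac (real_of_int (Dtot I + Btot I) / real (nstations I))" if val: "valid_DR I" for I
  proof -
    define n where "n = nstations I"
    have n1: "1 \<le> n" using val unfolding valid_DR_def n_def by simp
    have T0: "0 \<le> Ttot I" using val unfolding valid_DR_def Ttot_sum xbar_def by (intro sum_nonneg) auto
    let ?ab = "logfac (real n) * logfac (real_of_int (Ttot I) / real n)"
    obtain \<kappa> where \<kappa>: "1 \<le> \<kappa>" "Ttot I < 2 ^ \<kappa>" "\<kappa> \<le> 1 \<or> 2 ^ (\<kappa> - 1) \<le> Ttot I"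
      "real \<kappa> \<le> 3 * logfac (real n) * logfac (real_of_int (Ttot I) / real n)"
      using phase_count[OF T0 n1] by blast
    obtain t s where ts: "exec (cfun I) solve_DR (input_DR I) t s" "t \<le> solve_time n \<kappa>"
      "optimal_DR I (output_vec s ''d'') (output_vec s ''b'')"
      using runs_solve[OF val n_def \<kappa>(1-3)] unfolding runs_def by blast
    have "t \<le> A * (n * n * \<kappa>)" using ts(2) A[OF n1 \<kappa>(1)] by linarith
    then have "real t \<le> real (A * (n * n * \<kappa>))" by (simp only: of_nat_le_iff)
    also have "\<dots> = real A * (real n)\<^sup>2 * real \<kappa>" by (simp add: power2_eq_square)
    also have "\<dots> \<le> real A * (real n)\<^sup>2 * (3 * ?ab)"
      using \<kappa>(4) by (intro mult_left_mono) (auto simp: mult.assoc)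
    finally have "real t \<le> (3 * real A) * (real n)\<^sup>2 * logfac (real n) * logfac (real_of_int (Ttot I) / real n)"
      by (simp add: mult.assoc mult.left_commute)
    with ts show ?thesis unfolding n_def Ttot_def by blast
  qed
  then show ?thesis by blast
qed

end
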